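(* Suppose that $\Lambda$ is a row-finite $k$-graph with no sources, that $\eta:\Lambda\to G$ is a functor from $\Lambda$ into a group $G$, and that $B$ is the Fell bundle over $G$ with fibres $B_g=\overline{\operatorname{span}}\{s_\lambda s_\mu^*:\eta(\lambda)\eta(\mu)^{-1}=g\}\subset C^*(\Lambda)$. Suppose that $\sigma\in Z^2(G,\mathbb{T})$ is a cocycle. Let $\{s_\lambda:\lambda\in\Lambda\}$ be the canonical Cuntz--Krieger family in $C^*(\Lambda)$, viewed as a subset of $B$ (with $s_\lambda\in B_{\eta(\lambda)}$), and let $\pi^\sigma$ be the canonical representation of the deformed Fell bundle $B(\sigma)$ in $C^*(B(\sigma))$. Then the elements $t_\lambda:=\pi^\sigma_{\eta(\lambda)}(s_\lambda)$ of $C^*(B(\sigma))$ satisfy (CK1) $\{q_v:=t_v:v\in\Lambda^0\}$ consists of mutually orthogonal projections; (CK2) $t_\lambda t_\mu=\sigma(\eta(\lambda),\eta(\mu))\,t_{\lambda\mu}$ whenever $r(\mu)=s(\lambda)$; (CK3) $t_\lambda^*t_\lambda=q_{s(\lambda)}$ for all $\lambda\in\Lambda$; (CK4) $q_v=\sum_{\lambda\in v\Lambda^n}t_\lambda t_\lambda^*$ for all $v\in\Lambda^0$ and $n\in\mathbb{N}^k$. Conversely, given a family $\{T_\lambda:\lambda\in\Lambda\}$ in a $C^*$-algebra $A$ satisfying (CK1)--(CK4) (with $T_\lambda$ in place of $t_\lambda$), there is a homomorphism $\rho_T:C^*(B(\sigma))\to A$ such that $\rho_T(t_\lambda)=T_\lambda$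 for all $\lambda\in\Lambda$.
   Context: All groups are discrete. A $k$-graph is a countable small category $\Lambda$ with a functor $d:\Lambda\to\mathbb{N}^k$ satisfying the factorisation property: if $d(\lambda)=m+n$, there are unique $\mu,\nu$ with $\lambda=\mu\nu$, $d(\mu)=m$, $d(\nu)=n$. Range and source (codomain and domain) are written $r,s$, so $\lambda\mu$ is defined exactly when $s(\lambda)=r(\mu)$. $\Lambda^n:=d^{-1}(n)$, $\Lambda^0$ is identified with the set of objects, $v\Lambda^n:=\{\lambda\in\Lambda^n:r(\lambda)=v\}$. Row-finite with no sources means every $v\Lambda^n$ is finite and nonempty. $C^*(\Lambda)$ is the universal $C^*$-algebra generated by a Cuntz--Krieger family $\{s_\lambda\}$: the $p_v:=s_v$ ($v\in\Lambda^0$) are mutually orthogonal projections; $s_\lambda s_\mu=s_{\lambda\mu}$ if $s(\lambda)=r(\mu)$; $s_\lambda^*s_\lambda=p_{s(\lambda)}$; $p_v=\sum_{\lambda\in v\Lambda^n}s_\lambda s_\lambda^*$. A functor $\eta:\Lambda\to G$ is a map with $\eta(\lambda\mu)=\eta(\lambda)\eta(\mu)$ for composable $\lambda,\mu$ and $\eta(v)=e$ for $v\in\Lambda^0$. A Fell bundle over $G$ is a set $B$ with a map $p:B\to G$ whose fibres $B_g=p^{-1}(g)$ are complex Banach spaces, with an associative multiplication and an involution such that: $p(bc)=p(b)p(c)$; multiplication is bilinear $B_g\times B_h\to B_{gh}$ with $\|bc\|\le\|b\|\,\|c\|$; $b\mapsto b^*$ is conjugate linear $B_g\to B_{g^{-1}}$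 with $(bc)^*=c^*b^*$, $\|b^*b\|=\|b\|^2$ (so $B_e$ is a $C^*$-algebra); and $b^*b\ge0$ in $B_e$. The subspaces $B_g\subset C^*(\Lambda)$ of the claim form such a bundle $B=\bigsqcup_gB_g$ with the operations and norm of $C^*(\Lambda)$. $Z^2(G,\mathbb{T})$ is the set of $\sigma:G\times G\to\mathbb{T}$ with $\sigma(e,g)=\sigma(g,e)=1$ and $\sigma(g,h)\sigma(gh,k)=\sigma(g,hk)\sigma(h,k)$. The deformed bundle $B(\sigma)$ is the Fell bundle with the same set, projection and Banach space fibres as $B$, and operations $b\cdot_\sigma c=\sigma(g,h)bc$, $b^{*_\sigma}=\overline{\sigma(g,g^{-1})}b^*$ for $b\in B_g$, $c\in B_h$. A representation of a Fell bundle $B$ in a $C^*$-algebra $C$ consists of linear maps $\pi_g:B_g\to C$ with $\pi_{gh}(bc)=\pi_g(b)\pi_h(c)$, $\pi_g(b)^*=\pi_{g^{-1}}(b^* )$ and $\pi_e$ nondegenerate. $C^*(B)$ is the $C^*$-algebra generated by a universal such representation (the canonical representation). *)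

theory Defs
  imports Complex_Main "HOL-Library.Countable_Set" "HOL-Algebra.Ring"
begin

section \<open>Complex Banach spaces and C*-algebras on carrier sets\<close>

text \<open>Structures live on carrier sets, not on types, because the universal properties below
  quantify over all C*-algebras.\<close>

locale complex_banach_space =
  fixes V :: "'a set" and plus :: "'a \<Rightarrow> 'a \<Rightarrow> 'a" and zer :: 'a
    and scl :: "complex \<Rightarrow> 'a \<Rightarrow> 'a" and nrm :: "'a \<Rightarrow> real"
  assumes zero_in: "zer \<in> V"
    and plus_in: "\<lbrakk>x \<in> V; y \<in> V\<rbrakk> \<Longrightarrow> plus x y \<in> V"
    and scl_in: "x \<in> V \<Longrightarrow> scl z x \<in> V"
    and plus_assoc: "\<lbrakk>x \<in> V; y \<in> V; w \<in> V\<rbrakk> \<Longrightarrow> plus (plus x y) w = plus x (plus y w)"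
    and plus_commute: "\<lbrakk>x \<in> V; y \<in> V\<rbrakk> \<Longrightarrow> plus x y = plus y x"
    and plus_zero: "x \<in> V \<Longrightarrow> plus zer x = x"
    and plus_neg: "x \<in> V \<Longrightarrow> plus (scl (- 1) x) x = zer"
    and scl_one: "x \<in> V \<Longrightarrow> scl 1 x = x"
    and scl_scl: "x \<in> V \<Longrightarrow> scl z (scl z' x) = scl (z * z') x"
    and scl_plus: "\<lbrakk>x \<in> V; y \<in> V\<rbrakk> \<Longrightarrow> scl z (plus x y) = plus (scl z x) (scl z y)"
    and add_scl: "x \<in> V \<Longrightarrow> scl (z + z') x = plus (scl z x) (scl z' x)"
    and nrm_eq_0: "x \<in> V \<Longrightarrow> nrm x = 0 \<longleftrightarrow> x = zer"
    and nrm_plus: "\<lbrakk>x \<in> V; y \<in> V\<rbrakk> \<Longrightarrow> nrm (plus x y) \<le> nrm x + nrm y"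
    and nrm_scl: "x \<in> V \<Longrightarrow> nrm (scl z x) = cmod z * nrm x"
    and complete:
      "\<lbrakk>\<forall>n. X n \<in> V; \<forall>\<epsilon>>0. \<exists>N. \<forall>m\<ge>N. \<forall>n\<ge>N. nrm (plus (X m) (scl (- 1) (X n))) < \<epsilon>\<rbrakk>
        \<Longrightarrow> \<exists>x\<in>V. (\<lambda>n. nrm (plus (X n) (scl (- 1) x))) \<longlonglongrightarrow> 0"

text \<open>C*-algebras need not be unital: of the fields of the record \<open>ring\<close>, the unit is never
  used. The record is reused for its notation and for finite sums.\<close>

record 'a cstar = "'a ring" +
  scale :: "complex \<Rightarrow> 'a \<Rightarrow> 'a"
  adj :: "'a \<Rightarrow> 'a"
  cnorm :: "'a \<Rightarrow> real"

locale cstar_algebra =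
  complex_banach_space "carrier A" "add A" "zero A" "scale A" "cnorm A"
  for A :: "'a cstar" (structure) +
  assumes mult_in: "\<lbrakk>a \<in> carrier A; b \<in> carrier A\<rbrakk> \<Longrightarrow> a \<otimes> b \<in> carrier A"
    and adj_in: "a \<in> carrier A \<Longrightarrow> adj A a \<in> carrier A"
    and mult_assoc: "\<lbrakk>a \<in> carrier A; b \<in> carrier A; c \<in> carrier A\<rbrakk>
          \<Longrightarrow> (a \<otimes> b) \<otimes> c = a \<otimes> (b \<otimes> c)"
    and mult_plus: "\<lbrakk>a \<in> carrier A; b \<in> carrier A; c \<in> carrier A\<rbrakk>
          \<Longrightarrow> a \<otimes> (b \<oplus> c) = a \<otimes> b \<oplus> a \<otimes> c"
    and plus_mult: "\<lbrakk>a \<in> carrier A; b \<in> carrier A; c \<in> carrier A\<rbrakk>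
          \<Longrightarrow> (a \<oplus> b) \<otimes> c = a \<otimes> c \<oplus> b \<otimes> c"
    and scale_mult: "\<lbrakk>a \<in> carrier A; b \<in> carrier A\<rbrakk> \<Longrightarrow> scale A z a \<otimes> b = scale A z (a \<otimes> b)"
    and mult_scale: "\<lbrakk>a \<in> carrier A; b \<in> carrier A\<rbrakk> \<Longrightarrow> a \<otimes> scale A z b = scale A z (a \<otimes> b)"
    and adj_adj: "a \<in> carrier A \<Longrightarrow> adj A (adj A a) = a"
    and adj_plus: "\<lbrakk>a \<in> carrier A; b \<in> carrier A\<rbrakk> \<Longrightarrow> adj A (a \<oplus> b) = adj A a \<oplus> adj A b"
    and adj_scale: "a \<in> carrier A \<Longrightarrow> adj A (scale A z a) = scale A (cnj z) (adj A a)"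
    and adj_mult: "\<lbrakk>a \<in> carrier A; b \<in> carrier A\<rbrakk> \<Longrightarrow> adj A (a \<otimes> b) = adj A b \<otimes> adj A a"
    and norm_mult: "\<lbrakk>a \<in> carrier A; b \<in> carrier A\<rbrakk> \<Longrightarrow> cnorm A (a \<otimes> b) \<le> cnorm A a * cnorm A b"
    and cstar_identity: "a \<in> carrier A \<Longrightarrow> cnorm A (adj A a \<otimes> a) = (cnorm A a)\<^sup>2"

definition cstar_hom :: "'a cstar \<Rightarrow> 'b cstar \<Rightarrow> ('a \<Rightarrow> 'b) \<Rightarrow> bool" where
  "cstar_hom A B \<rho> \<longleftrightarrow>
    \<rho> \<in> carrier A \<rightarrow> carrier B \<and>
    (\<forall>a\<in>carrier A. \<forall>b\<in>carrier A. \<rho> (a \<oplus>\<^bsub>A\<^esub> b) = \<rho> a \<oplus>\<^bsub>B\<^esub> \<rho> b) \<and>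
    (\<forall>z. \<forall>a\<in>carrier A. \<rho> (scale A z a) = scale B z (\<rho> a)) \<and>
    (\<forall>a\<in>carrier A. \<forall>b\<in>carrier A. \<rho> (a \<otimes>\<^bsub>A\<^esub> b) = \<rho> a \<otimes>\<^bsub>B\<^esub> \<rho> b) \<and>
    (\<forall>a\<in>carrier A. \<rho> (adj A a) = adj B (\<rho> a))"

definition lin_subspace :: "'a cstar \<Rightarrow> 'a set \<Rightarrow> bool" where
  "lin_subspace A S \<longleftrightarrow> S \<subseteq> carrier A \<and> \<zero>\<^bsub>A\<^esub> \<in> S \<and>
    (\<forall>a\<in>S. \<forall>b\<in>S. a \<oplus>\<^bsub>A\<^esub> b \<in> S) \<and> (\<forall>z. \<forall>a\<in>S. scale A z a \<in> S)"

definition lin_span :: "'a cstar \<Rightarrow> 'a set \<Rightarrow> 'a set" where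
  "lin_span A X = \<Inter>{S. lin_subspace A S \<and> X \<subseteq> S}"

definition norm_closure :: "'a cstar \<Rightarrow> 'a set \<Rightarrow> 'a set" where
  "norm_closure A S =
    {a \<in> carrier A. \<forall>\<epsilon>>0. \<exists>x\<in>S. cnorm A (a \<oplus>\<^bsub>A\<^esub> scale A (- 1) x) < \<epsilon>}"

definition cstar_subalgebra :: "'a cstar \<Rightarrow> 'a set \<Rightarrow> bool" where
  "cstar_subalgebra A S \<longleftrightarrow> lin_subspace A S \<and>
    (\<forall>a\<in>S. \<forall>b\<in>S. a \<otimes>\<^bsub>A\<^esub> b \<in> S) \<and> (\<forall>a\<in>S. adj A a \<in> S) \<and> norm_closure A S = S"

definition generates :: "'a cstar \<Rightarrow> 'a set \<Rightarrow> bool" where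
  "generates A X \<longleftrightarrow>
    X \<subseteq> carrier A \<and> (\<forall>S. cstar_subalgebra A S \<and> X \<subseteq> S \<longrightarrow> S = carrier A)"

text \<open>A universal property cannot quantify over C*-algebras of all types, but testing it on
  algebras carried by the following type is as good. An element of the C*-algebra generated by
  a family indexed by \<open>'x\<close> is the limit of a sequence of *-polynomials in the family, that is,
  of finitely supported functions on words in the letters \<open>(x, False)\<close> (for \<open>x\<close>) and
  \<open>(x, True)\<close> (for its adjoint). Choosing such a sequence for each element embeds the generated
  C*-algebra in the type below, so that every C*-algebra generated by such a family, of
  whatever type, is isomorphic to one carried by a subset of this type.\<close>

type_synonym 'x test_elem = "nat \<Rightarrow> ('x \<times> bool) list \<Rightarrow> complex"

section \<open>Higher-rank graphs and Cuntz-Krieger families\<close>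

text \<open>Categories are presented by their morphisms only: an object is identified with its
  identity morphism, so \<open>rng\<close> and \<open>src\<close> take values in the identity morphisms. The composition
  \<open>pcomp \<Lambda> \<kappa> \<mu>\<close> is meaningful if \<open>src \<Lambda> \<kappa> = rng \<Lambda> \<mu>\<close>. The elements of the monoid
  \<open>Nk k\<close> are the sequences that vanish from position \<open>k\<close> on.\<close>

definition Nk :: "nat \<Rightarrow> (nat \<Rightarrow> nat) set" where
  "Nk k = {n. \<forall>i\<ge>k. n i = 0}"

record 'l graph_cat =
  paths :: "'l set"
  rng :: "'l \<Rightarrow> 'l"
  src :: "'l \<Rightarrow> 'l"
  pcomp :: "'l \<Rightarrow> 'l \<Rightarrow> 'l"
  deg :: "'l \<Rightarrow> nat \<Rightarrow> nat"

locale k_graph =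
  fixes k :: nat and \<Lambda> :: "'l graph_cat"
  assumes countable_paths: "countable (paths \<Lambda>)"
    and rng_in: "\<kappa> \<in> paths \<Lambda> \<Longrightarrow> rng \<Lambda> \<kappa> \<in> paths \<Lambda>"
    and src_in: "\<kappa> \<in> paths \<Lambda> \<Longrightarrow> src \<Lambda> \<kappa> \<in> paths \<Lambda>"
    and rng_rng: "\<kappa> \<in> paths \<Lambda> \<Longrightarrow> rng \<Lambda> (rng \<Lambda> \<kappa>) = rng \<Lambda> \<kappa>"
    and src_rng: "\<kappa> \<in> paths \<Lambda> \<Longrightarrow> src \<Lambda> (rng \<Lambda> \<kappa>) = rng \<Lambda> \<kappa>"
    and rng_src: "\<kappa> \<in> paths \<Lambda> \<Longrightarrow> rng \<Lambda> (src \<Lambda> \<kappa>) = src \<Lambda> \<kappa>"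
    and src_src: "\<kappa> \<in> paths \<Lambda> \<Longrightarrow> src \<Lambda> (src \<Lambda> \<kappa>) = src \<Lambda> \<kappa>"
    and comp_in: "\<lbrakk>\<kappa> \<in> paths \<Lambda>; \<mu> \<in> paths \<Lambda>; src \<Lambda> \<kappa> = rng \<Lambda> \<mu>\<rbrakk>
          \<Longrightarrow> pcomp \<Lambda> \<kappa> \<mu> \<in> paths \<Lambda>"
    and rng_comp: "\<lbrakk>\<kappa> \<in> paths \<Lambda>; \<mu> \<in> paths \<Lambda>; src \<Lambda> \<kappa> = rng \<Lambda> \<mu>\<rbrakk>
          \<Longrightarrow> rng \<Lambda> (pcomp \<Lambda> \<kappa> \<mu>) = rng \<Lambda> \<kappa>"
    and src_comp: "\<lbrakk>\<kappa> \<in> paths \<Lambda>; \<mu> \<in> paths \<Lambda>; src \<Lambda> \<kappa> = rng \<Lambda> \<mu>\<rbrakk>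
          \<Longrightarrow> src \<Lambda> (pcomp \<Lambda> \<kappa> \<mu>) = src \<Lambda> \<mu>"
    and comp_assoc: "\<lbrakk>\<kappa> \<in> paths \<Lambda>; \<mu> \<in> paths \<Lambda>; \<nu> \<in> paths \<Lambda>;
          src \<Lambda> \<kappa> = rng \<Lambda> \<mu>; src \<Lambda> \<mu> = rng \<Lambda> \<nu>\<rbrakk>
          \<Longrightarrow> pcomp \<Lambda> (pcomp \<Lambda> \<kappa> \<mu>) \<nu> = pcomp \<Lambda> \<kappa> (pcomp \<Lambda> \<mu> \<nu>)"
    and comp_rng: "\<kappa> \<in> paths \<Lambda> \<Longrightarrow> pcomp \<Lambda> (rng \<Lambda> \<kappa>) \<kappa> = \<kappa>"
    and comp_src: "\<kappa> \<in> paths \<Lambda> \<Longrightarrow> pcomp \<Lambda> \<kappa> (src \<Lambda> \<kappa>) = \<kappa>"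
    and deg_in: "\<kappa> \<in> paths \<Lambda> \<Longrightarrow> deg \<Lambda> \<kappa> \<in> Nk k"
    and deg_rng: "\<kappa> \<in> paths \<Lambda> \<Longrightarrow> deg \<Lambda> (rng \<Lambda> \<kappa>) = (\<lambda>i. 0)"
    and deg_src: "\<kappa> \<in> paths \<Lambda> \<Longrightarrow> deg \<Lambda> (src \<Lambda> \<kappa>) = (\<lambda>i. 0)"
    and deg_comp: "\<lbrakk>\<kappa> \<in> paths \<Lambda>; \<mu> \<in> paths \<Lambda>; src \<Lambda> \<kappa> = rng \<Lambda> \<mu>\<rbrakk>
          \<Longrightarrow> deg \<Lambda> (pcomp \<Lambda> \<kappa> \<mu>) = (\<lambda>i. deg \<Lambda> \<kappa> i + deg \<Lambda> \<mu> i)"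
    and factorisation:
      "\<lbrakk>\<kappa> \<in> paths \<Lambda>; m \<in> Nk k; n \<in> Nk k; deg \<Lambda> \<kappa> = (\<lambda>i. m i + n i)\<rbrakk>
        \<Longrightarrow> \<exists>!(\<mu>, \<nu>). \<mu> \<in> paths \<Lambda> \<and> \<nu> \<in> paths \<Lambda> \<and> src \<Lambda> \<mu> = rng \<Lambda> \<nu> \<and>
              pcomp \<Lambda> \<mu> \<nu> = \<kappa> \<and> deg \<Lambda> \<mu> = m \<and> deg \<Lambda> \<nu> = n"

definition vertices :: "'l graph_cat \<Rightarrow> 'l set" where
  "vertices \<Lambda> = {v \<in> paths \<Lambda>. deg \<Lambda> v = (\<lambda>i. 0)}"

definition paths_into :: "'l graph_cat \<Rightarrow> 'l \<Rightarrow> (nat \<Rightarrow> nat) \<Rightarrow> 'l set" where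
  "paths_into \<Lambda> v n = {\<kappa> \<in> paths \<Lambda>. deg \<Lambda> \<kappa> = n \<and> rng \<Lambda> \<kappa> = v}"

definition row_finite_no_sources :: "nat \<Rightarrow> 'l graph_cat \<Rightarrow> bool" where
  "row_finite_no_sources k \<Lambda> \<longleftrightarrow>
    (\<forall>v\<in>vertices \<Lambda>. \<forall>n\<in>Nk k. finite (paths_into \<Lambda> v n) \<and> paths_into \<Lambda> v n \<noteq> {})"

definition graph_functor :: "'l graph_cat \<Rightarrow> 'g monoid \<Rightarrow> ('l \<Rightarrow> 'g) \<Rightarrow> bool" where
  "graph_functor \<Lambda> G \<eta> \<longleftrightarrow>
    \<eta> \<in> paths \<Lambda> \<rightarrow> carrier G \<and>
    (\<forall>\<kappa>\<in>paths \<Lambda>. \<forall>\<mu>\<in>paths \<Lambda>. src \<Lambda> \<kappa> = rng \<Lambda> \<mu> \<longrightarrow>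
      \<eta> (pcomp \<Lambda> \<kappa> \<mu>) = \<eta> \<kappa> \<otimes>\<^bsub>G\<^esub> \<eta> \<mu>) \<and>
    (\<forall>v\<in>vertices \<Lambda>. \<eta> v = \<one>\<^bsub>G\<^esub>)"

text \<open>Condition (CK2) carries a scalar \<open>c \<kappa> \<mu>\<close>; untwisted families are those for \<open>c = 1\<close>.\<close>

definition twisted_CK_family ::
    "nat \<Rightarrow> 'l graph_cat \<Rightarrow> ('l \<Rightarrow> 'l \<Rightarrow> complex) \<Rightarrow> 'a cstar \<Rightarrow> ('l \<Rightarrow> 'a) \<Rightarrow> bool" where
  "twisted_CK_family k \<Lambda> c A T \<longleftrightarrow>
    T \<in> paths \<Lambda> \<rightarrow> carrier A \<and>
    \<comment> \<open>(CK1)\<close>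
    (\<forall>v\<in>vertices \<Lambda>. T v \<otimes>\<^bsub>A\<^esub> T v = T v \<and> adj A (T v) = T v) \<and>
    (\<forall>v\<in>vertices \<Lambda>. \<forall>w\<in>vertices \<Lambda>. v \<noteq> w \<longrightarrow> T v \<otimes>\<^bsub>A\<^esub> T w = \<zero>\<^bsub>A\<^esub>) \<and>
    \<comment> \<open>(CK2)\<close>
    (\<forall>\<kappa>\<in>paths \<Lambda>. \<forall>\<mu>\<in>paths \<Lambda>. rng \<Lambda> \<mu> = src \<Lambda> \<kappa> \<longrightarrow>
      T \<kappa> \<otimes>\<^bsub>A\<^esub> T \<mu> = scale A (c \<kappa> \<mu>) (T (pcomp \<Lambda> \<kappa> \<mu>))) \<and>
    \<comment> \<open>(CK3)\<close>
    (\<forall>\<kappa>\<in>paths \<Lambda>. adj A (T \<kappa>) \<otimes>\<^bsub>A\<^esub> T \<kappa> = T (src \<Lambda> \<kappa>)) \<and>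
    \<comment> \<open>(CK4)\<close>
    (\<forall>v\<in>vertices \<Lambda>. \<forall>n\<in>Nk k.
      T v = (\<Oplus>\<^bsub>A\<^esub>\<kappa>\<in>paths_into \<Lambda> v n. T \<kappa> \<otimes>\<^bsub>A\<^esub> adj A (T \<kappa>)))"

definition CK_family :: "nat \<Rightarrow> 'l graph_cat \<Rightarrow> 'a cstar \<Rightarrow> ('l \<Rightarrow> 'a) \<Rightarrow> bool" where
  "CK_family k \<Lambda> A S \<longleftrightarrow> twisted_CK_family k \<Lambda> (\<lambda>\<kappa> \<mu>. 1) A S"

text \<open>\<open>C\<close> is the C*-algebra of the graph \<open>\<Lambda>\<close>, with canonical family \<open>s\<close>.\<close>

definition graph_cstar_algebra ::
    "nat \<Rightarrow> 'l graph_cat \<Rightarrow> 'a cstar \<Rightarrow> ('l \<Rightarrow> 'a) \<Rightarrow> bool" where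
  "graph_cstar_algebra k \<Lambda> C s \<longleftrightarrow>
    cstar_algebra C \<and> CK_family k \<Lambda> C s \<and> generates C (s ` paths \<Lambda>) \<and>
    (\<forall>(E :: 'l test_elem cstar) S. cstar_algebra E \<and> CK_family k \<Lambda> E S \<longrightarrow>
      (\<exists>\<rho>. cstar_hom C E \<rho> \<and> (\<forall>\<kappa>\<in>paths \<Lambda>. \<rho> (s \<kappa>) = S \<kappa>)))"

section \<open>Fell bundles\<close>

record ('g, 'b) banach_bundle =
  elems :: "'b set"
  proj :: "'b \<Rightarrow> 'g"
  badd :: "'b \<Rightarrow> 'b \<Rightarrow> 'b"
  bzero :: "'g \<Rightarrow> 'b"
  bscale :: "complex \<Rightarrow> 'b \<Rightarrow> 'b"
  bmult :: "'b \<Rightarrow> 'b \<Rightarrow> 'b"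
  badj :: "'b \<Rightarrow> 'b"
  bnorm :: "'b \<Rightarrow> real"

definition fibre :: "('g, 'b) banach_bundle \<Rightarrow> 'g \<Rightarrow> 'b set" where
  "fibre B g = {b \<in> elems B. proj B b = g}"

text \<open>The last axiom is positivity of \<open>b\<^sup>*b\<close> in the C*-algebra over the unit. Deformations,
  representations and the C*-algebra of a bundle involve only its operations and are defined
  without reference to the axioms.\<close>

locale fell_bundle =
  fixes G :: "'g monoid" and B :: "('g, 'b) banach_bundle"
  assumes group: "group G"
    and proj_in: "b \<in> elems B \<Longrightarrow> proj B b \<in> carrier G"
    and banach_fibre:
      "g \<in> carrier G \<Longrightarrow>
        complex_banach_space (fibre B g) (badd B) (bzero B g) (bscale B) (bnorm B)"
    and bmult_in: "\<lbrakk>b \<in> elems B; c \<in> elems B\<rbrakk> \<Longrightarrow> bmult B b c \<in> elems B"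
    and proj_bmult: "\<lbrakk>b \<in> elems B; c \<in> elems B\<rbrakk>
          \<Longrightarrow> proj B (bmult B b c) = proj B b \<otimes>\<^bsub>G\<^esub> proj B c"
    and bmult_assoc: "\<lbrakk>a \<in> elems B; b \<in> elems B; c \<in> elems B\<rbrakk>
          \<Longrightarrow> bmult B (bmult B a b) c = bmult B a (bmult B b c)"
    and bmult_badd: "\<lbrakk>a \<in> elems B; b \<in> elems B; c \<in> elems B; proj B b = proj B c\<rbrakk>
          \<Longrightarrow> bmult B a (badd B b c) = badd B (bmult B a b) (bmult B a c)"
    and badd_bmult: "\<lbrakk>a \<in> elems B; b \<in> elems B; c \<in> elems B; proj B a = proj B b\<rbrakk>
          \<Longrightarrow> bmult B (badd B a b) c = badd B (bmult B a c) (bmult B b c)"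
    and bmult_bscale: "\<lbrakk>b \<in> elems B; c \<in> elems B\<rbrakk>
          \<Longrightarrow> bmult B b (bscale B z c) = bscale B z (bmult B b c)"
    and bscale_bmult: "\<lbrakk>b \<in> elems B; c \<in> elems B\<rbrakk>
          \<Longrightarrow> bmult B (bscale B z b) c = bscale B z (bmult B b c)"
    and bnorm_bmult: "\<lbrakk>b \<in> elems B; c \<in> elems B\<rbrakk>
          \<Longrightarrow> bnorm B (bmult B b c) \<le> bnorm B b * bnorm B c"
    and badj_in: "b \<in> elems B \<Longrightarrow> badj B b \<in> elems B"
    and proj_badj: "b \<in> elems B \<Longrightarrow> proj B (badj B b) = inv\<^bsub>G\<^esub> proj B b"
    and badj_badj: "b \<in> elems B \<Longrightarrow> badj B (badj B b) = b"
    and badj_badd: "\<lbrakk>b \<in> elems B; c \<in> elems B; proj B b = proj B c\<rbrakk>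
          \<Longrightarrow> badj B (badd B b c) = badd B (badj B b) (badj B c)"
    and badj_bscale: "b \<in> elems B \<Longrightarrow> badj B (bscale B z b) = bscale B (cnj z) (badj B b)"
    and badj_bmult: "\<lbrakk>b \<in> elems B; c \<in> elems B\<rbrakk>
          \<Longrightarrow> badj B (bmult B b c) = bmult B (badj B c) (badj B b)"
    and bnorm_badj_bmult: "b \<in> elems B \<Longrightarrow> bnorm B (bmult B (badj B b) b) = (bnorm B b)\<^sup>2"
    and positive: "b \<in> elems B
          \<Longrightarrow> \<exists>c\<in>fibre B \<one>\<^bsub>G\<^esub>. bmult B (badj B b) b = bmult B (badj B c) c"

definition cocycle :: "'g monoid \<Rightarrow> ('g \<Rightarrow> 'g \<Rightarrow> complex) \<Rightarrow> bool" where
  "cocycle G \<sigma> \<longleftrightarrow>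
    (\<forall>g\<in>carrier G. \<forall>h\<in>carrier G. cmod (\<sigma> g h) = 1) \<and>
    (\<forall>g\<in>carrier G. \<sigma> \<one>\<^bsub>G\<^esub> g = 1 \<and> \<sigma> g \<one>\<^bsub>G\<^esub> = 1) \<and>
    (\<forall>g\<in>carrier G. \<forall>h\<in>carrier G. \<forall>k\<in>carrier G.
      \<sigma> g h * \<sigma> (g \<otimes>\<^bsub>G\<^esub> h) k = \<sigma> g (h \<otimes>\<^bsub>G\<^esub> k) * \<sigma> h k)"

definition deform ::
    "'g monoid \<Rightarrow> ('g \<Rightarrow> 'g \<Rightarrow> complex) \<Rightarrow> ('g, 'b) banach_bundle \<Rightarrow> ('g, 'b) banach_bundle" where
  "deform G \<sigma> B = B\<lparr>
    bmult := (\<lambda>b c. bscale B (\<sigma> (proj B b) (proj B c)) (bmult B b c)),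
    badj := (\<lambda>b. bscale B (cnj (\<sigma> (proj B b) (inv\<^bsub>G\<^esub> proj B b))) (badj B b))\<rparr>"

lemma fell_bundle_deform:
  fixes G :: "'g monoid" (structure) and B :: "('g, 'b) banach_bundle"
  assumes "fell_bundle G B" and "cocycle G \<sigma>"
  shows "fell_bundle G (deform G \<sigma> B)"
proof -
  interpret fell_bundle G B by fact
  interpret group G by (rule group)
  have fib: "fibre (deform G \<sigma> B) g = fibre B g" for g
    by (simp add: fibre_def deform_def)
  have sel [simp]: "elems (deform G \<sigma> B) = elems B" "proj (deform G \<sigma> B) = proj B"
      "badd (deform G \<sigma> B) = badd B" "bzero (deform G \<sigma> B) = bzero B"
      "bscale (deform G \<sigma> B) = bscale B" "bnorm (deform G \<sigma> B) = bnorm B"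
    by (simp_all add: deform_def)
  have mul: "bmult (deform G \<sigma> B) b c = bscale B (\<sigma> (proj B b) (proj B c)) (bmult B b c)" for b c
    by (simp add: deform_def)
  have star: "badj (deform G \<sigma> B) b = bscale B (cnj (\<sigma> (proj B b) (inv proj B b))) (badj B b)" for b
    by (simp add: deform_def)
  note p = proj_in
  have ban: "complex_banach_space (fibre B (proj B b)) (badd B) (bzero B (proj B b)) (bscale B) (bnorm B)"
    if "b \<in> elems B" for b using banach_fibre p that by blast
  have mem: "b \<in> fibre B (proj B b)" if "b \<in> elems B" for b using that by (simp add: fibre_def)
  have sc_fib: "bscale B z b \<in> fibre B (proj B b)" if "b \<in> elems B" for b z
    using complex_banach_space.scl_in[OF ban mem] that by blast
  have sc_in: "bscale B z b \<in> elems B" and sc_p: "proj B (bscale B z b) = proj B b"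
    if "b \<in> elems B" for b z using sc_fib[OF that] by (auto simp: fibre_def)
  have ad_in: "badd B b c \<in> elems B" and ad_p: "proj B (badd B b c) = proj B b"
    if "b \<in> elems B" "c \<in> elems B" "proj B b = proj B c" for b c
    using complex_banach_space.plus_in[OF ban, of b b c] that by (auto simp: fibre_def)
  have sc_sc: "bscale B z (bscale B z' b) = bscale B (z * z') b" if "b \<in> elems B" for b z z'
    using complex_banach_space.scl_scl[OF ban mem] that by blast
  have sc_1: "bscale B 1 b = b" if "b \<in> elems B" for b
    using complex_banach_space.scl_one[OF ban mem] that by blast
  have sc_ad: "bscale B z (badd B b c) = badd B (bscale B z b) (bscale B z c)"
    if "b \<in> elems B" "c \<in> elems B" "proj B b = proj B c" for b c z
    using complex_banach_space.scl_plus[OF ban, of b b c z] that by (auto simp: fibre_def)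
  have sc_n: "bnorm B (bscale B z b) = cmod z * bnorm B b" if "b \<in> elems B" for b z
    using complex_banach_space.nrm_scl[OF ban mem] that by blast
  have u: "cmod (\<sigma> g h) = 1" if "g \<in> carrier G" "h \<in> carrier G" for g h
    using assms(2) that by (simp add: cocycle_def)
  have s1: "\<sigma> \<one> g = 1" "\<sigma> g \<one> = 1" if "g \<in> carrier G" for g
    using assms(2) that by (simp_all add: cocycle_def)
  have co: "\<sigma> g h * \<sigma> (g \<otimes> h) k = \<sigma> g (h \<otimes> k) * \<sigma> h k"
    if "g \<in> carrier G" "h \<in> carrier G" "k \<in> carrier G" for g h k
    using assms(2) that by (simp add: cocycle_def)
  have uc: "\<sigma> g h * cnj (\<sigma> g h) = 1" "cnj (\<sigma> g h) * \<sigma> g h = 1"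
    if "g \<in> carrier G" "h \<in> carrier G" for g h
    using complex_norm_square[of "\<sigma> g h"] u[OF that] by (simp_all add: mult.commute)
  have sym: "\<sigma> (inv g) g = \<sigma> g (inv g)" if "g \<in> carrier G" for g
    using co[of g "inv g" g] that by (simp add: s1)
  have star_mul: "cnj (\<sigma> (g \<otimes> h) (inv h \<otimes> inv g)) * cnj (\<sigma> g h)
      = \<sigma> (inv h) (inv g) * cnj (\<sigma> g (inv g)) * cnj (\<sigma> h (inv h))"
    if g: "g \<in> carrier G" and h: "h \<in> carrier G" for g h
  proof -
    have "h \<otimes> (inv h \<otimes> inv g) = inv g"
      using g h by (simp add: m_assoc[symmetric])
    then have 1: "\<sigma> g h * \<sigma> (g \<otimes> h) (inv h \<otimes> inv g) = \<sigma> g (inv g) * \<sigma> h (inv h \<otimes> inv g)"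
      using co[of g h "inv h \<otimes> inv g"] g h by simp
    have 2: "\<sigma> h (inv h) = \<sigma> h (inv h \<otimes> inv g) * \<sigma> (inv h) (inv g)"
      using co[of h "inv h" "inv g"] g h by (simp add: s1)
    have "\<sigma> (inv h) (inv g) * cnj (\<sigma> g (inv g)) * cnj (\<sigma> h (inv h))
        = cnj (\<sigma> g (inv g)) * cnj (\<sigma> h (inv h \<otimes> inv g)) * (\<sigma> (inv h) (inv g) * cnj (\<sigma> (inv h) (inv g)))"
      by (simp add: 2)
    also have "\<dots> = cnj (\<sigma> g (inv g) * \<sigma> h (inv h \<otimes> inv g))"
      using uc(1)[of "inv h" "inv g"] g h by simp
    also have "\<dots> = cnj (\<sigma> g h * \<sigma> (g \<otimes> h) (inv h \<otimes> inv g))" by (simp only: 1)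
    finally show ?thesis by (simp add: mult.commute)
  qed
  have sq: "bmult (deform G \<sigma> B) (badj (deform G \<sigma> B) b) b = bmult B (badj B b) b"
    if "b \<in> elems B" for b
  proof -
    have "bmult (deform G \<sigma> B) (badj (deform G \<sigma> B) b) b
        = bscale B (\<sigma> (inv proj B b) (proj B b) * cnj (\<sigma> (proj B b) (inv proj B b))) (bmult B (badj B b) b)"
      using that by (simp add: mul star sc_p sc_sc badj_in proj_badj bscale_bmult bmult_in)
    then show ?thesis
      using that p[OF that] by (simp add: sym uc sc_1 bmult_in badj_in)
  qed
  show ?thesis
  proof (intro fell_bundle.intro)
    fix b assume b: "b \<in> elems (deform G \<sigma> B)"
    then obtain c where "c \<in> fibre B \<one>" "bmult B (badj B b) b = bmult B (badj B c) c"
      using positive by auto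
    with b show "\<exists>c\<in>fibre (deform G \<sigma> B) \<one>.
        bmult (deform G \<sigma> B) (badj (deform G \<sigma> B) b) b
        = bmult (deform G \<sigma> B) (badj (deform G \<sigma> B) c) c"
      using sq by (auto simp: fib fibre_def)
  next
    fix b assume "b \<in> elems (deform G \<sigma> B)"
    then show "bnorm (deform G \<sigma> B) (bmult (deform G \<sigma> B) (badj (deform G \<sigma> B) b) b)
        = (bnorm (deform G \<sigma> B) b)\<^sup>2"
      by (simp add: sq bnorm_badj_bmult)
  next
    fix a b c assume m: "a \<in> elems (deform G \<sigma> B)" "b \<in> elems (deform G \<sigma> B)" "c \<in> elems (deform G \<sigma> B)"
    then have "proj B a \<in> carrier G" "proj B b \<in> carrier G" "proj B c \<in> carrier G" using p by auto
    with m show "bmult (deform G \<sigma> B) (bmult (deform G \<sigma> B) a b) c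
        = bmult (deform G \<sigma> B) a (bmult (deform G \<sigma> B) b c)"
      using co[of "proj B a" "proj B b" "proj B c"]
      by (simp add: mul sc_p sc_sc bmult_in proj_bmult bscale_bmult bmult_bscale bmult_assoc mult.commute)
  next
    fix b assume b: "b \<in> elems (deform G \<sigma> B)"
    then have g: "proj B b \<in> carrier G" using p by auto
    with b show "badj (deform G \<sigma> B) (badj (deform G \<sigma> B) b) = b"
      by (simp add: star sc_p sc_sc badj_in proj_badj badj_bscale badj_badj sym uc sc_1)
  next
    fix b c assume m: "b \<in> elems (deform G \<sigma> B)" "c \<in> elems (deform G \<sigma> B)"
    then have "proj B b \<in> carrier G" "proj B c \<in> carrier G" using p by auto
    with m show "badj (deform G \<sigma> B) (bmult (deform G \<sigma> B) b c)
        = bmult (deform G \<sigma> B) (badj (deform G \<sigma> B) c) (badj (deform G \<sigma> B) b)"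
      using star_mul[of "proj B b" "proj B c"]
      by (simp add: mul star sc_p sc_sc sc_in bmult_in badj_in proj_bmult proj_badj badj_bscale
          bscale_bmult bmult_bscale badj_bmult inv_mult_group mult_ac)
  next
    fix b c assume m: "b \<in> elems (deform G \<sigma> B)" "c \<in> elems (deform G \<sigma> B)"
    then have "proj B b \<in> carrier G" "proj B c \<in> carrier G" using p by auto
    with m show "bnorm (deform G \<sigma> B) (bmult (deform G \<sigma> B) b c)
        \<le> bnorm (deform G \<sigma> B) b * bnorm (deform G \<sigma> B) c"
      by (simp add: mul sc_n bmult_in u bnorm_bmult)
  qed (use p in \<open>auto simp: fib mul star sc_in sc_p sc_sc sc_ad ad_in ad_p bmult_in badj_in group
        banach_fibre proj_bmult proj_badj bmult_badd badd_bmult bmult_bscale bscale_bmult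
        badj_badd badj_bscale mult.commute\<close>)
  qed

definition fell_rep :: "'g monoid \<Rightarrow> ('g, 'b) banach_bundle \<Rightarrow> 'c cstar \<Rightarrow> ('g \<Rightarrow> 'b \<Rightarrow> 'c) \<Rightarrow> bool" where
  "fell_rep G B C \<pi> \<longleftrightarrow>
    (\<forall>g\<in>carrier G. \<pi> g \<in> fibre B g \<rightarrow> carrier C) \<and>
    (\<forall>g\<in>carrier G. \<forall>b\<in>fibre B g. \<forall>c\<in>fibre B g. \<pi> g (badd B b c) = \<pi> g b \<oplus>\<^bsub>C\<^esub> \<pi> g c) \<and>
    (\<forall>g\<in>carrier G. \<forall>z. \<forall>b\<in>fibre B g. \<pi> g (bscale B z b) = scale C z (\<pi> g b)) \<and>
    (\<forall>g\<in>carrier G. \<forall>h\<in>carrier G. \<forall>b\<in>fibre B g. \<forall>c\<in>fibre B h.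
      \<pi> (g \<otimes>\<^bsub>G\<^esub> h) (bmult B b c) = \<pi> g b \<otimes>\<^bsub>C\<^esub> \<pi> h c) \<and>
    (\<forall>g\<in>carrier G. \<forall>b\<in>fibre B g. adj C (\<pi> g b) = \<pi> (inv\<^bsub>G\<^esub> g) (badj B b)) \<and>
    norm_closure C (lin_span C
      {\<pi> \<one>\<^bsub>G\<^esub> b \<otimes>\<^bsub>C\<^esub> x |b x. b \<in> fibre B \<one>\<^bsub>G\<^esub> \<and> x \<in> carrier C}) = carrier C"

text \<open>\<open>C\<close> is the C*-algebra of the Fell bundle \<open>B\<close>, with canonical representation \<open>\<pi>\<close>.\<close>

definition bundle_cstar_algebra ::
    "'g monoid \<Rightarrow> ('g, 'b) banach_bundle \<Rightarrow> 'c cstar \<Rightarrow> ('g \<Rightarrow> 'b \<Rightarrow> 'c) \<Rightarrow> bool" where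
  "bundle_cstar_algebra G B C \<pi> \<longleftrightarrow>
    cstar_algebra C \<and> fell_rep G B C \<pi> \<and> generates C (\<Union>g\<in>carrier G. \<pi> g ` fibre B g) \<and>
    (\<forall>(E :: 'b test_elem cstar) \<psi>. cstar_algebra E \<and> fell_rep G B E \<psi> \<longrightarrow>
      (\<exists>\<rho>. cstar_hom C E \<rho> \<and> (\<forall>g\<in>carrier G. \<forall>b\<in>fibre B g. \<rho> (\<pi> g b) = \<psi> g b)))"

text \<open>The bundle determined by a functor \<open>\<eta>\<close>. The subspaces of \<open>C\<close> that serve as fibres are
  not disjoint (all contain zero), so their elements are tagged with the group element.\<close>

definition graph_fibre ::
    "'g monoid \<Rightarrow> 'l graph_cat \<Rightarrow> ('l \<Rightarrow> 'g) \<Rightarrow> 'a cstar \<Rightarrow> ('l \<Rightarrow> 'a) \<Rightarrow> 'g \<Rightarrow> 'a set" where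
  "graph_fibre G \<Lambda> \<eta> C s g = norm_closure C (lin_span C
    {s \<kappa> \<otimes>\<^bsub>C\<^esub> adj C (s \<mu>) |\<kappa> \<mu>.
      \<kappa> \<in> paths \<Lambda> \<and> \<mu> \<in> paths \<Lambda> \<and> \<eta> \<kappa> \<otimes>\<^bsub>G\<^esub> inv\<^bsub>G\<^esub> \<eta> \<mu> = g})"

definition graph_bundle ::
    "'g monoid \<Rightarrow> 'l graph_cat \<Rightarrow> ('l \<Rightarrow> 'g) \<Rightarrow> 'a cstar \<Rightarrow> ('l \<Rightarrow> 'a) \<Rightarrow> ('g, 'g \<times> 'a) banach_bundle" where
  "graph_bundle G \<Lambda> \<eta> C s = \<lparr>
    elems = (SIGMA g : carrier G. graph_fibre G \<Lambda> \<eta> C s g),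
    proj = fst,
    badd = (\<lambda>b c. (fst b, snd b \<oplus>\<^bsub>C\<^esub> snd c)),
    bzero = (\<lambda>g. (g, \<zero>\<^bsub>C\<^esub>)),
    bscale = (\<lambda>z b. (fst b, scale C z (snd b))),
    bmult = (\<lambda>b c. (fst b \<otimes>\<^bsub>G\<^esub> fst c, snd b \<otimes>\<^bsub>C\<^esub> snd c)),
    badj = (\<lambda>b. (inv\<^bsub>G\<^esub> fst b, adj C (snd b))),
    bnorm = (\<lambda>b. cnorm C (snd b))\<rparr>"

end

theory Submission
  imports Defs
begin

text \<open>That the family \<open>t\<close> satisfies the relations is a computation in the deformed bundle.
  For the converse, let \<open>u\<close> be the left regular representation of \<open>G\<close> twisted by the conjugate of
  \<open>\<sigma>\<close>. In \<open>A \<otimes> C*(u)\<close> the two twists cancel in \<open>T\<^sub>\<kappa> \<otimes> u\<^bsub>\<eta>(\<kappa>)\<^esub>\<close>, so this family is the image of the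
  canonical one under a homomorphism \<open>\<Phi>\<close> of the graph algebra. As \<open>\<Phi>\<close> is contractive and each
  \<open>A \<otimes> u\<^sub>g\<close> is closed, \<open>\<Phi>\<close> maps the fibre over \<open>g\<close> into \<open>A \<otimes> u\<^sub>g\<close>; reading off the first tensor factor
  gives a representation of the deformed bundle, and the universal property applies.

  The tensor product acts on the finitely supported functions from \<open>G\<close> to the unitization of \<open>A\<close>,
  a pre-Hilbert module. Its Cauchy-Schwarz inequality, like the contractivity of \<open>\<Phi>\<close>, rests on
  square roots of positive elements and on Kaplansky's theorem that \<open>x\<^sup>*x\<close> is positive.\<close>

section \<open>C*-seminormed algebras\<close>

text \<open>On the products \<open>s\<^sub>\<kappa> s\<^sub>\<mu>\<^sup>*\<close> the wanted
  representation is forced by the relations for \<open>T\<close>, but prescribing it there leaves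
  open whether it is well defined and continuous on their closed span: every relation in the graph
  algebra would need a twisted counterpart. A homomorphism out of the graph algebra settles both
  points at once, and its universal property accepts only untwisted families; hence the auxiliary
  factor that absorbs the twist. Two more obstacles shape the end of the proof. The universal
  properties speak of algebras carried by the test types, whereas \<open>A\<close> and the operator
  algebra live on other types; so the C*-subalgebra generated by the family in question is copied
  onto a test type. Moreover \<open>A\<close> may be much larger than what \<open>T\<close>
  generates, so the representation in \<open>A\<close> may be degenerate; it is cut down to the
  C*-subalgebra generated by its values. Spectra and functional calculus do not appear. Their place
  is taken by square roots of self-adjoint \<open>p\<close> with
  \<open>\<parallel>t - p\<parallel> < t\<close>, together with the fact that such a root commutes
  with everything that commutes with \<open>p\<close>.\<close>

locale pre_cstar = abelian_group A for A :: "'a cstar" (structure) +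
  assumes scale_in: "x \<in> carrier A \<Longrightarrow> scale A z x \<in> carrier A"
    and scale_1: "x \<in> carrier A \<Longrightarrow> scale A 1 x = x"
    and scale_scale: "x \<in> carrier A \<Longrightarrow> scale A z (scale A z' x) = scale A (z * z') x"
    and scale_plus: "\<lbrakk>x \<in> carrier A; y \<in> carrier A\<rbrakk>
          \<Longrightarrow> scale A z (x \<oplus> y) = scale A z x \<oplus> scale A z y"
    and plus_scale: "x \<in> carrier A \<Longrightarrow> scale A (z + z') x = scale A z x \<oplus> scale A z' x"
    and norm_plus: "\<lbrakk>x \<in> carrier A; y \<in> carrier A\<rbrakk> \<Longrightarrow> cnorm A (x \<oplus> y) \<le> cnorm A x + cnorm A y"
    and norm_scale: "x \<in> carrier A \<Longrightarrow> cnorm A (scale A z x) = cmod z * cnorm A x"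
    and mult_in: "\<lbrakk>a \<in> carrier A; b \<in> carrier A\<rbrakk> \<Longrightarrow> a \<otimes> b \<in> carrier A"
    and adj_in: "a \<in> carrier A \<Longrightarrow> adj A a \<in> carrier A"
    and mult_assoc: "\<lbrakk>a \<in> carrier A; b \<in> carrier A; c \<in> carrier A\<rbrakk>
          \<Longrightarrow> (a \<otimes> b) \<otimes> c = a \<otimes> (b \<otimes> c)"
    and mult_plus: "\<lbrakk>a \<in> carrier A; b \<in> carrier A; c \<in> carrier A\<rbrakk>
          \<Longrightarrow> a \<otimes> (b \<oplus> c) = a \<otimes> b \<oplus> a \<otimes> c"
    and plus_mult: "\<lbrakk>a \<in> carrier A; b \<in> carrier A; c \<in> carrier A\<rbrakk>
          \<Longrightarrow> (a \<oplus> b) \<otimes> c = a \<otimes> c \<oplus> b \<otimes> c"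
    and scale_mult: "\<lbrakk>a \<in> carrier A; b \<in> carrier A\<rbrakk> \<Longrightarrow> scale A z a \<otimes> b = scale A z (a \<otimes> b)"
    and mult_scale: "\<lbrakk>a \<in> carrier A; b \<in> carrier A\<rbrakk> \<Longrightarrow> a \<otimes> scale A z b = scale A z (a \<otimes> b)"
    and adj_adj: "a \<in> carrier A \<Longrightarrow> adj A (adj A a) = a"
    and adj_plus: "\<lbrakk>a \<in> carrier A; b \<in> carrier A\<rbrakk> \<Longrightarrow> adj A (a \<oplus> b) = adj A a \<oplus> adj A b"
    and adj_scale: "a \<in> carrier A \<Longrightarrow> adj A (scale A z a) = scale A (cnj z) (adj A a)"
    and adj_mult: "\<lbrakk>a \<in> carrier A; b \<in> carrier A\<rbrakk> \<Longrightarrow> adj A (a \<otimes> b) = adj A b \<otimes> adj A a"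
    and norm_mult: "\<lbrakk>a \<in> carrier A; b \<in> carrier A\<rbrakk> \<Longrightarrow> cnorm A (a \<otimes> b) \<le> cnorm A a * cnorm A b"
    and cstar_identity: "a \<in> carrier A \<Longrightarrow> cnorm A (adj A a \<otimes> a) = (cnorm A a)\<^sup>2"
begin

lemmas closed [simp] = scale_in mult_in adj_in

lemma scale_0 [simp]: "x \<in> carrier A \<Longrightarrow> scale A 0 x = \<zero>"
  using plus_scale[of x 0 0] by (metis add.l_cancel_one' add_0 scale_in)

lemma scale_zero [simp]: "scale A z \<zero> = \<zero>"
  using scale_scale[of \<zero> z 0] scale_0[of \<zero>] by simp

lemma scale_minus_one: "x \<in> carrier A \<Longrightarrow> scale A (- 1) x = \<ominus> x"
  using plus_scale[of x "-1" 1] by (intro minus_equality[symmetric]) (simp_all add: scale_1)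

lemma scale_uminus: "x \<in> carrier A \<Longrightarrow> scale A (- z) x = \<ominus> scale A z x"
  using scale_minus_one[of "scale A z x"] by (simp add: scale_scale)

lemma scale_neg: "x \<in> carrier A \<Longrightarrow> scale A z (\<ominus> x) = \<ominus> scale A z x"
  using scale_scale[of x z "-1"] scale_uminus[of x z] scale_minus_one[of x] by simp

lemma scale_minus: "\<lbrakk>x \<in> carrier A; y \<in> carrier A\<rbrakk>
    \<Longrightarrow> scale A z (x \<ominus> y) = scale A z x \<ominus> scale A z y"
  by (simp add: a_minus_def scale_plus scale_neg)

lemma scale_numeral_2: "x \<in> carrier A \<Longrightarrow> scale A 2 x = x \<oplus> x"
  using plus_scale[of x 1 1] by (simp add: scale_1)

lemma mult_neg: "\<lbrakk>x \<in> carrier A; y \<in> carrier A\<rbrakk> \<Longrightarrow> x \<otimes> (\<ominus> y) = \<ominus> (x \<otimes> y)"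
  using mult_scale[of x y "-1"] by (simp add: scale_minus_one)

lemma neg_mult: "\<lbrakk>x \<in> carrier A; y \<in> carrier A\<rbrakk> \<Longrightarrow> (\<ominus> x) \<otimes> y = \<ominus> (x \<otimes> y)"
  using scale_mult[of x y "-1"] by (simp add: scale_minus_one)

lemma mult_minus: "\<lbrakk>x \<in> carrier A; y \<in> carrier A; w \<in> carrier A\<rbrakk>
    \<Longrightarrow> w \<otimes> (x \<ominus> y) = w \<otimes> x \<ominus> w \<otimes> y"
  by (simp add: a_minus_def mult_plus mult_neg)

lemma minus_mult: "\<lbrakk>x \<in> carrier A; y \<in> carrier A; w \<in> carrier A\<rbrakk>
    \<Longrightarrow> (x \<ominus> y) \<otimes> w = x \<otimes> w \<ominus> y \<otimes> w"
  by (simp add: a_minus_def plus_mult neg_mult)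

lemma mult_zero [simp]: "x \<in> carrier A \<Longrightarrow> x \<otimes> \<zero> = \<zero>"
  using mult_scale[of x \<zero> 0] by simp

lemma zero_mult [simp]: "x \<in> carrier A \<Longrightarrow> \<zero> \<otimes> x = \<zero>"
  using scale_mult[of \<zero> x 0] by simp

lemma adj_neg: "x \<in> carrier A \<Longrightarrow> adj A (\<ominus> x) = \<ominus> adj A x"
  using adj_scale[of x "-1"] by (simp add: scale_minus_one)

lemma adj_minus: "\<lbrakk>x \<in> carrier A; y \<in> carrier A\<rbrakk> \<Longrightarrow> adj A (x \<ominus> y) = adj A x \<ominus> adj A y"
  by (simp add: a_minus_def adj_plus adj_neg)

lemma adj_zero [simp]: "adj A \<zero> = \<zero>"
  using adj_scale[of \<zero> 0] by simp

lemma norm_zero [simp]: "cnorm A \<zero> = 0"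
  using norm_scale[of \<zero> 0] by simp

lemma norm_neg [simp]: "x \<in> carrier A \<Longrightarrow> cnorm A (\<ominus> x) = cnorm A x"
  using norm_scale[of x "-1"] by (simp add: scale_minus_one)

lemma norm_nonneg [simp]: "x \<in> carrier A \<Longrightarrow> 0 \<le> cnorm A x"
  using norm_plus[of x "\<ominus> x"] by (simp add: r_neg)

lemma norm_minus: "\<lbrakk>x \<in> carrier A; y \<in> carrier A\<rbrakk> \<Longrightarrow> cnorm A (x \<ominus> y) \<le> cnorm A x + cnorm A y"
  using norm_plus[of x "\<ominus> y"] by (simp add: a_minus_def)

lemma norm_minus_commute:
  "\<lbrakk>x \<in> carrier A; y \<in> carrier A\<rbrakk> \<Longrightarrow> cnorm A (x \<ominus> y) = cnorm A (y \<ominus> x)"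
  using norm_neg[of "x \<ominus> y"] by (simp add: a_minus_def minus_add a_comm)

lemma minus_plus_cancel: "\<lbrakk>x \<in> carrier A; y \<in> carrier A\<rbrakk> \<Longrightarrow> (x \<ominus> y) \<oplus> y = x"
  by (simp add: a_minus_def a_assoc l_neg)

lemma minus_split: "\<lbrakk>x \<in> carrier A; y \<in> carrier A; w \<in> carrier A\<rbrakk>
    \<Longrightarrow> x \<ominus> w = (x \<ominus> y) \<oplus> (y \<ominus> w)"
  by (metis a_assoc a_inv_closed a_minus_def minus_plus_cancel minus_closed)

lemma norm_triangle: "\<lbrakk>x \<in> carrier A; y \<in> carrier A; w \<in> carrier A\<rbrakk>
    \<Longrightarrow> cnorm A (x \<ominus> w) \<le> cnorm A (x \<ominus> y) + cnorm A (y \<ominus> w)"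
  using minus_split[of x y w] norm_plus[of "x \<ominus> y" "y \<ominus> w"] by simp

lemma norm_triangle': "\<lbrakk>x \<in> carrier A; y \<in> carrier A\<rbrakk>
    \<Longrightarrow> cnorm A x \<le> cnorm A y + cnorm A (x \<ominus> y)"
  using norm_plus[of "x \<ominus> y" y] by (simp add: minus_plus_cancel)

lemma norm_diff_abs: "\<lbrakk>x \<in> carrier A; y \<in> carrier A\<rbrakk>
    \<Longrightarrow> \<bar>cnorm A x - cnorm A y\<bar> \<le> cnorm A (x \<ominus> y)"
  using norm_triangle'[of x y] norm_triangle'[of y x] norm_minus_commute[of x y] by linarith

text \<open>Isometry of the adjoint is not an axiom. The C*-identity and submultiplicativity bound
  the squared norm of \<open>y\<close> by the product of the norms of \<open>adj A y\<close> and
  \<open>y\<close>; a nonzero factor cancels, and \<open>y\<close> may be replaced by its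
  adjoint.\<close>

lemma norm_adj [simp]:
  assumes "x \<in> carrier A" shows "cnorm A (adj A x) = cnorm A x"
proof -
  have le: "cnorm A y \<le> cnorm A (adj A y)" if "y \<in> carrier A" for y
  proof (cases "cnorm A y = 0")
    case False
    have "cnorm A y * cnorm A y \<le> cnorm A (adj A y) * cnorm A y"
      using norm_mult[of "adj A y" y] cstar_identity[of y] that by (simp add: power2_eq_square)
    with False that show ?thesis by (simp add: less_le)
  qed (use that in simp)
  show ?thesis using le[of x] le[of "adj A x"] assms by (simp add: adj_adj)
qed

lemma plus_diff_plus: "\<lbrakk>a \<in> carrier A; b \<in> carrier A; a' \<in> carrier A; b' \<in> carrier A\<rbrakk>
    \<Longrightarrow> (a \<oplus> b) \<ominus> (a' \<oplus> b') = (a \<ominus> a') \<oplus> (b \<ominus> b')"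
  by (simp add: a_minus_def minus_add a_ac)

lemma norm_diff_plus: "\<lbrakk>a \<in> carrier A; b \<in> carrier A; a' \<in> carrier A; b' \<in> carrier A\<rbrakk>
    \<Longrightarrow> cnorm A ((a \<oplus> b) \<ominus> (a' \<oplus> b')) \<le> cnorm A (a \<ominus> a') + cnorm A (b \<ominus> b')"
  by (simp add: plus_diff_plus norm_plus)

lemma norm_diff_mult:
  assumes "a \<in> carrier A" "b \<in> carrier A" "a' \<in> carrier A" "b' \<in> carrier A"
  shows "cnorm A (a \<otimes> b \<ominus> a' \<otimes> b') \<le> cnorm A a * cnorm A (b \<ominus> b') + cnorm A (a \<ominus> a') * cnorm A b'"
proof -
  have "a \<otimes> b \<ominus> a' \<otimes> b' = a \<otimes> (b \<ominus> b') \<oplus> (a \<ominus> a') \<otimes> b'"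
    using minus_split[of "a \<otimes> b" "a \<otimes> b'" "a' \<otimes> b'"] assms by (simp add: mult_minus minus_mult)
  then show ?thesis
    using norm_plus[of "a \<otimes> (b \<ominus> b')" "(a \<ominus> a') \<otimes> b'"] norm_mult[of a "b \<ominus> b'"]
      norm_mult[of "a \<ominus> a'" b'] assms by simp
qed

section \<open>Norm closures and linear spans\<close>

lemma norm_closure_iff:
  assumes "S \<subseteq> carrier A"
  shows "a \<in> norm_closure A S \<longleftrightarrow> a \<in> carrier A \<and> (\<forall>e>0. \<exists>x\<in>S. cnorm A (a \<ominus> x) < e)"
proof -
  have "a \<oplus> scale A (- 1) x = a \<ominus> x" if "x \<in> S" for x
    using assms that by (auto simp: scale_minus_one a_minus_def)
  then show ?thesis by (auto simp: norm_closure_def)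
qed

lemma closure_approx:
  assumes "a \<in> norm_closure A S" "S \<subseteq> carrier A" "e > 0"
  obtains x where "x \<in> S" "x \<in> carrier A" "cnorm A (a \<ominus> x) < e"
  using assms norm_closure_iff[of S a] by blast

lemma closure_subset: "S \<subseteq> carrier A \<Longrightarrow> S \<subseteq> norm_closure A S"
  by (force simp: norm_closure_iff a_minus_def r_neg subset_iff)

lemma closure_in_carrier: "norm_closure A S \<subseteq> carrier A"
  by (auto simp: norm_closure_def)

lemma closure_mono: "S \<subseteq> S' \<Longrightarrow> norm_closure A S \<subseteq> norm_closure A S'"
  by (fastforce simp: norm_closure_def)

lemma closure_idem:
  assumes "S \<subseteq> carrier A" shows "norm_closure A (norm_closure A S) = norm_closure A S"
proof
  show "norm_closure A (norm_closure A S) \<subseteq> norm_closure A S"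
  proof
    fix a assume a: "a \<in> norm_closure A (norm_closure A S)"
    then have ac: "a \<in> carrier A" by (simp add: norm_closure_def)
    have "\<exists>x\<in>S. cnorm A (a \<ominus> x) < e" if e: "e > 0" for e
    proof -
      obtain y where y: "y \<in> norm_closure A S" "cnorm A (a \<ominus> y) < e/2"
        using closure_approx[OF a closure_in_carrier half_gt_zero[OF e]] by blast
      then obtain x where x: "x \<in> S" "cnorm A (y \<ominus> x) < e/2"
        using closure_approx[OF y(1) assms half_gt_zero[OF e]] by blast
      show ?thesis
        using norm_triangle[of a y x] x y ac assms by (force simp: norm_closure_iff)
    qed
    then show "a \<in> norm_closure A S" using ac assms by (simp add: norm_closure_iff)
  qed
qed (intro closure_subset closure_in_carrier)

lemma subspace_span: "X \<subseteq> carrier A \<Longrightarrow> lin_subspace A (lin_span A X)"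
  by (auto simp: lin_subspace_def lin_span_def intro!: exI[of _ "carrier A"])

lemma span_superset: "X \<subseteq> lin_span A X"
  by (auto simp: lin_span_def)

lemma span_least: "lin_subspace A S \<Longrightarrow> X \<subseteq> S \<Longrightarrow> lin_span A X \<subseteq> S"
  by (auto simp: lin_span_def)

lemma span_carrier: "X \<subseteq> carrier A \<Longrightarrow> lin_span A X \<subseteq> carrier A"
  by (rule span_least) (auto simp: lin_subspace_def)

lemma subspace_closure:
  assumes "lin_subspace A S" shows "lin_subspace A (norm_closure A S)"
proof -
  have S: "S \<subseteq> carrier A" "\<zero> \<in> S" "\<And>a b. a \<in> S \<Longrightarrow> b \<in> S \<Longrightarrow> a \<oplus> b \<in> S"
      "\<And>a z. a \<in> S \<Longrightarrow> scale A z a \<in> S"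
    using assms by (auto simp: lin_subspace_def)
  have sub: "\<And>x. x \<in> S \<Longrightarrow> x \<in> carrier A" using S by blast
  show ?thesis unfolding lin_subspace_def
  proof (intro conjI ballI allI)
    show "norm_closure A S \<subseteq> carrier A" by (rule closure_in_carrier)
    show "\<zero> \<in> norm_closure A S" using closure_subset S by blast
    fix a assume a: "a \<in> norm_closure A S"
    then have ac: "a \<in> carrier A" by (simp add: norm_closure_def)
    { fix b assume b: "b \<in> norm_closure A S"
      then have bc: "b \<in> carrier A" by (simp add: norm_closure_def)
      have "\<exists>x\<in>S. cnorm A (a \<oplus> b \<ominus> x) < e" if e: "e > 0" for e
      proof -
        obtain x where x: "x \<in> S" "cnorm A (a \<ominus> x) < e/2"
          using closure_approx[OF a S(1) half_gt_zero[OF e]] by blast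
        obtain y where y: "y \<in> S" "cnorm A (b \<ominus> y) < e/2"
          using closure_approx[OF b S(1) half_gt_zero[OF e]] by blast
        have "cnorm A (a \<oplus> b \<ominus> (x \<oplus> y)) < e"
          using norm_diff_plus[OF ac bc sub[OF x(1)] sub[OF y(1)]] x(2) y(2) by linarith
        then show ?thesis using S(3)[OF x(1) y(1)] by blast
      qed
      with ac bc S(1) show "a \<oplus> b \<in> norm_closure A S" by (simp add: norm_closure_iff) }
    fix z
    have "\<exists>x\<in>S. cnorm A (scale A z a \<ominus> x) < e" if e: "e > 0" for e
    proof -
      \<comment> \<open>Dividing by \<open>cmod z + 1\<close> instead of \<open>cmod z\<close>
        covers the case \<open>z = 0\<close>.\<close>
      have "e / (cmod z + 1) > 0" using that by (simp add: add_nonneg_pos)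
      then obtain x where x: "x \<in> S" "cnorm A (a \<ominus> x) < e / (cmod z + 1)"
        using closure_approx[OF a S(1)] by blast
      have xc: "x \<in> carrier A" using x(1) by (rule sub)
      have "cmod z * cnorm A (a \<ominus> x) \<le> (cmod z + 1) * cnorm A (a \<ominus> x)"
        using xc ac by (intro mult_right_mono) auto
      also have "\<dots> < e" using x by (simp add: pos_less_divide_eq add_nonneg_pos mult.commute)
      finally have "cnorm A (scale A z a \<ominus> scale A z x) < e"
        using xc ac by (simp add: scale_minus[symmetric] norm_scale)
      then show ?thesis using S(4)[OF x(1)] by blast
    qed
    with ac S(1) show "scale A z a \<in> norm_closure A S" by (simp add: norm_closure_iff)
  qed
qed

lemma subspaceD:
  assumes "lin_subspace A S"
  shows "S \<subseteq> carrier A" "\<zero> \<in> S" "\<And>a b. a \<in> S \<Longrightarrow> b \<in> S \<Longrightarrow> a \<oplus> b \<in> S"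
    "\<And>a z. a \<in> S \<Longrightarrow> scale A z a \<in> S"
  using assms by (auto simp: lin_subspace_def)

text \<open>Bilinearity is used one factor at a time. For \<open>x\<close> in \<open>X\<close>, the
  \<open>b\<close> in the span with \<open>x \<otimes> b\<close> in the span form a subspace
  containing \<open>X\<close>, hence are all of it; the same argument in the left factor
  finishes.\<close>

lemma span_closed_mult:
  assumes X: "X \<subseteq> carrier A" and m: "\<And>a b. a \<in> X \<Longrightarrow> b \<in> X \<Longrightarrow> a \<otimes> b \<in> X"
    and ab: "a \<in> lin_span A X" "b \<in> lin_span A X"
  shows "a \<otimes> b \<in> lin_span A X"
proof -
  note sp = subspaceD[OF subspace_span[OF X]]
  have c: "x \<in> carrier A" if "x \<in> lin_span A X" for x using that sp(1) by blast
  have 1: "x \<otimes> b \<in> lin_span A X" if "x \<in> X" "b \<in> lin_span A X" for x b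
  proof -
    have "lin_subspace A {b \<in> lin_span A X. x \<otimes> b \<in> lin_span A X}"
      using that X sp by (auto simp: lin_subspace_def c mult_plus mult_scale subset_iff)
    then have "lin_span A X \<subseteq> {b \<in> lin_span A X. x \<otimes> b \<in> lin_span A X}"
      using that m span_superset by (intro span_least) (auto simp: subset_iff)
    with that show ?thesis by blast
  qed
  have "lin_subspace A {a \<in> lin_span A X. a \<otimes> b \<in> lin_span A X}"
    using ab X sp by (auto simp: lin_subspace_def c plus_mult scale_mult)
  then have "lin_span A X \<subseteq> {a \<in> lin_span A X. a \<otimes> b \<in> lin_span A X}"
    using 1 ab span_superset by (intro span_least) auto
  with ab show ?thesis by blast
qed

lemma span_closed_adj:
  assumes X: "X \<subseteq> carrier A" and m: "\<And>a. a \<in> X \<Longrightarrow> adj A a \<in> X" and a: "a \<in> lin_span A X"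
  shows "adj A a \<in> lin_span A X"
proof -
  note sp = subspaceD[OF subspace_span[OF X]]
  have c: "x \<in> carrier A" if "x \<in> lin_span A X" for x using that sp(1) by blast
  have "lin_subspace A {a \<in> lin_span A X. adj A a \<in> lin_span A X}"
    using X sp by (auto simp: lin_subspace_def c adj_plus adj_scale)
  then have "lin_span A X \<subseteq> {a \<in> lin_span A X. adj A a \<in> lin_span A X}"
    using m span_superset by (intro span_least) auto
  with a show ?thesis by blast
qed

lemma subalgebra_closure_span:
  assumes X: "X \<subseteq> carrier A" and m: "\<And>a b. a \<in> X \<Longrightarrow> b \<in> X \<Longrightarrow> a \<otimes> b \<in> X"
    and ad: "\<And>a. a \<in> X \<Longrightarrow> adj A a \<in> X"
  shows "cstar_subalgebra A (norm_closure A (lin_span A X))"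
proof -
  let ?S = "lin_span A X"
  have S: "?S \<subseteq> carrier A" using X by (rule span_carrier)
  then have c: "\<And>x. x \<in> ?S \<Longrightarrow> x \<in> carrier A" by blast
  show ?thesis unfolding cstar_subalgebra_def
  proof (intro conjI ballI)
    show "lin_subspace A (norm_closure A ?S)" using X by (intro subspace_closure subspace_span)
    show "norm_closure A (norm_closure A ?S) = norm_closure A ?S" using S by (rule closure_idem)
    fix a assume a: "a \<in> norm_closure A ?S"
    then have ac: "a \<in> carrier A" by (simp add: norm_closure_def)
    have "\<exists>x\<in>?S. cnorm A (adj A a \<ominus> x) < e" if e: "e > 0" for e
    proof -
      obtain x where "x \<in> ?S" "cnorm A (a \<ominus> x) < e" using closure_approx[OF a S e] by blast
      then show ?thesis using ac norm_adj[of "a \<ominus> x"] span_closed_adj[OF X ad]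
        by (intro bexI[of _ "adj A x"]) (auto simp: adj_minus c simp del: norm_adj)
    qed
    then show "adj A a \<in> norm_closure A ?S" using ac S by (simp add: norm_closure_iff)
    fix b assume b: "b \<in> norm_closure A ?S"
    then have bc: "b \<in> carrier A" by (simp add: norm_closure_def)
    have "\<exists>x\<in>?S. cnorm A (a \<otimes> b \<ominus> x) < e" if e: "e > 0" for e
    proof -
      \<comment> \<open>\<open>K\<close> bounds the norm of \<open>a\<close> and that of the
        approximant \<open>y\<close> of \<open>b\<close>, since the minimum with 1 below keeps
        \<open>y\<close> within distance 1 of \<open>b\<close>.\<close>
      define K where "K = cnorm A a + cnorm A b + 1"
      have K: "K > 0" using ac bc by (simp add: K_def add_nonneg_pos)
      then have "min 1 (e / (2 * K)) > 0" using that by simp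
      then obtain y where y: "y \<in> ?S" "cnorm A (b \<ominus> y) < min 1 (e / (2 * K))"
        using closure_approx[OF b S] by blast
      obtain x where x: "x \<in> ?S" "cnorm A (a \<ominus> x) < e / (2 * K)"
        using closure_approx[OF a S, of "e / (2 * K)"] e K by auto
      have "cnorm A y \<le> K" using norm_triangle'[of y b] norm_minus_commute[of y b] y bc c ac
        unfolding K_def by (smt (verit) norm_nonneg)
      moreover have "cnorm A a \<le> K" using bc by (simp add: K_def)
      ultimately have "cnorm A a * cnorm A (b \<ominus> y) + cnorm A (a \<ominus> x) * cnorm A y
          \<le> K * cnorm A (b \<ominus> y) + cnorm A (a \<ominus> x) * K"
        using x y ac bc c by (intro add_mono mult_right_mono mult_left_mono) auto
      also have "\<dots> < K * (e / (2 * K)) + (e / (2 * K)) * K"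
        using x y K by (intro add_strict_mono mult_strict_left_mono mult_strict_right_mono) auto
      also have "\<dots> = e" using K by simp
      finally show ?thesis
        using norm_diff_mult[of a b x y] x y ac bc c span_closed_mult[OF X m]
        by (intro bexI[of _ "x \<otimes> y"]) auto
    qed
    then show "a \<otimes> b \<in> norm_closure A ?S" using ac bc S by (simp add: norm_closure_iff)
  qed
qed

end

text \<open>The multiple by -1 is an additive inverse; this links the Banach space axioms to
  differences and finite sums in an \<open>abelian_group\<close>.\<close>

sublocale cstar_algebra \<subseteq> pre_cstar A
proof -
  have "\<exists>y\<in>carrier A. y \<oplus> x = \<zero>" if "x \<in> carrier A" for x
    using plus_neg[OF that] scl_in[OF that] by blast
  then interpret abelian_group A
    by (intro abelian_groupI) (simp_all add: zero_in plus_in plus_assoc plus_zero, metis plus_commute)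
  show "pre_cstar A"
    by unfold_locales
      (simp_all add: scl_in scl_one scl_scl scl_plus add_scl nrm_plus nrm_scl mult_in adj_in
        mult_assoc mult_plus plus_mult scale_mult mult_scale adj_adj adj_plus adj_scale adj_mult
        norm_mult cstar_identity)
qed

context cstar_algebra begin

lemma norm_minus_eq_zero: "\<lbrakk>x \<in> carrier A; y \<in> carrier A\<rbrakk> \<Longrightarrow> cnorm A (x \<ominus> y) = 0 \<longleftrightarrow> x = y"
  by (metis a_minus_def minus_closed minus_plus_cancel nrm_eq_0 l_zero r_neg)

lemma complete':
  assumes X: "\<And>n. X n \<in> carrier A" and c: "\<And>e. e > 0 \<Longrightarrow> \<exists>N. \<forall>m\<ge>N. \<forall>n\<ge>N. cnorm A (X m \<ominus> X n) < e"
  obtains x where "x \<in> carrier A" "(\<lambda>n. cnorm A (X n \<ominus> x)) \<longlonglongrightarrow> 0"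
proof -
  have e: "y \<oplus> scale A (- 1) w = y \<ominus> w" if "w \<in> carrier A" for y w
    using that by (simp add: scale_minus_one a_minus_def)
  have "\<exists>x\<in>carrier A. (\<lambda>n. cnorm A (X n \<oplus> scale A (- 1) x)) \<longlonglongrightarrow> 0"
    by (rule complete) (use X c in \<open>auto simp: e\<close>)
  then show ?thesis using that by (auto simp: e)
qed

lemma limit_in_closure:
  assumes "S \<subseteq> carrier A" "\<And>n. X n \<in> S" "x \<in> carrier A" "(\<lambda>n. cnorm A (X n \<ominus> x)) \<longlonglongrightarrow> 0"
  shows "x \<in> norm_closure A S"
proof -
  have "\<exists>y\<in>S. cnorm A (x \<ominus> y) < e" if e: "e > 0" for e
  proof -
    obtain n where "norm (cnorm A (X n \<ominus> x) - 0) < e"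
      using LIMSEQ_D[OF assms(4) e] by blast
    moreover have "X n \<in> carrier A" using assms by blast
    ultimately show ?thesis using assms norm_minus_commute[of x "X n"]
      by (intro bexI[of _ "X n"]) auto
  qed
  then show ?thesis using assms by (simp add: norm_closure_iff)
qed

end

section \<open>Positivity in unital C*-algebras\<close>

text \<open>The steps from \<open>n\<close> on sum to at most \<open>r ^ n / (1 - r)\<close>. The
  distance is a function of two indices, so that a norm distance on a carrier set can be inserted
  directly.\<close>

lemma geometric_Cauchy:
  fixes d :: "nat \<Rightarrow> nat \<Rightarrow> real" and r :: real
  assumes r: "0 \<le> r" "r < 1" and step: "\<And>n. d (Suc n) n \<le> r ^ n"
    and tri: "\<And>i j l. d i l \<le> d i j + d j l" and refl: "\<And>i. d i i = 0" and sym: "\<And>i j. d i j = d j i"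
    and e: "e > 0"
  shows "\<exists>N. \<forall>m\<ge>N. \<forall>n\<ge>N. d m n < e"
proof -
  have le: "d (n + p) n \<le> r ^ n * (1 - r ^ p) / (1 - r)" for n p
  proof (induction p)
    case (Suc p)
    have "d (n + Suc p) n \<le> r ^ (n + p) + r ^ n * (1 - r ^ p) / (1 - r)"
      using tri[where i = "n + Suc p" and j = "n + p" and l = n] step[of "n + p"] Suc by simp
    also have "\<dots> = r ^ n * (1 - r ^ Suc p) / (1 - r)"
      using r by (simp add: field_simps power_add)
    finally show ?case .
  qed (simp add: refl)
  have b: "d m n \<le> r ^ n / (1 - r)" if "n \<le> m" for m n
  proof -
    have "r ^ n * (1 - r ^ (m - n)) / (1 - r) \<le> r ^ n * 1 / (1 - r)"
      using r by (intro divide_right_mono mult_left_mono) auto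
    then show ?thesis using le[of n "m - n"] that by simp
  qed
  have "(\<lambda>n. r ^ n / (1 - r)) \<longlonglongrightarrow> 0 / (1 - r)"
    using r by (intro tendsto_divide LIMSEQ_realpow_zero tendsto_const) auto
  then have "eventually (\<lambda>n. r ^ n / (1 - r) < e) sequentially"
    using e by (auto intro: order_tendstoD)
  then obtain N where N: "\<And>n. n \<ge> N \<Longrightarrow> r ^ n / (1 - r) < e"
    by (auto simp: eventually_sequentially)
  have "d m n < e" if "m \<ge> N" "n \<ge> N" for m n
    using b[of n m] b[of m n] N[of m] N[of n] that sym[of m n] by (cases "n \<le> m") auto
  then show ?thesis by blast
qed

context cstar_algebra begin

section \<open>Limits of sequences and continuity of the operations\<close>

lemma limit_unique:
  assumes "x \<in> carrier A" "y \<in> carrier A" "\<And>n. X n \<in> carrier A"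
    and "(\<lambda>n. cnorm A (X n \<ominus> x)) \<longlonglongrightarrow> 0" "(\<lambda>n. cnorm A (X n \<ominus> y)) \<longlonglongrightarrow> 0"
  shows "x = y"
proof -
  have "(\<lambda>n. cnorm A (X n \<ominus> x) + cnorm A (X n \<ominus> y)) \<longlonglongrightarrow> 0 + 0"
    by (intro tendsto_add assms)
  moreover have "cnorm A (x \<ominus> y) \<le> cnorm A (X n \<ominus> x) + cnorm A (X n \<ominus> y)" for n
    using norm_triangle[of x "X n" y] norm_minus_commute[of x "X n"] assms by simp
  ultimately have "cnorm A (x \<ominus> y) \<le> 0"
    by (intro LIMSEQ_le_const[where X = "\<lambda>n. cnorm A (X n \<ominus> x) + cnorm A (X n \<ominus> y)"]) auto
  then have "cnorm A (x \<ominus> y) = 0" using assms(1,2) by (intro antisym norm_nonneg) auto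
  then show ?thesis using norm_minus_eq_zero assms(1,2) by blast
qed

lemma limit_plus:
  assumes "x \<in> carrier A" "y \<in> carrier A" "\<And>n. X n \<in> carrier A" "\<And>n. Y n \<in> carrier A"
    and "(\<lambda>n. cnorm A (X n \<ominus> x)) \<longlonglongrightarrow> 0" "(\<lambda>n. cnorm A (Y n \<ominus> y)) \<longlonglongrightarrow> 0"
  shows "(\<lambda>n. cnorm A (X n \<oplus> Y n \<ominus> (x \<oplus> y))) \<longlonglongrightarrow> 0"
proof (rule tendsto_sandwich[OF _ _ tendsto_const])
  show "(\<lambda>n. cnorm A (X n \<ominus> x) + cnorm A (Y n \<ominus> y)) \<longlonglongrightarrow> 0"
    using tendsto_add[OF assms(5,6)] by simp
qed (use assms norm_diff_plus in auto)

lemma limit_scale: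
  assumes "x \<in> carrier A" "\<And>n. X n \<in> carrier A" "(\<lambda>n. cnorm A (X n \<ominus> x)) \<longlonglongrightarrow> 0"
  shows "(\<lambda>n. cnorm A (scale A z (X n) \<ominus> scale A z x)) \<longlonglongrightarrow> 0"
  using tendsto_mult_left[OF assms(3), of "cmod z"] assms(1,2)
  by (simp add: scale_minus[symmetric] norm_scale)

lemma limit_adj:
  assumes "x \<in> carrier A" "\<And>n. X n \<in> carrier A" "(\<lambda>n. cnorm A (X n \<ominus> x)) \<longlonglongrightarrow> 0"
  shows "(\<lambda>n. cnorm A (adj A (X n) \<ominus> adj A x)) \<longlonglongrightarrow> 0"
  using assms by (simp add: adj_minus[symmetric])

lemma limit_norm:
  assumes "x \<in> carrier A" "\<And>n. X n \<in> carrier A" "(\<lambda>n. cnorm A (X n \<ominus> x)) \<longlonglongrightarrow> 0"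
  shows "(\<lambda>n. cnorm A (X n)) \<longlonglongrightarrow> cnorm A x"
proof -
  have "(\<lambda>n. cnorm A (X n) - cnorm A x) \<longlonglongrightarrow> 0"
    by (rule metric_tendsto_imp_tendsto[OF assms(3)])
       (use assms(1,2) norm_diff_abs in \<open>auto simp: dist_real_def\<close>)
  then show ?thesis by (simp add: LIM_zero_iff)
qed

lemma limit_mult:
  assumes "x \<in> carrier A" "y \<in> carrier A" "\<And>n. X n \<in> carrier A" "\<And>n. Y n \<in> carrier A"
    and "(\<lambda>n. cnorm A (X n \<ominus> x)) \<longlonglongrightarrow> 0" "(\<lambda>n. cnorm A (Y n \<ominus> y)) \<longlonglongrightarrow> 0"
  shows "(\<lambda>n. cnorm A (X n \<otimes> Y n \<ominus> x \<otimes> y)) \<longlonglongrightarrow> 0"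
proof (rule tendsto_sandwich[OF _ _ tendsto_const])
  show "(\<lambda>n. cnorm A (X n) * cnorm A (Y n \<ominus> y) + cnorm A (X n \<ominus> x) * cnorm A y) \<longlonglongrightarrow> 0"
    using tendsto_add[OF tendsto_mult[OF limit_norm[OF assms(1,3,5)] assms(6)]
        tendsto_mult_right[OF assms(5), of "cnorm A y"]] by simp
qed (use assms norm_diff_mult in auto)

text \<open>\<open>b\<close> plays the role of \<open>1 - sqrt (1 - h)\<close>; it is the fixed point of the contraction
  \<open>b \<mapsto> (h + b\<^sup>2) / 2\<close> of the ball of radius \<open>cnorm A h\<close>.\<close>

lemma quadratic_fixpoint:
  assumes h: "h \<in> carrier A" "adj A h = h" and r: "cnorm A h < 1"
  obtains b where "b \<in> carrier A" "adj A b = b" "b \<oplus> b = h \<oplus> b \<otimes> b"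
    "\<And>y. y \<in> carrier A \<Longrightarrow> y \<otimes> h = h \<otimes> y \<Longrightarrow> y \<otimes> b = b \<otimes> y"
proof -
  define X where "X = rec_nat \<zero> (\<lambda>n b. scale A (1/2) (h \<oplus> b \<otimes> b))"
  have X0: "X 0 = \<zero>" and XS: "X (Suc n) = scale A (1/2) (h \<oplus> X n \<otimes> X n)" for n
    by (simp_all add: X_def)
  define \<rho> where "\<rho> = cnorm A h"
  have \<rho>: "0 \<le> \<rho>" "\<rho> < 1" using r h by (auto simp: \<rho>_def)
  have Xc [simp]: "X n \<in> carrier A" for n using h by (induction n) (simp_all add: X0 XS)
  \<comment> \<open>The ball of radius \<rho> is invariant because
    \<open>(\<rho> + \<rho>\<^sup>2) / 2 \<le> \<rho>\<close> for \<open>\<rho> < 1\<close>.\<close>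
  have Xn: "cnorm A (X n) \<le> \<rho>" for n
  proof (induction n)
    case (Suc n)
    have "cnorm A (X n \<otimes> X n) \<le> \<rho> * \<rho>"
      using norm_mult[of "X n" "X n"] mult_mono[OF Suc Suc \<rho>(1)] by simp
    also have "\<dots> \<le> \<rho>" using \<rho> by (simp add: mult_left_le)
    finally show ?case
      using norm_plus[of h "X n \<otimes> X n"] h by (simp add: XS norm_scale \<rho>_def)
  qed (use \<rho> in \<open>simp add: X0\<close>)
  \<comment> \<open>The difference of the squares of consecutive iterates splits into two terms,
    each at most \<rho> times their distance. The factor 1/2 in the iteration compensates for there
    being two, so distances shrink by \<rho>.\<close>
  have step: "cnorm A (X (Suc n) \<ominus> X n) \<le> \<rho> ^ n" for n
  proof (induction n)
    case 0
    have "cnorm A (X 1 \<ominus> X 0) \<le> cnorm A (X 1) + cnorm A (X 0)" by (intro norm_minus) auto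
    then show ?case using Xn[of 1] \<rho> by (simp add: X0)
  next
    case (Suc n)
    have "X (Suc (Suc n)) \<ominus> X (Suc n)
        = scale A (1/2) ((h \<ominus> h) \<oplus> (X (Suc n) \<otimes> X (Suc n) \<ominus> X n \<otimes> X n))"
      unfolding XS[of "Suc n"] using h Xc[of n] Xc[of "Suc n"]
      by (subst XS[of n]) (simp only: scale_minus[symmetric] plus_diff_plus mult_in a_closed)
    also have "\<dots> = scale A (1/2) (X (Suc n) \<otimes> X (Suc n) \<ominus> X n \<otimes> X n)"
      using h by (simp add: a_minus_def r_neg)
    finally have "2 * cnorm A (X (Suc (Suc n)) \<ominus> X (Suc n))
        = cnorm A (X (Suc n) \<otimes> X (Suc n) \<ominus> X n \<otimes> X n)"
      by (simp add: norm_scale)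
    also have "\<dots> \<le> cnorm A (X (Suc n)) * cnorm A (X (Suc n) \<ominus> X n)
        + cnorm A (X (Suc n) \<ominus> X n) * cnorm A (X n)"
      by (intro norm_diff_mult) auto
    also have "\<dots> \<le> \<rho> * \<rho> ^ n + \<rho> ^ n * \<rho>"
      using Xn Suc \<rho> by (intro add_mono mult_mono) auto
    finally show ?case by simp
  qed
  have Cauchy: "\<exists>N. \<forall>m\<ge>N. \<forall>n\<ge>N. cnorm A (X m \<ominus> X n) < e" if "e > 0" for e
    by (rule geometric_Cauchy[where d = "\<lambda>m n. cnorm A (X m \<ominus> X n)", OF \<rho> step])
       (use that norm_triangle norm_minus_commute in \<open>auto simp: a_minus_def r_neg\<close>)
  obtain b where b: "b \<in> carrier A" "(\<lambda>n. cnorm A (X n \<ominus> b)) \<longlonglongrightarrow> 0"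
    by (rule complete'[OF Xc Cauchy])
  have b': "(\<lambda>n. cnorm A (X (Suc n) \<ominus> b)) \<longlonglongrightarrow> 0" using b(2) by (rule LIMSEQ_Suc)
  have "(\<lambda>n. cnorm A (h \<oplus> X n \<otimes> X n \<ominus> (h \<oplus> b \<otimes> b))) \<longlonglongrightarrow> 0"
    using h b by (intro limit_plus limit_mult) (auto simp: a_minus_def r_neg)
  then have "(\<lambda>n. cnorm A (X (Suc n) \<ominus> scale A (1/2) (h \<oplus> b \<otimes> b))) \<longlonglongrightarrow> 0"
    unfolding XS using h b by (intro limit_scale) auto
  then have fp: "b = scale A (1/2) (h \<oplus> b \<otimes> b)"
    using limit_unique[OF _ _ _ b'] h b by simp
  have "b \<oplus> b = scale A 2 b" using b by (simp add: scale_numeral_2)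
  also have "\<dots> = h \<oplus> b \<otimes> b" using h b by (subst fp) (simp add: scale_scale scale_1)
  finally have 1: "b \<oplus> b = h \<oplus> b \<otimes> b" .
  have "adj A (X n) = X n" for n
    using h by (induction n) (simp_all add: X0 XS adj_scale adj_plus adj_mult)
  then have "adj A b = b"
    using limit_unique[of "adj A b" b X] limit_adj[OF b(1) _ b(2)] b by simp
  \<comment> \<open>Each iterate is a polynomial in \<open>h\<close>, so what commutes with
    \<open>h\<close> commutes with all iterates and, multiplication being continuous, with their
    limit.\<close>
  moreover have "y \<otimes> b = b \<otimes> y" if y: "y \<in> carrier A" "y \<otimes> h = h \<otimes> y" for y
  proof -
    have c: "y \<otimes> X n = X n \<otimes> y" for n
    proof (induction n)
      case (Suc n)
      have "y \<otimes> (X n \<otimes> X n) = (X n \<otimes> X n) \<otimes> y"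
        using y(1) Suc by (metis Xc mult_assoc)
      then show ?case
        using y h by (simp add: XS mult_scale scale_mult mult_plus plus_mult)
    qed (use y in \<open>simp add: X0\<close>)
    have z: "(\<lambda>n. cnorm A (y \<ominus> y)) \<longlonglongrightarrow> 0" using y by (simp add: a_minus_def r_neg)
    have "(\<lambda>n. cnorm A (y \<otimes> X n \<ominus> y \<otimes> b)) \<longlonglongrightarrow> 0"
      using limit_mult[OF y(1) b(1) _ _ z b(2)] y by simp
    moreover have "(\<lambda>n. cnorm A (X n \<otimes> y \<ominus> b \<otimes> y)) \<longlonglongrightarrow> 0"
      using limit_mult[OF b(1) y(1) _ _ b(2) z] y by simp
    ultimately show ?thesis
      using limit_unique[of "y \<otimes> b" "b \<otimes> y" "\<lambda>n. y \<otimes> X n"] y b by (simp add: c)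
  qed
  ultimately show ?thesis using that b 1 by blast
qed

end

locale unital_cstar = cstar_algebra +
  assumes one_in: "\<one> \<in> carrier A"
    and one_mult: "a \<in> carrier A \<Longrightarrow> \<one> \<otimes> a = a"
    and mult_one: "a \<in> carrier A \<Longrightarrow> a \<otimes> \<one> = a"

sublocale unital_cstar \<subseteq> ring A
  by (intro ring.intro abelian_group_axioms monoidI ring_axioms.intro)
     (simp_all add: one_in one_mult mult_one mult_assoc mult_plus plus_mult)

context unital_cstar begin

abbreviation sc :: "real \<Rightarrow> 'a" where "sc t \<equiv> scale A (of_real t) \<one>"

lemma adj_one [simp]: "adj A \<one> = \<one>"
  by (metis adj_adj adj_in adj_mult one_in one_mult mult_one)

lemma norm_one_le: "cnorm A \<one> \<le> 1"
proof -
  have "(cnorm A \<one>)\<^sup>2 = cnorm A \<one>" using cstar_identity[of \<one>] one_in by (simp add: one_mult)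
  then have "cnorm A \<one> = 0 \<or> cnorm A \<one> = 1" by (simp add: power2_eq_square)
  then show ?thesis by linarith
qed

lemma sc_norm: "cnorm A (sc t) \<le> \<bar>t\<bar>"
  using norm_one_le by (simp add: norm_scale one_in mult_left_le)

lemma adj_sc [simp]: "adj A (sc t) = sc t" by (simp add: adj_scale one_in)

lemma sc_in [simp]: "sc t \<in> carrier A" by (simp add: one_in)

lemma sc_mult: "x \<in> carrier A \<Longrightarrow> sc t \<otimes> x = scale A (of_real t) x"
  by (simp add: scale_mult one_in)

lemma mult_sc: "x \<in> carrier A \<Longrightarrow> x \<otimes> sc t = scale A (of_real t) x"
  by (simp add: mult_scale one_in)

lemma sc_add: "sc s \<oplus> sc t = sc (s + t)" by (simp add: plus_scale one_in)

lemma cstar_identity_sa: "x \<in> carrier A \<Longrightarrow> adj A x = x \<Longrightarrow> cnorm A (x \<otimes> x) = (cnorm A x)\<^sup>2"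
  using cstar_identity[of x] by simp

text \<open>Put \<open>h = (t - p) / t\<close>, which has norm less than 1, so that
  \<open>p = t (1 - h)\<close>. The solution \<open>b\<close> of \<open>2 b = h + b\<^sup>2\<close>
  satisfies \<open>(1 - b)\<^sup>2 = 1 - h\<close>; hence \<open>sqrt t (1 - b)\<close> squares to
  \<open>p\<close>. The clause on commuting elements stands in for the functional calculus.\<close>

lemma sqrt_exists:
  assumes p: "p \<in> carrier A" "adj A p = p" and t: "cnorm A (sc t \<ominus> p) < t"
  obtains d where "d \<in> carrier A" "adj A d = d" "d \<otimes> d = p"
    "\<And>y. y \<in> carrier A \<Longrightarrow> y \<otimes> p = p \<otimes> y \<Longrightarrow> y \<otimes> d = d \<otimes> y"
proof -
  have t0: "t > 0" using t p(1) norm_nonneg[of "sc t \<ominus> p"] sc_in[of t] by (meson le_less_trans minus_closed)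
  define h where "h = scale A (of_real (1/t)) (sc t \<ominus> p)"
  have h: "h \<in> carrier A" "adj A h = h"
    using p by (simp_all add: h_def adj_scale adj_minus)
  have "cnorm A h < 1" using t t0 p by (simp add: h_def norm_scale norm_divide)
  then obtain b where b: "b \<in> carrier A" "adj A b = b" "b \<oplus> b = h \<oplus> b \<otimes> b"
    and cb: "\<And>y. y \<in> carrier A \<Longrightarrow> y \<otimes> h = h \<otimes> y \<Longrightarrow> y \<otimes> b = b \<otimes> y"
    using quadratic_fixpoint[OF h] by metis
  define e where "e = \<one> \<ominus> b"
  define d where "d = scale A (of_real (sqrt t)) e"
  have e: "e \<in> carrier A" "adj A e = e" using b by (simp_all add: e_def adj_minus)
  have "e \<otimes> e = \<one> \<ominus> (b \<oplus> b) \<oplus> b \<otimes> b"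
    using b(1) by (simp add: e_def minus_mult mult_minus one_in) algebra
  also have "\<dots> = \<one> \<ominus> h"
    using b(1) h(1) by (simp add: b(3)) algebra
  finally have ee: "e \<otimes> e = \<one> \<ominus> h" .
  have "complex_of_real (sqrt t) * complex_of_real (sqrt t) = of_real t"
    using t0 by (metis less_eq_real_def of_real_mult real_sqrt_mult_self abs_of_pos)
  then have "d \<otimes> d = scale A (of_real t) (\<one> \<ominus> h)"
    using e by (simp add: d_def scale_mult mult_scale scale_scale ee h one_in)
  also have "\<dots> = sc t \<ominus> (sc t \<ominus> p)"
    using h p t0 by (simp add: scale_minus one_in h_def scale_scale scale_1)
  also have "\<dots> = p" using p sc_in[of t] by algebra
  finally have "d \<otimes> d = p" .
  moreover have "y \<otimes> d = d \<otimes> y" if y: "y \<in> carrier A" "y \<otimes> p = p \<otimes> y" for y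
  proof -
    have "y \<otimes> h = h \<otimes> y"
      using y p by (simp add: h_def mult_scale scale_mult mult_minus minus_mult mult_sc sc_mult)
    then have "y \<otimes> b = b \<otimes> y" using cb y by blast
    then show ?thesis using y b
      by (simp add: d_def e_def mult_scale scale_mult mult_minus minus_mult one_in)
  qed
  moreover have "d \<in> carrier A" "adj A d = d" using e by (simp_all add: d_def adj_scale)
  ultimately show ?thesis using that by blast
qed

text \<open>\<open>c + \<i> d\<close> is \<open>sqrt t\<close> times a unitary, of which \<open>c\<close> is the real part.\<close>

lemma sum_squares_bound:
  assumes c: "c \<in> carrier A" "adj A c = c" and d: "d \<in> carrier A" "adj A d = d"
    and cd: "c \<otimes> d = d \<otimes> c" and t: "c \<otimes> c \<oplus> d \<otimes> d = sc t" "0 \<le> t"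
  shows "(cnorm A c)\<^sup>2 \<le> t" "cnorm A (c \<otimes> c \<ominus> d \<otimes> d) \<le> t"
proof -
  define e where "e = scale A \<i> d"
  define w where "w = c \<oplus> e"
  have e: "e \<in> carrier A" "adj A e = \<ominus> e" "e \<otimes> e = \<ominus> (d \<otimes> d)" "c \<otimes> e = e \<otimes> c"
    using c d cd by (simp_all add: e_def adj_scale scale_uminus scale_mult mult_scale scale_scale
        scale_minus_one scale_1)
  have w: "w \<in> carrier A" "adj A w = c \<ominus> e"
    using c e by (simp_all add: w_def adj_plus a_minus_def)
  have "adj A w \<otimes> w = c \<otimes> c \<ominus> e \<otimes> e \<oplus> (c \<otimes> e \<ominus> e \<otimes> c)"
    unfolding w(2) unfolding w_def using c(1) e(1) by algebra
  also have "\<dots> = c \<otimes> c \<oplus> d \<otimes> d"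
    unfolding e(3,4) using c(1) d(1) e(1) by algebra
  finally have "(cnorm A w)\<^sup>2 \<le> t"
    using cstar_identity[OF w(1)] sc_norm[of t] t by simp
  have "c \<oplus> c = w \<oplus> adj A w" unfolding w(2) unfolding w_def using c(1) e(1) by algebra
  then have "2 * cnorm A c \<le> 2 * cnorm A w"
    using norm_plus[of w "adj A w"] norm_adj[OF w(1)] w(1) c(1) norm_scale[of c 2]
    by (simp add: scale_numeral_2)
  then show "(cnorm A c)\<^sup>2 \<le> t"
    using \<open>(cnorm A w)\<^sup>2 \<le> t\<close> power_mono[of "cnorm A c" "cnorm A w" 2] c(1) by simp
  \<comment> \<open>Twice the real part of \<open>w\<^sup>2\<close> is
    \<open>2 (c\<^sup>2 - d\<^sup>2)\<close>, so the second bound follows from the bound on the norm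
    of \<open>w\<close>.\<close>
  have "w \<otimes> w \<oplus> adj A w \<otimes> adj A w = (c \<otimes> c \<oplus> e \<otimes> e) \<oplus> (c \<otimes> c \<oplus> e \<otimes> e)"
    unfolding w(2) unfolding w_def using c(1) e(1) by algebra
  also have "\<dots> = (c \<otimes> c \<ominus> d \<otimes> d) \<oplus> (c \<otimes> c \<ominus> d \<otimes> d)"
    by (simp add: e(3) a_minus_def)
  finally have "2 * cnorm A (c \<otimes> c \<ominus> d \<otimes> d) = cnorm A (w \<otimes> w \<oplus> adj A w \<otimes> adj A w)"
    using norm_scale[of "c \<otimes> c \<ominus> d \<otimes> d" 2] c d by (simp add: scale_numeral_2)
  also have "\<dots> \<le> cnorm A w * cnorm A w + cnorm A (adj A w) * cnorm A (adj A w)"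
    using w(1) by (intro order_trans[OF norm_plus] add_mono norm_mult) auto
  also have "\<dots> \<le> 2 * t" using \<open>(cnorm A w)\<^sup>2 \<le> t\<close> w(1) by (simp add: power2_eq_square)
  finally show "cnorm A (c \<otimes> c \<ominus> d \<otimes> d) \<le> t" by simp
qed

text \<open>For self-adjoint \<open>p\<close> the inequality
  \<open>\<parallel>t - p\<parallel> \<le> t\<close> says that the spectrum lies in
  \<open>[0, 2t]\<close>. In this form positivity can be handled without spectra, and sums are
  positive because the radii \<open>t\<close> add up.\<close>

definition pos :: "'a \<Rightarrow> bool" where
  "pos p \<longleftrightarrow> p \<in> carrier A \<and> adj A p = p \<and> (\<exists>t\<ge>0. cnorm A (sc t \<ominus> p) \<le> t)"

lemma pos_in: "pos p \<Longrightarrow> p \<in> carrier A" by (simp add: pos_def)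

lemma pos_plus:
  assumes "pos p" "pos q" shows "pos (p \<oplus> q)"
proof -
  obtain s t where st: "s \<ge> 0" "cnorm A (sc s \<ominus> p) \<le> s" "t \<ge> 0" "cnorm A (sc t \<ominus> q) \<le> t"
    using assms by (auto simp: pos_def)
  have pq: "p \<in> carrier A" "q \<in> carrier A" using assms by (simp_all add: pos_in)
  have "cnorm A (sc (s + t) \<ominus> (p \<oplus> q)) \<le> s + t"
    using norm_diff_plus[of "sc s" "sc t" p q] st pq by (simp add: sc_add)
  then show ?thesis using assms st unfolding pos_def
    by (intro conjI exI[of _ "s + t"]) (auto simp: adj_plus)
qed

lemma pos_scale:
  assumes "pos p" "s \<ge> 0" shows "pos (scale A (of_real s) p)"
proof -
  obtain t where t: "t \<ge> 0" "cnorm A (sc t \<ominus> p) \<le> t" using assms by (auto simp: pos_def)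
  have "sc (s * t) \<ominus> scale A (of_real s) p = scale A (of_real s) (sc t \<ominus> p)"
    using pos_in[OF assms(1)] by (simp add: scale_minus scale_scale one_in)
  then show ?thesis using assms t unfolding pos_def
    by (intro conjI exI[of _ "s * t"]) (auto simp: adj_scale norm_scale mult_left_mono)
qed

text \<open>The shift by \<epsilon> turns the weak inequality at radius \<open>t\<close> into the
  strict one at radius \<open>t + \<epsilon>\<close> that \<open>sqrt_exists\<close> demands. Every
  application lets \<epsilon> tend to 0 in a norm estimate.\<close>

lemma pos_sqrt:
  assumes "pos p" "\<epsilon> > 0"
  obtains d where "d \<in> carrier A" "adj A d = d" "d \<otimes> d = p \<oplus> sc \<epsilon>"
    "\<And>y. y \<in> carrier A \<Longrightarrow> y \<otimes> p = p \<otimes> y \<Longrightarrow> y \<otimes> d = d \<otimes> y"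
proof -
  obtain t where t: "t \<ge> 0" "cnorm A (sc t \<ominus> p) \<le> t" using assms by (auto simp: pos_def)
  have p: "p \<in> carrier A" "adj A p = p" using assms by (simp_all add: pos_def)
  have "sc (t + \<epsilon>) \<ominus> (p \<oplus> sc \<epsilon>) = sc t \<ominus> p"
    using p(1) sc_in[of t] sc_in[of \<epsilon>] unfolding sc_add[symmetric] by algebra
  then have "cnorm A (sc (t + \<epsilon>) \<ominus> (p \<oplus> sc \<epsilon>)) < t + \<epsilon>" using t assms by simp
  moreover have "p \<oplus> sc \<epsilon> \<in> carrier A" "adj A (p \<oplus> sc \<epsilon>) = p \<oplus> sc \<epsilon>"
    using p by (simp_all add: adj_plus)
  ultimately obtain d where "d \<in> carrier A" "adj A d = d" "d \<otimes> d = p \<oplus> sc \<epsilon>"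
    and c: "\<And>y. y \<in> carrier A \<Longrightarrow> y \<otimes> (p \<oplus> sc \<epsilon>) = (p \<oplus> sc \<epsilon>) \<otimes> y \<Longrightarrow> y \<otimes> d = d \<otimes> y"
    using sqrt_exists by blast
  moreover have "y \<otimes> d = d \<otimes> y" if "y \<in> carrier A" "y \<otimes> p = p \<otimes> y" for y
    using c[of y] that p by (simp add: mult_plus plus_mult mult_sc sc_mult)
  ultimately show ?thesis using that by blast
qed

lemma pos_of_norm_le: "\<lbrakk>p \<in> carrier A; adj A p = p; cnorm A p \<le> t\<rbrakk> \<Longrightarrow> pos (sc t \<ominus> p)"
  unfolding pos_def
proof (intro conjI exI[of _ t])
  assume p: "p \<in> carrier A" "adj A p = p" "cnorm A p \<le> t"
  show "t \<ge> 0" using p norm_nonneg[of p] by linarith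
  have "sc t \<ominus> (sc t \<ominus> p) = p" using p(1) sc_in[of t] by algebra
  then show "cnorm A (sc t \<ominus> (sc t \<ominus> p)) \<le> t" using p by simp
qed (auto simp: adj_minus)

text \<open>Choose \<open>d\<close> with \<open>d\<^sup>2 = t - c\<^sup>2\<close>. Then
  \<open>c\<^sup>2 + d\<^sup>2 = t\<close>, and
  \<open>t - 2 c\<^sup>2 = d\<^sup>2 - c\<^sup>2\<close> has norm at most \<open>t\<close> by
  \<open>sum_squares_bound\<close>; thus \<open>2 c\<^sup>2\<close> is positive with radius
  \<open>t\<close>.\<close>

lemma pos_square:
  assumes c: "c \<in> carrier A" "adj A c = c" shows "pos (c \<otimes> c)"
proof -
  define t where "t = cnorm A (c \<otimes> c) + 1"
  have t: "t > 0" using c by (simp add: t_def add_nonneg_pos)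
  have eq: "sc t \<ominus> (sc t \<ominus> c \<otimes> c) = c \<otimes> c" using c(1) sc_in[of t] by algebra
  then have "cnorm A (sc t \<ominus> (sc t \<ominus> c \<otimes> c)) < t" by (simp add: t_def)
  moreover have "sc t \<ominus> c \<otimes> c \<in> carrier A" "adj A (sc t \<ominus> c \<otimes> c) = sc t \<ominus> c \<otimes> c"
    using c by (simp_all add: adj_minus adj_mult)
  ultimately obtain d where d: "d \<in> carrier A" "adj A d = d" "d \<otimes> d = sc t \<ominus> c \<otimes> c"
    and com: "\<And>y. y \<in> carrier A \<Longrightarrow> y \<otimes> (sc t \<ominus> c \<otimes> c) = (sc t \<ominus> c \<otimes> c) \<otimes> y \<Longrightarrow> y \<otimes> d = d \<otimes> y"
    using sqrt_exists by blast
  have "c \<otimes> d = d \<otimes> c"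
    using c com[of c] by (simp add: mult_minus minus_mult mult_sc sc_mult mult_assoc)
  moreover have "c \<otimes> c \<oplus> d \<otimes> d = sc t" using c(1) sc_in[of t] unfolding d(3) by algebra
  ultimately have le: "cnorm A (c \<otimes> c \<ominus> d \<otimes> d) \<le> t"
    using sum_squares_bound(2)[OF c d(1,2)] t by simp
  have "sc t \<ominus> (c \<otimes> c \<oplus> c \<otimes> c) = d \<otimes> d \<ominus> c \<otimes> c"
    using c(1) sc_in[of t] unfolding d(3) by algebra
  then have "cnorm A (sc t \<ominus> (c \<otimes> c \<oplus> c \<otimes> c)) \<le> t"
    using le norm_minus_commute[of "c \<otimes> c" "d \<otimes> d"] c d by simp
  then have "pos (c \<otimes> c \<oplus> c \<otimes> c)"
    unfolding pos_def using c t by (intro conjI exI[of _ t]) (auto simp: adj_plus adj_mult)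
  from pos_scale[OF this, of "1/2"] show ?thesis
    using c by (simp add: scale_numeral_2[symmetric] scale_scale scale_1)
qed

text \<open>Up to \<delta>, the elements \<open>p\<close> and \<open>t - p\<close> are squares
  \<open>c\<^sup>2\<close> and \<open>d\<^sup>2\<close> with sum \<open>t\<close>, so the squared
  norm of \<open>c\<close> is at most \<open>t\<close>. Of the three \<delta> in \<epsilon>, two
  come from the shifts under the roots and one from removing the shift of \<open>p\<close>.\<close>

lemma pos_bound:
  assumes "pos p" "pos (sc t \<ominus> p)" "t \<ge> 0" shows "cnorm A p \<le> t"
proof (rule field_le_epsilon)
  fix \<epsilon> :: real assume "\<epsilon> > 0"
  define \<delta> where "\<delta> = \<epsilon> / 3"
  have \<delta>: "\<delta> > 0" "\<epsilon> = 3 * \<delta>" using \<open>\<epsilon> > 0\<close> by (simp_all add: \<delta>_def)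
  have p: "p \<in> carrier A" using assms pos_in by blast
  obtain c where c: "c \<in> carrier A" "adj A c = c" "c \<otimes> c = p \<oplus> sc \<delta>"
    and cc: "\<And>y. y \<in> carrier A \<Longrightarrow> y \<otimes> p = p \<otimes> y \<Longrightarrow> y \<otimes> c = c \<otimes> y"
    by (rule pos_sqrt[OF assms(1) \<delta>(1)]) blast
  obtain d where d: "d \<in> carrier A" "adj A d = d" "d \<otimes> d = sc t \<ominus> p \<oplus> sc \<delta>"
    and dc: "\<And>y. y \<in> carrier A \<Longrightarrow> y \<otimes> (sc t \<ominus> p) = (sc t \<ominus> p) \<otimes> y \<Longrightarrow> y \<otimes> d = d \<otimes> y"
    by (rule pos_sqrt[OF assms(2) \<delta>(1)]) blast
  \<comment> \<open>\<open>p\<close> commutes with \<open>t - p\<close>, hence with the root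
    \<open>d\<close>; so \<open>d\<close> commutes with \<open>p\<close>, hence with the root
    \<open>c\<close>.\<close>
  have "p \<otimes> d = d \<otimes> p" using p by (intro dc) (auto simp: mult_minus minus_mult mult_sc sc_mult)
  then have cd: "c \<otimes> d = d \<otimes> c" using cc[of d] d by simp
  have "c \<otimes> c \<oplus> d \<otimes> d = sc t \<oplus> (sc \<delta> \<oplus> sc \<delta>)"
    using p sc_in[of t] sc_in[of \<delta>] unfolding c(3) d(3) by algebra
  also have "\<dots> = sc (t + 2 * \<delta>)" unfolding sc_add by simp
  finally have "(cnorm A c)\<^sup>2 \<le> t + 2 * \<delta>"
    using sum_squares_bound(1)[OF c(1,2) d(1,2) cd] assms \<delta> by simp
  then have "cnorm A (p \<oplus> sc \<delta>) \<le> t + 2 * \<delta>"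
    using cstar_identity_sa[OF c(1,2)] c(3) by simp
  moreover have "p = (p \<oplus> sc \<delta>) \<ominus> sc \<delta>" using p sc_in[of \<delta>] by algebra
  ultimately show "cnorm A p \<le> t + \<epsilon>"
    using norm_minus[of "p \<oplus> sc \<delta>" "sc \<delta>"] sc_norm[of \<delta>] p \<delta> by simp
qed

text \<open>Adding the squares of the real and imaginary parts of \<open>y\<close>.\<close>

lemma pos_adj_mult_plus_mult_adj:
  assumes y: "y \<in> carrier A" shows "pos (adj A y \<otimes> y \<oplus> y \<otimes> adj A y)"
proof -
  let ?z = "adj A y"
  define a where "a = y \<oplus> ?z"
  define b where "b = scale A \<i> (y \<ominus> ?z)"
  have "adj A a = a" using y by (simp add: a_def adj_plus adj_adj a_comm)
  then have "pos (a \<otimes> a)" using y by (intro pos_square) (auto simp: a_def)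
  have "adj A b = scale A (- \<i>) (?z \<ominus> y)" using y by (simp add: b_def adj_scale adj_minus adj_adj)
  also have "\<dots> = b"
    using y by (simp add: b_def scale_uminus scale_neg[symmetric] a_minus_def minus_add a_comm)
  finally have "pos (b \<otimes> b)" using y by (intro pos_square) (auto simp: b_def)
  have bb: "b \<otimes> b = \<ominus> ((y \<ominus> ?z) \<otimes> (y \<ominus> ?z))"
    using y by (simp add: b_def mult_scale scale_mult scale_scale scale_minus_one)
  have "a \<otimes> a \<oplus> b \<otimes> b = (?z \<otimes> y \<oplus> y \<otimes> ?z) \<oplus> (?z \<otimes> y \<oplus> y \<otimes> ?z)"
    unfolding bb unfolding a_def using y adj_in[OF y] by algebra
  then have "pos (scale A 2 (?z \<otimes> y \<oplus> y \<otimes> ?z))"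
    using pos_plus[OF \<open>pos (a \<otimes> a)\<close> \<open>pos (b \<otimes> b)\<close>] y by (simp add: scale_numeral_2)
  from pos_scale[OF this, of "1/2"] show ?thesis using y by (simp add: scale_scale scale_1)
qed

text \<open>Kaplansky's theorem. For \<open>u = 1 - x\<^sup>*x\<close>, \<open>v = 1 - xx\<^sup>*\<close> and \<open>y = x sqrt (1 + u)\<close> one has
  \<open>y\<^sup>*y = 1 - u\<^sup>2\<close> and \<open>yy\<^sup>* = 1 - v\<^sup>2\<close>. Since \<open>y\<^sup>*y + yy\<^sup>*\<close> is positive, so is \<open>2 - u\<^sup>2\<close>;
  hence \<open>y\<close> is again a contraction, and the bound for \<open>y\<close> improves the one for \<open>x\<close>.\<close>

lemma one_minus_adj_mult_bound:
  "x \<in> carrier A \<Longrightarrow> cnorm A x \<le> 1 \<Longrightarrow> cnorm A (\<one> \<ominus> adj A x \<otimes> x) \<le> 2 powr (1 / 2 ^ n)"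
proof (induction n arbitrary: x)
  case 0
  have "cnorm A (adj A x \<otimes> x) \<le> 1" using 0 by (simp add: cstar_identity power_le_one)
  then show ?case using norm_minus[of \<one> "adj A x \<otimes> x"] norm_one_le 0 by simp
next
  case (Suc n)
  note x = Suc.prems(1)
  have sc: "sc 1 = \<one>" "sc 2 = \<one> \<oplus> \<one>" by (simp_all add: scale_1 scale_numeral_2 one_in)
  define h where "h = adj A x \<otimes> x"
  define k where "k = x \<otimes> adj A x"
  define u where "u = \<one> \<ominus> h"
  define v where "v = \<one> \<ominus> k"
  have in': "h \<in> carrier A" "k \<in> carrier A" "u \<in> carrier A" "v \<in> carrier A"
    using x by (simp_all add: h_def k_def u_def v_def)
  have sa: "adj A h = h" "adj A k = k" using x by (simp_all add: h_def k_def adj_mult adj_adj)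
  then have sa': "adj A u = u" "adj A v = v" using in' by (simp_all add: u_def v_def adj_minus)
  \<comment> \<open>\<open>f\<close> is to be a square root of \<open>1 + u = 2 - h\<close>. Radius
    2 is admissible because \<open>2 - (2 - h) = h\<close> has norm at most 1.\<close>
  have "cnorm A h \<le> 1" using Suc.prems by (simp add: h_def cstar_identity power_le_one)
  moreover have "sc 2 \<ominus> (sc 2 \<ominus> h) = h" using in' sc_in[of 2] by algebra
  ultimately have "cnorm A (sc 2 \<ominus> (sc 2 \<ominus> h)) < 2" by simp
  moreover have "sc 2 \<ominus> h \<in> carrier A" "adj A (sc 2 \<ominus> h) = sc 2 \<ominus> h"
    using in' sa by (simp_all only: minus_closed sc_in adj_minus adj_sc)
  ultimately obtain f where f: "f \<in> carrier A" "adj A f = f" "f \<otimes> f = sc 2 \<ominus> h"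
    and fc: "\<And>y. y \<in> carrier A \<Longrightarrow> y \<otimes> (sc 2 \<ominus> h) = (sc 2 \<ominus> h) \<otimes> y \<Longrightarrow> y \<otimes> f = f \<otimes> y"
    using sqrt_exists by blast
  have fh: "h \<otimes> f = f \<otimes> h"
    using in' by (intro fc) (auto simp: mult_minus minus_mult mult_scale scale_mult one_in)
  define y where "y = x \<otimes> f"
  have y: "y \<in> carrier A" "adj A y = f \<otimes> adj A x" using x f by (simp_all add: y_def adj_mult)
  have "adj A y \<otimes> y = f \<otimes> h \<otimes> f" using x f unfolding y(2) unfolding y_def h_def by (simp add: mult_assoc)
  also have "\<dots> = h \<otimes> (f \<otimes> f)" using in'(1) f(1) by (simp only: fh[symmetric] mult_assoc)
  also have "\<dots> = \<one> \<ominus> u \<otimes> u" unfolding f(3) sc u_def using in'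
    by (simp add: mult_minus minus_mult mult_plus one_in) algebra
  finally have yy: "adj A y \<otimes> y = \<one> \<ominus> u \<otimes> u" .
  have "y \<otimes> adj A y = x \<otimes> (f \<otimes> f) \<otimes> adj A x"
    using x f(1) unfolding y(2) unfolding y_def by (simp add: mult_assoc)
  also have "\<dots> = x \<otimes> adj A x \<oplus> x \<otimes> adj A x \<ominus> (x \<otimes> adj A x) \<otimes> (x \<otimes> adj A x)"
    unfolding f(3) sc h_def using x adj_in[OF x]
    by (simp add: mult_minus minus_mult mult_plus plus_mult one_in mult_assoc)
  also have "\<dots> = \<one> \<ominus> v \<otimes> v" unfolding v_def k_def[symmetric] using in'
    by (simp add: mult_minus minus_mult one_in) algebra
  finally have yy': "y \<otimes> adj A y = \<one> \<ominus> v \<otimes> v" .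
  \<comment> \<open>\<open>y\<^sup>*y + yy\<^sup>* = 2 - u\<^sup>2 - v\<^sup>2\<close>, and adding
    the positive element \<open>v\<^sup>2\<close> leaves \<open>2 - u\<^sup>2\<close>.\<close>
  have "pos ((adj A y \<otimes> y \<oplus> y \<otimes> adj A y) \<oplus> v \<otimes> v)"
    using y in' sa' by (intro pos_plus pos_adj_mult_plus_mult_adj pos_square) auto
  also have "(adj A y \<otimes> y \<oplus> y \<otimes> adj A y) \<oplus> v \<otimes> v = sc 2 \<ominus> u \<otimes> u"
    unfolding yy yy' sc using in' by algebra
  finally have pos: "pos (sc 2 \<ominus> u \<otimes> u)" .
  \<comment> \<open>With \<open>d\<^sup>2 = 2 - u\<^sup>2 + \<epsilon>\<close> the squares of
    \<open>u\<close> and \<open>d\<close> add up to \<open>2 + \<epsilon>\<close>, so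
    \<open>u\<^sup>2 - d\<^sup>2\<close> has norm at most \<open>2 + \<epsilon>\<close>. As
    \<open>2 (1 - u\<^sup>2) = d\<^sup>2 - u\<^sup>2 - \<epsilon>\<close>, the bound
    \<open>1 + \<epsilon>\<close> results.\<close>
  have "cnorm A (\<one> \<ominus> u \<otimes> u) \<le> 1"
  proof (rule field_le_epsilon)
    fix \<epsilon> :: real assume \<epsilon>: "\<epsilon> > 0"
    obtain d where d: "d \<in> carrier A" "adj A d = d" "d \<otimes> d = sc 2 \<ominus> u \<otimes> u \<oplus> sc \<epsilon>"
      and dc: "\<And>y. y \<in> carrier A \<Longrightarrow> y \<otimes> (sc 2 \<ominus> u \<otimes> u) = (sc 2 \<ominus> u \<otimes> u) \<otimes> y \<Longrightarrow> y \<otimes> d = d \<otimes> y"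
      by (rule pos_sqrt[OF pos \<epsilon>]) blast
    have ud: "u \<otimes> d = d \<otimes> u"
      using in' by (intro dc) (auto simp: mult_minus minus_mult mult_scale scale_mult one_in mult_assoc)
    have "u \<otimes> u \<oplus> d \<otimes> d = sc 2 \<oplus> sc \<epsilon>"
      unfolding d(3) using in' sc_in[of 2] sc_in[of \<epsilon>] by algebra
    then have "cnorm A (u \<otimes> u \<ominus> d \<otimes> d) \<le> 2 + \<epsilon>"
      using sum_squares_bound(2)[OF in'(3) sa'(1) d(1,2) ud, of "2 + \<epsilon>"] \<epsilon> sc_add[of 2 \<epsilon>]
      by simp
    moreover have "(\<one> \<ominus> u \<otimes> u) \<oplus> (\<one> \<ominus> u \<otimes> u) = (d \<otimes> d \<ominus> u \<otimes> u) \<ominus> sc \<epsilon>"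
      unfolding d(3) sc using in' sc_in[of \<epsilon>] by algebra
    then have "2 * cnorm A (\<one> \<ominus> u \<otimes> u) = cnorm A ((d \<otimes> d \<ominus> u \<otimes> u) \<ominus> sc \<epsilon>)"
      using norm_scale[of "\<one> \<ominus> u \<otimes> u" 2] in' by (simp add: scale_numeral_2)
    ultimately show "cnorm A (\<one> \<ominus> u \<otimes> u) \<le> 1 + \<epsilon>"
      using norm_minus[of "d \<otimes> d \<ominus> u \<otimes> u" "sc \<epsilon>"] sc_norm[of \<epsilon>] in' d(1) \<epsilon>
        norm_minus_commute[of "u \<otimes> u" "d \<otimes> d"] by simp
  qed
  then have "(cnorm A y)\<^sup>2 \<le> 1" using cstar_identity[OF y(1)] yy by simp
  then have "cnorm A y \<le> 1" using power2_le_imp_le[of "cnorm A y" 1] by simp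
  \<comment> \<open>The induction hypothesis is used for \<open>y\<close>. Since
    \<open>1 - y\<^sup>*y = u\<^sup>2\<close>, it bounds the square of the norm of \<open>u\<close>,
    which halves the exponent; the start is the trivial bound 2.\<close>
  then have "cnorm A (\<one> \<ominus> adj A y \<otimes> y) \<le> 2 powr (1 / 2 ^ n)" using Suc.IH y(1) by blast
  moreover have "\<one> \<ominus> adj A y \<otimes> y = u \<otimes> u" unfolding yy using in' by algebra
  ultimately have "(cnorm A u)\<^sup>2 \<le> 2 powr (1 / 2 ^ n)" using cstar_identity_sa[OF in'(3) sa'(1)] by simp
  also have "\<dots> = (2 powr (1 / 2 ^ Suc n))\<^sup>2"
    by (simp add: power2_eq_square flip: powr_add)
  finally have "cnorm A u \<le> 2 powr (1 / 2 ^ Suc n)" by (rule power2_le_imp_le) simp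
  then show ?case by (simp add: u_def h_def)
qed

text \<open>Letting \<open>n\<close> grow in the previous bound gives
  \<open>\<parallel>1 - z\<^sup>*z\<parallel> \<le> 1\<close> for every contraction
  \<open>z\<close>, which is positivity with radius 1. A general \<open>x\<close> is first scaled
  into the unit ball.\<close>

lemma pos_adj_mult:
  assumes x: "x \<in> carrier A" shows "pos (adj A x \<otimes> x)"
proof -
  have 1: "cnorm A (\<one> \<ominus> adj A z \<otimes> z) \<le> 1" if "z \<in> carrier A" "cnorm A z \<le> 1" for z
  proof -
    have "(\<lambda>n. 1 / 2 ^ n :: real) \<longlonglongrightarrow> 0"
      using LIMSEQ_realpow_zero[of "1/2 :: real"] by (simp add: power_one_over)
    then have "(\<lambda>n. 2 powr (1 / 2 ^ n) :: real) \<longlonglongrightarrow> 2 powr 0"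
      by (intro tendsto_powr tendsto_const) auto
    then show ?thesis
      using one_minus_adj_mult_bound[OF that] by (intro LIMSEQ_le_const) auto
  qed
  define t where "t = 1 / (cnorm A x + 1)"
  have t: "t > 0" using x by (simp add: t_def add_nonneg_pos)
  define z where "z = scale A (of_real t) x"
  have z: "z \<in> carrier A" "cnorm A z \<le> 1"
    using x t by (simp_all add: z_def norm_scale) (simp add: t_def)
  have "sc 1 = \<one>" by (simp add: scale_1 one_in)
  then have "pos (adj A z \<otimes> z)"
    unfolding pos_def using z 1[OF z] by (intro conjI exI[of _ 1]) (auto simp: adj_mult adj_adj)
  from pos_scale[OF this, of "1 / t\<^sup>2"] show ?thesis
    using x t by (simp add: z_def adj_scale scale_mult mult_scale scale_scale power2_eq_square scale_1)
qed

text \<open>With \<open>t\<close> the norm of \<open>p + q\<close>, the element \<open>t - p\<close>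
  is the sum of the positive elements \<open>t - (p + q)\<close> and \<open>q\<close>, so
  \<open>pos_bound\<close> applies.\<close>

lemma norm_pos_mono:
  assumes "pos p" "pos q" shows "cnorm A p \<le> cnorm A (p \<oplus> q)"
proof -
  let ?t = "cnorm A (p \<oplus> q)"
  have pq: "p \<in> carrier A" "q \<in> carrier A" "pos (p \<oplus> q)" using assms by (simp_all add: pos_in pos_plus)
  then have "pos (sc ?t \<ominus> (p \<oplus> q) \<oplus> q)"
    using assms by (intro pos_plus pos_of_norm_le) (auto simp: pos_def)
  also have "sc ?t \<ominus> (p \<oplus> q) \<oplus> q = sc ?t \<ominus> p" using pq(1,2) sc_in[of ?t] by algebra
  finally show ?thesis using assms pq by (intro pos_bound) auto
qed

lemma pos_zero: "pos \<zero>"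
  using pos_square[of \<zero>] by simp

end

section \<open>Unitization and contractivity of homomorphisms\<close>

text \<open>The infimum of the admissible bounds avoids quotients by a seminorm that may vanish. It
  is meaningful only if some bound exists; hence the hypothesis carried by several lemmas below. The
  function \<open>m\<close> stands for the norm of the image vector.\<close>

definition opnorm :: "'v set \<Rightarrow> ('v \<Rightarrow> real) \<Rightarrow> ('v \<Rightarrow> real) \<Rightarrow> real" where
  "opnorm V n m = Inf {K. 0 \<le> K \<and> (\<forall>x\<in>V. m x \<le> K * n x)}"

lemma opnorm_le: "0 \<le> K \<Longrightarrow> (\<And>x. x \<in> V \<Longrightarrow> m x \<le> K * n x) \<Longrightarrow> opnorm V n m \<le> K"
  unfolding opnorm_def by (intro cInf_lower bdd_belowI[where m = 0]) auto

lemma opnorm_nonneg: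
  assumes "\<exists>K\<ge>0. \<forall>x\<in>V. m x \<le> K * n x" shows "0 \<le> opnorm V n m"
  unfolding opnorm_def by (rule cInf_greatest) (use assms in auto)

lemma opnorm_bound:
  assumes "\<exists>K\<ge>0. \<forall>x\<in>V. m x \<le> K * n x" and x: "x \<in> V" "0 \<le> n x"
  shows "m x \<le> opnorm V n m * n x"
proof (cases "n x = 0")
  case False
  with x have pos: "n x > 0" by simp
  have "m x / n x \<le> opnorm V n m"
    unfolding opnorm_def
  proof (rule cInf_greatest)
    fix K assume "K \<in> {K. 0 \<le> K \<and> (\<forall>x\<in>V. m x \<le> K * n x)}"
    then show "m x / n x \<le> K" using pos x by (simp add: pos_divide_le_eq)
  qed (use assms in auto)
  then show ?thesis using pos by (simp add: pos_divide_le_eq)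
qed (use assms in auto)

lemma opnorm_cong: "(\<And>x. x \<in> V \<Longrightarrow> m x = m' x) \<Longrightarrow> opnorm V n m = opnorm V n m'"
  by (simp add: opnorm_def)

lemma opnorm_scale:
  assumes b: "\<exists>K\<ge>0. \<forall>x\<in>V. m x \<le> K * n x" and n: "\<And>x. x \<in> V \<Longrightarrow> 0 \<le> n x" and c: "0 \<le> c"
  shows "opnorm V n (\<lambda>x. c * m x) = c * opnorm V n m"
proof (rule antisym)
  note bd = opnorm_bound[where m = m, OF b _ n]
  have le: "c * m x \<le> c * opnorm V n m * n x" if "x \<in> V" for x
    using mult_left_mono[OF bd c] that by (simp add: mult.assoc)
  then show "opnorm V n (\<lambda>x. c * m x) \<le> c * opnorm V n m"
    using opnorm_nonneg[OF b] c by (intro opnorm_le) auto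
  have b': "\<exists>K\<ge>0. \<forall>x\<in>V. c * m x \<le> K * n x"
    using le opnorm_nonneg[OF b] c by (intro exI[of _ "c * opnorm V n m"]) auto
  show "c * opnorm V n m \<le> opnorm V n (\<lambda>x. c * m x)"
  proof (cases "c = 0")
    case True
    then show ?thesis using opnorm_nonneg[OF b'] by simp
  next
    case False
    with c have c: "c > 0" by simp
    have "opnorm V n m \<le> opnorm V n (\<lambda>x. c * m x) / c"
    proof (rule opnorm_le)
      fix x assume x: "x \<in> V"
      then have "c * m x \<le> opnorm V n (\<lambda>x. c * m x) * n x"
        using opnorm_bound[where m = "\<lambda>x. c * m x", OF b' x n] by simp
      then show "m x \<le> opnorm V n (\<lambda>x. c * m x) / c * n x" using c by (simp add: field_simps)
    qed (use opnorm_nonneg[OF b'] c in simp)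
    then show ?thesis using c by (simp add: field_simps)
  qed
qed

text \<open>Derives the C*-identity where isometry of the adjoint is not yet known:
  \<open>a\<close>, \<open>b\<close>, \<open>c\<close>, \<open>d\<close> are the norms of
  \<open>x\<close>, \<open>x\<^sup>*\<close>, \<open>x\<^sup>*x\<close> and
  \<open>xx\<^sup>*\<close>. The estimates for \<open>xx\<^sup>*\<close> give
  \<open>b \<le> a\<close>, and then those for \<open>x\<^sup>*x\<close> give equality.\<close>

lemma eq_square_of_bounds:
  fixes a b c d :: real
  assumes "0 \<le> a" "0 \<le> b" "a\<^sup>2 \<le> c" "c \<le> b * a" "b\<^sup>2 \<le> d" "d \<le> a * b"
  shows "c = a\<^sup>2"
proof -
  have "b \<le> a"
    using order_trans[OF assms(5,6)] assms(1,2) by (cases "b = 0") (auto simp: power2_eq_square less_le)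
  then have "b * a \<le> a\<^sup>2" using assms(1) by (simp add: power2_eq_square mult_right_mono)
  then show ?thesis using assms by linarith
qed

definition unit_act :: "'a cstar \<Rightarrow> complex \<times> 'a \<Rightarrow> 'a \<Rightarrow> 'a" where
  "unit_act A x z = scale A (fst x) z \<oplus>\<^bsub>A\<^esub> snd x \<otimes>\<^bsub>A\<^esub> z"

definition unit_opnorm :: "'a cstar \<Rightarrow> complex \<times> 'a \<Rightarrow> real" where
  "unit_opnorm A x = opnorm (carrier A) (cnorm A) (\<lambda>z. cnorm A (unit_act A x z))"

text \<open>If \<open>A\<close> already has a unit \<open>e\<close>, then \<open>(1, - e)\<close> acts on \<open>A\<close> as zero; the maximum with the
  modulus of the scalar part turns the operator seminorm into a norm in all cases.\<close>

definition unitization :: "'a cstar \<Rightarrow> (complex \<times> 'a) cstar" where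
  "unitization A = \<lparr>
    carrier = UNIV \<times> carrier A,
    mult = (\<lambda>x y. (fst x * fst y,
      scale A (fst x) (snd y) \<oplus>\<^bsub>A\<^esub> scale A (fst y) (snd x) \<oplus>\<^bsub>A\<^esub> snd x \<otimes>\<^bsub>A\<^esub> snd y)),
    one = (1, \<zero>\<^bsub>A\<^esub>),
    zero = (0, \<zero>\<^bsub>A\<^esub>),
    add = (\<lambda>x y. (fst x + fst y, snd x \<oplus>\<^bsub>A\<^esub> snd y)),
    scale = (\<lambda>z x. (z * fst x, scale A z (snd x))),
    adj = (\<lambda>x. (cnj (fst x), adj A (snd x))),
    cnorm = (\<lambda>x. max (cmod (fst x)) (unit_opnorm A x))\<rparr>"

lemma unitization_sel [simp]:
  "carrier (unitization A) = UNIV \<times> carrier A"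
  "mult (unitization A) x y = (fst x * fst y,
      scale A (fst x) (snd y) \<oplus>\<^bsub>A\<^esub> scale A (fst y) (snd x) \<oplus>\<^bsub>A\<^esub> snd x \<otimes>\<^bsub>A\<^esub> snd y)"
  "one (unitization A) = (1, \<zero>\<^bsub>A\<^esub>)"
  "zero (unitization A) = (0, \<zero>\<^bsub>A\<^esub>)"
  "add (unitization A) x y = (fst x + fst y, snd x \<oplus>\<^bsub>A\<^esub> snd y)"
  "scale (unitization A) z x = (z * fst x, scale A z (snd x))"
  "adj (unitization A) x = (cnj (fst x), adj A (snd x))"
  "cnorm (unitization A) x = max (cmod (fst x)) (unit_opnorm A x)"
  by (simp_all add: unitization_def)

context cstar_algebra begin

lemma unit_act_in [simp]: "snd x \<in> carrier A \<Longrightarrow> z \<in> carrier A \<Longrightarrow> unit_act A x z \<in> carrier A"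
  by (simp add: unit_act_def)

lemma unit_act_le: "snd x \<in> carrier A \<Longrightarrow> z \<in> carrier A \<Longrightarrow>
    cnorm A (unit_act A x z) \<le> (cmod (fst x) + cnorm A (snd x)) * cnorm A z"
  unfolding unit_act_def
  using norm_mult[of "snd x" z]
  by (intro order_trans[OF norm_plus]) (auto simp: norm_scale distrib_right)

lemma unit_act_bounded:
  "snd x \<in> carrier A \<Longrightarrow> \<exists>K\<ge>0. \<forall>z\<in>carrier A. cnorm A (unit_act A x z) \<le> K * cnorm A z"
  using unit_act_le by (intro exI[of _ "cmod (fst x) + cnorm A (snd x)"]) auto

lemma unit_opnorm_nonneg: "snd x \<in> carrier A \<Longrightarrow> 0 \<le> unit_opnorm A x"
  unfolding unit_opnorm_def by (intro opnorm_nonneg unit_act_bounded)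

lemma unit_opnorm_bound: "snd x \<in> carrier A \<Longrightarrow> z \<in> carrier A \<Longrightarrow>
    cnorm A (unit_act A x z) \<le> unit_opnorm A x * cnorm A z"
  unfolding unit_opnorm_def
  by (rule opnorm_bound[where m = "\<lambda>z. cnorm A (unit_act A x z)"]) (simp_all add: unit_act_bounded)

lemma unit_opnorm_le: "0 \<le> K \<Longrightarrow> (\<And>z. z \<in> carrier A \<Longrightarrow> cnorm A (unit_act A x z) \<le> K * cnorm A z)
    \<Longrightarrow> unit_opnorm A x \<le> K"
  unfolding unit_opnorm_def by (intro opnorm_le)

text \<open>Left multiplication by \<open>a\<close> attains its norm at the adjoint of
  \<open>a\<close>, since \<open>aa\<^sup>*\<close> has the squared norm of
  \<open>a\<close>.\<close>

lemma unit_opnorm_snd: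
  assumes a: "a \<in> carrier A" shows "unit_opnorm A (0, a) = cnorm A a"
proof (rule antisym)
  show "unit_opnorm A (0, a) \<le> cnorm A a"
    using a norm_mult by (intro unit_opnorm_le) (auto simp: unit_act_def)
  have "cnorm A a * cnorm A a \<le> unit_opnorm A (0, a) * cnorm A a"
    using unit_opnorm_bound[of "(0, a)" "adj A a"] a cstar_identity[of "adj A a"]
    by (simp add: unit_act_def adj_adj power2_eq_square)
  then show "cnorm A a \<le> unit_opnorm A (0, a)"
    using a unit_opnorm_nonneg[of "(0, a)"] norm_nonneg[OF a] by (cases "cnorm A a = 0") (auto simp: less_le)
qed

lemma unit_act_mult: "snd x \<in> carrier A \<Longrightarrow> snd y \<in> carrier A \<Longrightarrow> z \<in> carrier A \<Longrightarrow>
    unit_act A (x \<otimes>\<^bsub>unitization A\<^esub> y) z = unit_act A x (unit_act A y z)"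
  by (simp add: unit_act_def plus_mult mult_plus scale_plus scale_scale scale_mult mult_scale
      mult_assoc a_ac)

lemma unit_opnorm_mult: "snd x \<in> carrier A \<Longrightarrow> snd y \<in> carrier A \<Longrightarrow>
    unit_opnorm A (x \<otimes>\<^bsub>unitization A\<^esub> y) \<le> unit_opnorm A x * unit_opnorm A y"
proof (rule unit_opnorm_le)
  fix z assume a: "snd x \<in> carrier A" "snd y \<in> carrier A" "z \<in> carrier A"
  have "cnorm A (unit_act A x (unit_act A y z)) \<le> unit_opnorm A x * cnorm A (unit_act A y z)"
    using a by (intro unit_opnorm_bound) auto
  also have "\<dots> \<le> unit_opnorm A x * (unit_opnorm A y * cnorm A z)"
    using a by (intro mult_left_mono unit_opnorm_bound unit_opnorm_nonneg) auto
  finally show "cnorm A (unit_act A (x \<otimes>\<^bsub>unitization A\<^esub> y) z)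
      \<le> unit_opnorm A x * unit_opnorm A y * cnorm A z"
    using a by (simp only: unit_act_mult mult.assoc)
qed (simp add: unit_opnorm_nonneg)

lemma unit_act_inner: "snd x \<in> carrier A \<Longrightarrow> z \<in> carrier A \<Longrightarrow>
    adj A (unit_act A x z) \<otimes> w = adj A z \<otimes> unit_act A (adj (unitization A) x) w"
  if "w \<in> carrier A"
  using that by (simp add: unit_act_def adj_plus adj_scale adj_mult plus_mult mult_plus scale_mult
      mult_scale mult_assoc)

text \<open>\<open>A\<close> acts as a Hilbert module over itself with inner product
  \<open>z\<^sup>*w\<close>, for which \<open>unit_act_inner\<close> is the adjoint relation; so the
  squared norm of \<open>xz\<close> is the norm of \<open>z\<^sup>*(x\<^sup>*x)z\<close>.\<close>

lemma unit_opnorm_sq_le: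
  assumes x: "snd x \<in> carrier A"
  shows "(unit_opnorm A x)\<^sup>2 \<le> unit_opnorm A (adj (unitization A) x \<otimes>\<^bsub>unitization A\<^esub> x)" (is "_ \<le> ?N")
proof -
  let ?s = "adj (unitization A) x"
  have s: "snd ?s \<in> carrier A" "snd (?s \<otimes>\<^bsub>unitization A\<^esub> x) \<in> carrier A" using x by simp_all
  have N0: "0 \<le> ?N" using s by (intro unit_opnorm_nonneg)
  have "unit_opnorm A x \<le> sqrt ?N"
  proof (rule unit_opnorm_le)
    fix z assume z: "z \<in> carrier A"
    have "(cnorm A (unit_act A x z))\<^sup>2 = cnorm A (adj A z \<otimes> unit_act A ?s (unit_act A x z))"
      using x z by (simp add: cstar_identity[symmetric] unit_act_inner del: unitization_sel)
    also have "\<dots> = cnorm A (adj A z \<otimes> unit_act A (?s \<otimes>\<^bsub>unitization A\<^esub> x) z)"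
      using x s z by (simp only: unit_act_mult)
    also have "\<dots> \<le> cnorm A (adj A z) * cnorm A (unit_act A (?s \<otimes>\<^bsub>unitization A\<^esub> x) z)"
      using s z by (intro norm_mult) auto
    also have "\<dots> \<le> cnorm A z * (?N * cnorm A z)"
      using s z by (simp only: norm_adj) (intro mult_left_mono unit_opnorm_bound norm_nonneg)
    also have "\<dots> = (sqrt ?N * cnorm A z)\<^sup>2"
      using N0 by (simp add: power_mult_distrib power2_eq_square)
    finally show "cnorm A (unit_act A x z) \<le> sqrt ?N * cnorm A z"
      by (rule power2_le_imp_le) (use N0 z in simp)
  qed (use N0 in simp)
  then have "(unit_opnorm A x)\<^sup>2 \<le> (sqrt ?N)\<^sup>2"
    by (intro power_mono unit_opnorm_nonneg x)
  then show ?thesis using N0 by simp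
qed

lemma unit_opnorm_cstar:
  assumes x: "snd x \<in> carrier A"
  shows "unit_opnorm A (adj (unitization A) x \<otimes>\<^bsub>unitization A\<^esub> x) = (unit_opnorm A x)\<^sup>2"
proof -
  let ?s = "adj (unitization A) x"
  have s: "snd ?s \<in> carrier A" "adj (unitization A) ?s = x" using x by (simp_all add: adj_adj)
  show ?thesis
    using unit_opnorm_sq_le[OF x] unit_opnorm_mult[OF s(1) x] unit_opnorm_sq_le[OF s(1), unfolded s(2)]
      unit_opnorm_mult[OF x s(1)] unit_opnorm_nonneg[OF x] unit_opnorm_nonneg[OF s(1)]
    by (intro eq_square_of_bounds[of "unit_opnorm A x" "unit_opnorm A ?s"])
qed

lemma unit_opnorm_plus: "snd x \<in> carrier A \<Longrightarrow> snd y \<in> carrier A \<Longrightarrow>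
    unit_opnorm A (x \<oplus>\<^bsub>unitization A\<^esub> y) \<le> unit_opnorm A x + unit_opnorm A y"
proof (rule unit_opnorm_le)
  fix z assume a: "snd x \<in> carrier A" "snd y \<in> carrier A" "z \<in> carrier A"
  have "unit_act A (x \<oplus>\<^bsub>unitization A\<^esub> y) z = unit_act A x z \<oplus> unit_act A y z"
    using a by (simp add: unit_act_def plus_scale plus_mult a_ac)
  then show "cnorm A (unit_act A (x \<oplus>\<^bsub>unitization A\<^esub> y) z)
      \<le> (unit_opnorm A x + unit_opnorm A y) * cnorm A z"
    using order_trans[OF norm_plus add_mono[OF unit_opnorm_bound unit_opnorm_bound]] a
    by (simp add: distrib_right del: unitization_sel)
qed (simp add: unit_opnorm_nonneg)

lemma unit_opnorm_scale:
  assumes x: "snd x \<in> carrier A"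
  shows "unit_opnorm A (scale (unitization A) c x) = cmod c * unit_opnorm A x"
proof -
  have "cnorm A (unit_act A (scale (unitization A) c x) z) = cmod c * cnorm A (unit_act A x z)"
    if "z \<in> carrier A" for z
    using that x norm_scale[of "unit_act A x z" c]
    by (simp add: unit_act_def scale_plus scale_scale scale_mult)
  then have "unit_opnorm A (scale (unitization A) c x)
      = opnorm (carrier A) (cnorm A) (\<lambda>z. cmod c * cnorm A (unit_act A x z))"
    unfolding unit_opnorm_def by (intro opnorm_cong) auto
  also have "\<dots> = cmod c * unit_opnorm A x"
    unfolding unit_opnorm_def using x by (intro opnorm_scale unit_act_bounded) auto
  finally show ?thesis .
qed

lemma unit_opnorm_le_sum: "snd x \<in> carrier A \<Longrightarrow> unit_opnorm A x \<le> cmod (fst x) + cnorm A (snd x)"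
  by (intro unit_opnorm_le unit_act_le) auto

text \<open>Subtracting the scalar part, whose operator norm is at most its modulus, leaves
  \<open>(0, snd x)\<close>. Together with \<open>unit_opnorm_le_sum\<close> this makes the norm of
  the unitization equivalent to the sum of the two coordinate norms, so completeness can be checked
  coordinatewise.\<close>

lemma norm_snd_le:
  assumes x: "snd x \<in> carrier A" shows "cnorm A (snd x) \<le> unit_opnorm A x + cmod (fst x)"
proof -
  have "x \<oplus>\<^bsub>unitization A\<^esub> (- fst x, \<zero>) = (0, snd x)" using x by simp
  then have "unit_opnorm A (0, snd x) \<le> unit_opnorm A x + unit_opnorm A (- fst x, \<zero>)"
    using unit_opnorm_plus[of x "(- fst x, \<zero>)"] x by simp
  then show ?thesis using unit_opnorm_snd[OF x] unit_opnorm_le_sum[of "(- fst x, \<zero>)"] by simp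
qed

lemma unitization_complete:
  assumes X: "\<forall>n. X n \<in> carrier (unitization A)"
    and c: "\<forall>\<epsilon>>0. \<exists>N. \<forall>m\<ge>N. \<forall>n\<ge>N. cnorm (unitization A)
      (X m \<oplus>\<^bsub>unitization A\<^esub> scale (unitization A) (- 1) (X n)) < \<epsilon>"
  shows "\<exists>x\<in>carrier (unitization A). (\<lambda>n. cnorm (unitization A)
      (X n \<oplus>\<^bsub>unitization A\<^esub> scale (unitization A) (- 1) x)) \<longlonglongrightarrow> 0"
proof -
  have s: "snd (X n) \<in> carrier A" for n using X by (metis SigmaE2 prod.collapse unitization_sel(1))
  have d: "X m \<oplus>\<^bsub>unitization A\<^esub> scale (unitization A) (- 1) y = (fst (X m) - fst y, snd (X m) \<ominus> snd y)"
    if "snd y \<in> carrier A" for m y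
    using that s by (simp add: scale_minus_one a_minus_def)
  have C: "\<exists>N. \<forall>m\<ge>N. \<forall>n\<ge>N. cmod (fst (X m) - fst (X n)) < e \<and>
      unit_opnorm A (fst (X m) - fst (X n), snd (X m) \<ominus> snd (X n)) < e" if "e > 0" for e
    using c[rule_format, OF that] unfolding d[OF s] by simp
  have "Cauchy (\<lambda>n. fst (X n))"
    unfolding Cauchy_def dist_norm using C by meson
  then obtain l where l: "(\<lambda>n. fst (X n)) \<longlonglongrightarrow> l" using Cauchy_convergent convergent_def by blast
  have "\<exists>N. \<forall>m\<ge>N. \<forall>n\<ge>N. cnorm A (snd (X m) \<ominus> snd (X n)) < e" if e: "e > 0" for e
  proof -
    obtain N where N: "\<forall>m\<ge>N. \<forall>n\<ge>N. cmod (fst (X m) - fst (X n)) < e/2 \<and>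
        unit_opnorm A (fst (X m) - fst (X n), snd (X m) \<ominus> snd (X n)) < e/2"
      using C[OF half_gt_zero[OF e]] by blast
    have "cnorm A (snd (X m) \<ominus> snd (X n)) < e" if "m \<ge> N" "n \<ge> N" for m n
    proof -
      have "cmod (fst (X m) - fst (X n)) < e/2"
          "unit_opnorm A (fst (X m) - fst (X n), snd (X m) \<ominus> snd (X n)) < e/2"
        using N that by auto
      moreover have "snd (X m) \<ominus> snd (X n) \<in> carrier A" using s by simp
      ultimately show ?thesis
        using norm_snd_le[of "(fst (X m) - fst (X n), snd (X m) \<ominus> snd (X n))"] by simp
    qed
    then show ?thesis by blast
  qed
  then obtain a where a: "a \<in> carrier A" "(\<lambda>n. cnorm A (snd (X n) \<ominus> a)) \<longlonglongrightarrow> 0"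
    by (rule complete'[OF s])
  have "(\<lambda>n. cnorm (unitization A) (fst (X n) - l, snd (X n) \<ominus> a)) \<longlonglongrightarrow> 0"
  proof (rule tendsto_sandwich[OF _ _ tendsto_const])
    have "(\<lambda>n. cmod (fst (X n) - l)) \<longlonglongrightarrow> 0"
      using l by (simp add: LIM_zero tendsto_norm_zero)
    then show "(\<lambda>n. cmod (fst (X n) - l) + cnorm A (snd (X n) \<ominus> a)) \<longlonglongrightarrow> 0"
      using tendsto_add[OF _ a(2)] by force
    have "cnorm (unitization A) (fst (X n) - l, snd (X n) \<ominus> a)
        \<le> cmod (fst (X n) - l) + cnorm A (snd (X n) \<ominus> a)" for n
      using unit_opnorm_le_sum[of "(fst (X n) - l, snd (X n) \<ominus> a)"] s a by simp
    then show "\<forall>\<^sub>F n in sequentially. cnorm (unitization A) (fst (X n) - l, snd (X n) \<ominus> a)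
        \<le> cmod (fst (X n) - l) + cnorm A (snd (X n) \<ominus> a)" by simp
  qed (auto simp: le_max_iff_disj)
  then show ?thesis using a(1) by (intro bexI[of _ "(l, a)"]) (simp_all only: d snd_conv fst_conv, auto)
qed

lemma unital_cstar_unitization: "unital_cstar (unitization A)"
proof -
  let ?U = "unitization A"
  \<comment> \<open>Squaring commutes with the maximum of nonnegative numbers, so the maximum of two
    C*-seminorms inherits the C*-identity.\<close>
  have sq: "(max a b)\<^sup>2 = max (a\<^sup>2) (b\<^sup>2)" if "0 \<le> a" "0 \<le> b" for a b :: real
    using that by (simp add: max_def power_mono_iff)
  show ?thesis
  proof (unfold_locales, goal_cases)
    case (12 x) 
    then have x: "snd x \<in> carrier A" by auto
    show ?case
    proof
      assume 0: "cnorm ?U x = 0"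
      have "fst x = 0" "unit_opnorm A x \<le> 0"
        using 0 max.cobounded1[of "cmod (fst x)" "unit_opnorm A x"]
          max.cobounded2[of "unit_opnorm A x" "cmod (fst x)"] by simp_all
      then have "cnorm A (snd x) = 0" using norm_snd_le[OF x] norm_nonneg[OF x] by simp
      then show "x = \<zero>\<^bsub>?U\<^esub>" using \<open>fst x = 0\<close> x by (simp add: prod_eq_iff nrm_eq_0)
    qed (use unit_opnorm_snd[of \<zero>] in simp)
  next
    case (13 x y)
    then have "unit_opnorm A (x \<oplus>\<^bsub>?U\<^esub> y) \<le> unit_opnorm A x + unit_opnorm A y"
      by (intro unit_opnorm_plus) auto
    moreover have "cmod (fst x + fst y) \<le> cmod (fst x) + cmod (fst y)" by (rule norm_triangle_ineq)
    ultimately show ?case unfolding unitization_sel by auto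
  next
    case (14 x z)
    then have "unit_opnorm A (scale ?U z x) = cmod z * unit_opnorm A x"
      by (intro unit_opnorm_scale) auto
    then show ?case by (simp add: real_normed_div_algebra_class.norm_mult max_mult_distrib_left)
  next
    case (15 X)
    then show ?case by (rule unitization_complete)
  next
    case (27 a b)
    then have "unit_opnorm A (a \<otimes>\<^bsub>?U\<^esub> b) \<le> unit_opnorm A a * unit_opnorm A b"
      by (intro unit_opnorm_mult) auto
    moreover have "cmod (fst a) * cmod (fst b) \<le> cnorm ?U a * cnorm ?U b"
      "unit_opnorm A a * unit_opnorm A b \<le> cnorm ?U a * cnorm ?U b"
      using 27 by (auto intro!: mult_mono unit_opnorm_nonneg simp: le_max_iff_disj)
    ultimately show ?case by (simp add: real_normed_div_algebra_class.norm_mult)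
  next
    case (28 a)
    then have "unit_opnorm A (adj ?U a \<otimes>\<^bsub>?U\<^esub> a) = (unit_opnorm A a)\<^sup>2"
      by (intro unit_opnorm_cstar) auto
    moreover have "cmod (cnj (fst a) * fst a) = (cmod (fst a))\<^sup>2"
      by (simp add: real_normed_div_algebra_class.norm_mult power2_eq_square)
    ultimately show ?case using 28 by (auto simp: sq unit_opnorm_nonneg)
  qed (auto simp: scale_1 scale_scale scale_plus plus_scale plus_mult mult_plus scale_mult mult_scale
      mult_assoc adj_adj adj_plus adj_scale adj_mult a_ac scale_minus_one l_neg r_neg algebra_simps)
qed

end

section \<open>Automatic contractivity of *-homomorphisms\<close>

lemma cstar_homD:
  assumes "cstar_hom A B \<rho>"
  shows "a \<in> carrier A \<Longrightarrow> \<rho> a \<in> carrier B"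
    "\<lbrakk>a \<in> carrier A; b \<in> carrier A\<rbrakk> \<Longrightarrow> \<rho> (a \<oplus>\<^bsub>A\<^esub> b) = \<rho> a \<oplus>\<^bsub>B\<^esub> \<rho> b"
    "a \<in> carrier A \<Longrightarrow> \<rho> (scale A z a) = scale B z (\<rho> a)"
    "\<lbrakk>a \<in> carrier A; b \<in> carrier A\<rbrakk> \<Longrightarrow> \<rho> (a \<otimes>\<^bsub>A\<^esub> b) = \<rho> a \<otimes>\<^bsub>B\<^esub> \<rho> b"
    "a \<in> carrier A \<Longrightarrow> \<rho> (adj A a) = adj B (\<rho> a)"
  using assms by (auto simp: cstar_hom_def)

lemma cstar_hom_zero:
  assumes "pre_cstar A" "pre_cstar B" "cstar_hom A B \<rho>" shows "\<rho> \<zero>\<^bsub>A\<^esub> = \<zero>\<^bsub>B\<^esub>"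
proof -
  interpret A: pre_cstar A by fact
  interpret B: pre_cstar B by fact
  show ?thesis using cstar_homD(3)[OF assms(3) A.zero_closed, of 0] cstar_homD(1)[OF assms(3) A.zero_closed]
    by simp
qed

lemma cstar_hom_minus:
  assumes "pre_cstar A" "pre_cstar B" "cstar_hom A B \<rho>" "a \<in> carrier A" "b \<in> carrier A"
  shows "\<rho> (a \<ominus>\<^bsub>A\<^esub> b) = \<rho> a \<ominus>\<^bsub>B\<^esub> \<rho> b"
proof -
  interpret A: pre_cstar A by fact
  interpret B: pre_cstar B by fact
  note h = cstar_homD[OF assms(3)]
  show ?thesis using assms(4,5) h(2)[of a "\<ominus>\<^bsub>A\<^esub> b"] h(3)[of b "-1"] h(1)[of b]
    by (simp add: a_minus_def A.scale_minus_one B.scale_minus_one)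
qed

text \<open>If \<open>h\<close> is self-adjoint with \<open>cnorm A h < t\<close>, then \<open>h\<^sup>2 + d\<^sup>2 = t\<^sup>2\<close> for some self-adjoint \<open>d\<close>
  commuting with \<open>h\<close>; the images satisfy the same relation, which bounds the image of \<open>h\<close>.\<close>

lemma unital_hom_contractive:
  assumes "unital_cstar A" "unital_cstar B" and hom: "cstar_hom A B \<rho>" and one: "\<rho> \<one>\<^bsub>A\<^esub> = \<one>\<^bsub>B\<^esub>"
    and x: "x \<in> carrier A"
  shows "cnorm B (\<rho> x) \<le> cnorm A x"
proof -
  interpret A: unital_cstar A by fact
  interpret B: unital_cstar B by fact
  note h = cstar_homD[OF hom]
  have sa: "cnorm B (\<rho> c) \<le> cnorm A c" if c: "c \<in> carrier A" "adj A c = c" for c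
  proof (rule dense_ge)
    fix t assume t: "cnorm A c < t"
    then have t0: "t > 0" using A.norm_nonneg[OF c(1)] by linarith
    have c2: "c \<otimes>\<^bsub>A\<^esub> c \<in> carrier A" "adj A (c \<otimes>\<^bsub>A\<^esub> c) = c \<otimes>\<^bsub>A\<^esub> c" using c by (simp_all add: A.adj_mult)
    let ?p = "A.sc (t\<^sup>2) \<ominus>\<^bsub>A\<^esub> c \<otimes>\<^bsub>A\<^esub> c"
    have "A.sc (t\<^sup>2) \<ominus>\<^bsub>A\<^esub> ?p = c \<otimes>\<^bsub>A\<^esub> c" using c2(1) A.sc_in[of "t\<^sup>2"] by algebra
    then have "cnorm A (A.sc (t\<^sup>2) \<ominus>\<^bsub>A\<^esub> ?p) < t\<^sup>2"
      using A.cstar_identity_sa[OF c] t A.norm_nonneg[OF c(1)] by (simp add: power_strict_mono)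
    moreover have "?p \<in> carrier A" "adj A ?p = ?p" using c2 by (simp_all only: A.minus_closed A.sc_in A.adj_minus A.adj_sc)
    ultimately obtain d where d: "d \<in> carrier A" "adj A d = d" "d \<otimes>\<^bsub>A\<^esub> d = ?p"
      and dc: "\<And>y. y \<in> carrier A \<Longrightarrow> y \<otimes>\<^bsub>A\<^esub> ?p = ?p \<otimes>\<^bsub>A\<^esub> y \<Longrightarrow> y \<otimes>\<^bsub>A\<^esub> d = d \<otimes>\<^bsub>A\<^esub> y"
      using A.sqrt_exists by blast
    have cd: "c \<otimes>\<^bsub>A\<^esub> d = d \<otimes>\<^bsub>A\<^esub> c"
      using c by (intro dc) (auto simp: A.mult_minus A.minus_mult A.mult_scale A.scale_mult A.one_in A.mult_assoc)
    have "c \<otimes>\<^bsub>A\<^esub> c \<oplus>\<^bsub>A\<^esub> d \<otimes>\<^bsub>A\<^esub> d = A.sc (t\<^sup>2)"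
      using c2(1) A.sc_in[of "t\<^sup>2"] unfolding d(3) by algebra
    then have "\<rho> c \<otimes>\<^bsub>B\<^esub> \<rho> c \<oplus>\<^bsub>B\<^esub> \<rho> d \<otimes>\<^bsub>B\<^esub> \<rho> d = B.sc (t\<^sup>2)"
      using c d h one A.one_in by (metis A.mult_in)
    moreover have "\<rho> c \<otimes>\<^bsub>B\<^esub> \<rho> d = \<rho> d \<otimes>\<^bsub>B\<^esub> \<rho> c" using cd c d h by metis
    ultimately have "(cnorm B (\<rho> c))\<^sup>2 \<le> t\<^sup>2"
      using B.sum_squares_bound(1)[of "\<rho> c" "\<rho> d" "t\<^sup>2"] c d h(1,5) by (metis zero_le_power2)
    then show "cnorm B (\<rho> c) \<le> t" by (rule power2_le_imp_le) (use t0 in simp)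
  qed
  \<comment> \<open>The C*-identity reduces a general \<open>x\<close> to the self-adjoint element
    \<open>x\<^sup>*x\<close>.\<close>
  have "(cnorm B (\<rho> x))\<^sup>2 = cnorm B (\<rho> (adj A x \<otimes>\<^bsub>A\<^esub> x))"
    using x h(1,4,5) by (simp add: B.cstar_identity)
  also have "\<dots> \<le> cnorm A (adj A x \<otimes>\<^bsub>A\<^esub> x)" using x by (intro sa) (auto simp: A.adj_mult A.adj_adj)
  also have "\<dots> = (cnorm A x)\<^sup>2" using x by (rule A.cstar_identity)
  finally show ?thesis by (rule power2_le_imp_le) (use x in simp)
qed

text \<open>On the unitizations the map that is the identity on scalars and \<rho> on
  \<open>A\<close> is unital, whatever \<rho> does to a possible unit of \<open>A\<close>; and both
  algebras sit isometrically in their unitizations.\<close>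

lemma cstar_hom_contractive:
  assumes "cstar_algebra A" "cstar_algebra B" and hom: "cstar_hom A B \<rho>" and x: "x \<in> carrier A"
  shows "cnorm B (\<rho> x) \<le> cnorm A x"
proof -
  interpret A: cstar_algebra A by fact
  interpret B: cstar_algebra B by fact
  note h = cstar_homD[OF hom]
  have z: "\<rho> \<zero>\<^bsub>A\<^esub> = \<zero>\<^bsub>B\<^esub>"
    by (rule cstar_hom_zero[OF A.pre_cstar_axioms B.pre_cstar_axioms hom])
  have "cstar_hom (unitization A) (unitization B) (map_prod id \<rho>)"
    unfolding cstar_hom_def using h by (auto simp: A.mult_in A.scale_in)
  then have "cnorm (unitization B) (map_prod id \<rho> (0, x)) \<le> cnorm (unitization A) (0, x)"
    using unital_hom_contractive[OF A.unital_cstar_unitization B.unital_cstar_unitization,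
        of "map_prod id \<rho>" "(0, x)"] x z by simp
  then show ?thesis using x h(1)[OF x] by (simp add: A.unit_opnorm_snd B.unit_opnorm_snd)
qed

section \<open>Operators on a pre-Hilbert module\<close>

text \<open>Additivity is required only on a set closed under sums, because the maps of a
  representation are given on a single fibre. The induction carries along that partial sums stay in
  this set; over an infinite index set both sums are zero by convention.\<close>

lemma finsum_additive_on:
  assumes "abelian_group A" "abelian_group B"
    and S: "S \<subseteq> carrier A" "\<zero>\<^bsub>A\<^esub> \<in> S" "\<And>x y. x \<in> S \<Longrightarrow> y \<in> S \<Longrightarrow> x \<oplus>\<^bsub>A\<^esub> y \<in> S"
    and \<phi>: "\<And>x. x \<in> S \<Longrightarrow> \<phi> x \<in> carrier B"
    and add: "\<And>x y. x \<in> S \<Longrightarrow> y \<in> S \<Longrightarrow> \<phi> (x \<oplus>\<^bsub>A\<^esub> y) = \<phi> x \<oplus>\<^bsub>B\<^esub> \<phi> y"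
    and f: "f \<in> F \<rightarrow> S"
  shows "\<phi> (finsum A f F) = finsum B (\<lambda>i. \<phi> (f i)) F"
proof -
  interpret A: abelian_group A by fact
  interpret B: abelian_group B by fact
  have 0: "\<phi> \<zero>\<^bsub>A\<^esub> = \<zero>\<^bsub>B\<^esub>" using add[OF S(2,2)] \<phi>[OF S(2)] by simp
  show ?thesis
  proof (cases "finite F")
    case True
    then have "finsum A f F \<in> S \<and> \<phi> (finsum A f F) = finsum B (\<lambda>i. \<phi> (f i)) F" using f
    proof (induction F)
      case (insert x F)
      then have i: "\<And>i. i \<in> F \<Longrightarrow> f i \<in> S" "f x \<in> S" by auto
      then have "\<And>i. i \<in> F \<Longrightarrow> f i \<in> carrier A" "f x \<in> carrier A" using S(1) by auto
      with i insert show ?case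
        by (simp add: A.finsum_insert B.finsum_insert Pi_def \<phi> add S(3))
    qed (simp add: 0 S(2))
    then show ?thesis ..
  qed (simp add: 0)
qed

lemma finsum_additive:
  assumes "abelian_group A" "abelian_group B"
    and "\<And>x. x \<in> carrier A \<Longrightarrow> \<phi> x \<in> carrier B"
    and "\<And>x y. x \<in> carrier A \<Longrightarrow> y \<in> carrier A \<Longrightarrow> \<phi> (x \<oplus>\<^bsub>A\<^esub> y) = \<phi> x \<oplus>\<^bsub>B\<^esub> \<phi> y"
    and "f \<in> F \<rightarrow> carrier A"
  shows "\<phi> (finsum A f F) = finsum B (\<lambda>i. \<phi> (f i)) F"
proof -
  interpret A: abelian_group A by fact
  show ?thesis by (rule finsum_additive_on[OF assms(1,2) subset_refl]) (use assms in auto)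
qed

context unital_cstar begin

lemma pos_finsum: "finite F \<Longrightarrow> (\<And>i. i \<in> F \<Longrightarrow> pos (f i)) \<Longrightarrow> pos (\<Oplus>i\<in>F. f i)"
proof (induction F rule: finite_induct)
  case (insert x F)
  then show ?case by (subst finsum_insert) (auto simp: pos_in intro: pos_plus)
qed (simp add: pos_zero)

end

locale free_module = unital_cstar A for A :: "'a cstar" (structure) + fixes I :: "'i set"
begin

text \<open>The algebraic direct sum of copies of \<open>A\<close> over \<open>I\<close>, a right
  \<open>A\<close>-module. Functions are made zero outside \<open>I\<close>, so that equality of
  module elements is equality of functions.\<close>

definition X :: "('i \<Rightarrow> 'a) set" where
  "X = {f. (\<forall>i. f i \<in> carrier A) \<and> finite {i. f i \<noteq> \<zero>} \<and> (\<forall>i. i \<notin> I \<longrightarrow> f i = \<zero>)}"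

text \<open>Linear in the second variable. Summing over the support of the first argument gives a
  finite sum without choices; \<open>ip_eq\<close> replaces the support by any larger finite
  set.\<close>

definition ip :: "('i \<Rightarrow> 'a) \<Rightarrow> ('i \<Rightarrow> 'a) \<Rightarrow> 'a" where
  "ip f h = (\<Oplus>i\<in>{i. f i \<noteq> \<zero>}. adj A (f i) \<otimes> h i)"

definition mnorm :: "('i \<Rightarrow> 'a) \<Rightarrow> real" where
  "mnorm f = sqrt (cnorm A (ip f f))"

lemma XD: "f \<in> X \<Longrightarrow> f i \<in> carrier A" "f \<in> X \<Longrightarrow> finite {i. f i \<noteq> \<zero>}" "f \<in> X \<Longrightarrow> i \<notin> I \<Longrightarrow> f i = \<zero>"
  by (auto simp: X_def)

lemma X_pointwise:
  assumes f: "f \<in> X" and c: "\<And>i x. x \<in> carrier A \<Longrightarrow> \<phi> i x \<in> carrier A" and z: "\<And>i. \<phi> i \<zero> = \<zero>"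
  shows "(\<lambda>i. \<phi> i (f i)) \<in> X"
proof -
  have "{i. \<phi> i (f i) \<noteq> \<zero>} \<subseteq> {i. f i \<noteq> \<zero>}" using z by auto
  then show ?thesis using assms unfolding X_def by (auto intro: finite_subset)
qed

lemma X_zero: "(\<lambda>i. \<zero>) \<in> X" by (simp add: X_def)

lemma X_plus: "f \<in> X \<Longrightarrow> h \<in> X \<Longrightarrow> (\<lambda>i. f i \<oplus> h i) \<in> X"
proof -
  assume a: "f \<in> X" "h \<in> X"
  have "{i. f i \<oplus> h i \<noteq> \<zero>} \<subseteq> {i. f i \<noteq> \<zero>} \<union> {i. h i \<noteq> \<zero>}" by auto
  then show ?thesis using a unfolding X_def by (auto intro: finite_subset)
qed

lemma X_scale: "f \<in> X \<Longrightarrow> (\<lambda>i. scale A z (f i)) \<in> X"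
  by (rule X_pointwise) auto

lemma X_left: "f \<in> X \<Longrightarrow> a \<in> carrier A \<Longrightarrow> (\<lambda>i. a \<otimes> f i) \<in> X"
  by (rule X_pointwise) auto

lemma X_right: "f \<in> X \<Longrightarrow> a \<in> carrier A \<Longrightarrow> (\<lambda>i. f i \<otimes> a) \<in> X"
  by (rule X_pointwise[where \<phi> = "\<lambda>i x. x \<otimes> a"]) auto

lemmas X_intros [intro, simp] = X_zero X_plus X_scale X_left X_right

lemma ip_term: "f \<in> X \<Longrightarrow> h \<in> X \<Longrightarrow> adj A (f i) \<otimes> h i \<in> carrier A"
  by (simp add: XD)

lemma ip_eq:
  assumes "f \<in> X" "h \<in> X" "finite F" "{i. f i \<noteq> \<zero>} \<subseteq> F"
  shows "ip f h = (\<Oplus>i\<in>F. adj A (f i) \<otimes> h i)"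
  unfolding ip_def using assms ip_term[OF assms(1,2)]
  by (intro add.finprod_mono_neutral_cong_left) (auto simp: XD)

lemma ip_support:
  assumes "f \<in> X" "h \<in> X"
  obtains F where "finite F" "{i. f i \<noteq> \<zero>} \<subseteq> F" "{i. h i \<noteq> \<zero>} \<subseteq> F"
  using that[of "{i. f i \<noteq> \<zero>} \<union> {i. h i \<noteq> \<zero>}"] assms by (auto simp: XD)

lemma ip_in [simp]: "f \<in> X \<Longrightarrow> h \<in> X \<Longrightarrow> ip f h \<in> carrier A"
  unfolding ip_def by (intro finsum_closed) (auto simp: XD)

lemma ip_adj: assumes f: "f \<in> X" and h: "h \<in> X" shows "adj A (ip f h) = ip h f"
proof -
  obtain F where F: "finite F" "{i. f i \<noteq> \<zero>} \<subseteq> F" "{i. h i \<noteq> \<zero>} \<subseteq> F"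
    using ip_support[OF f h] .
  have "adj A (ip f h) = (\<Oplus>i\<in>F. adj A (adj A (f i) \<otimes> h i))"
    using f h F abelian_group_axioms
    by (simp only: ip_eq) (intro finsum_additive, auto simp: adj_plus ip_term)
  also have "\<dots> = (\<Oplus>i\<in>F. adj A (h i) \<otimes> f i)"
    using f h by (intro finsum_cong') (auto simp: adj_mult adj_adj XD)
  finally show ?thesis using ip_eq[OF h f F(1,3)] by simp
qed

lemma ip_plus_right:
  assumes f: "f \<in> X" and h: "h \<in> X" "h' \<in> X"
  shows "ip f (\<lambda>i. h i \<oplus> h' i) = ip f h \<oplus> ip f h'"
proof -
  have "ip f (\<lambda>i. h i \<oplus> h' i) = (\<Oplus>i\<in>{i. f i \<noteq> \<zero>}. adj A (f i) \<otimes> h i \<oplus> adj A (f i) \<otimes> h' i)"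
    unfolding ip_def using f h by (intro finsum_cong') (auto simp: mult_plus XD)
  also have "\<dots> = ip f h \<oplus> ip f h'"
    unfolding ip_def using f h by (intro finsum_addf) (auto simp: XD)
  finally show ?thesis .
qed

lemma ip_scale_right:
  assumes f: "f \<in> X" and h: "h \<in> X"
  shows "ip f (\<lambda>i. scale A z (h i)) = scale A z (ip f h)"
proof -
  have "scale A z (ip f h) = (\<Oplus>i\<in>{i. f i \<noteq> \<zero>}. scale A z (adj A (f i) \<otimes> h i))"
    unfolding ip_def using f h abelian_group_axioms
    by (intro finsum_additive) (auto simp: scale_plus XD)
  also have "\<dots> = ip f (\<lambda>i. scale A z (h i))"
    unfolding ip_def using f h by (intro finsum_cong') (auto simp: mult_scale XD)
  finally show ?thesis ..
qed

lemma ip_mult_right: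
  assumes f: "f \<in> X" and h: "h \<in> X" and a: "a \<in> carrier A"
  shows "ip f (\<lambda>i. h i \<otimes> a) = ip f h \<otimes> a"
proof -
  have "ip f h \<otimes> a = (\<Oplus>i\<in>{i. f i \<noteq> \<zero>}. adj A (f i) \<otimes> h i \<otimes> a)"
    unfolding ip_def using f h a abelian_group_axioms
    by (intro finsum_additive[where \<phi> = "\<lambda>x. x \<otimes> a"]) (auto simp: plus_mult XD)
  also have "\<dots> = ip f (\<lambda>i. h i \<otimes> a)"
    unfolding ip_def using f h a by (intro finsum_cong') (auto simp: mult_assoc XD)
  finally show ?thesis ..
qed

lemma ip_plus_left: "\<lbrakk>f \<in> X; f' \<in> X; h \<in> X\<rbrakk> \<Longrightarrow> ip (\<lambda>i. f i \<oplus> f' i) h = ip f h \<oplus> ip f' h"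
  using ip_adj[of h "\<lambda>i. f i \<oplus> f' i"] by (simp add: ip_plus_right adj_plus ip_adj)

lemma ip_scale_left: "\<lbrakk>f \<in> X; h \<in> X\<rbrakk> \<Longrightarrow> ip (\<lambda>i. scale A z (f i)) h = scale A (cnj z) (ip f h)"
  using ip_adj[of h "\<lambda>i. scale A z (f i)"] by (simp add: ip_scale_right adj_scale ip_adj)

lemma ip_mult_left: "\<lbrakk>f \<in> X; h \<in> X; a \<in> carrier A\<rbrakk> \<Longrightarrow> ip (\<lambda>i. f i \<otimes> a) h = adj A a \<otimes> ip f h"
  using ip_adj[of h "\<lambda>i. f i \<otimes> a"] by (simp add: ip_mult_right adj_mult ip_adj)

lemma ip_left_mult:
  assumes f: "f \<in> X" and h: "h \<in> X" and a: "a \<in> carrier A"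
  shows "ip (\<lambda>i. a \<otimes> f i) h = ip f (\<lambda>i. adj A a \<otimes> h i)"
proof -
  have "{i. a \<otimes> f i \<noteq> \<zero>} \<subseteq> {i. f i \<noteq> \<zero>}" using a by auto
  then have "ip (\<lambda>i. a \<otimes> f i) h = (\<Oplus>i\<in>{i. f i \<noteq> \<zero>}. adj A (a \<otimes> f i) \<otimes> h i)"
    using f h a by (intro ip_eq) (auto simp: XD)
  also have "\<dots> = ip f (\<lambda>i. adj A a \<otimes> h i)"
    unfolding ip_def using f h a by (intro finsum_cong') (auto simp: adj_mult mult_assoc XD)
  finally show ?thesis .
qed

lemma pos_ip: "f \<in> X \<Longrightarrow> pos (ip f f)"
  unfolding ip_def by (intro pos_finsum pos_adj_mult) (auto simp: XD)

lemma mnorm_nonneg [simp]: "f \<in> X \<Longrightarrow> 0 \<le> mnorm f"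
  by (simp add: mnorm_def)

lemma mnorm_sq: "f \<in> X \<Longrightarrow> (mnorm f)\<^sup>2 = cnorm A (ip f f)"
  by (simp add: mnorm_def)

text \<open>Completing the square, with \<open>a\<close> the inner product, \<open>P\<close> and
  \<open>Q\<close> those of \<open>f\<close> and \<open>h\<close> with themselves, and
  \<open>t\<close> above the norm of \<open>P\<close>. For \<open>g = f a - t h\<close> and
  \<open>r\<^sup>2 = t - P\<close>, the sum of the positive elements \<open>ip g g\<close> and
  \<open>(ra)\<^sup>*(ra)\<close> is \<open>t\<^sup>2 Q - t a\<^sup>*a\<close>. Hence
  \<open>t a\<^sup>*a\<close> lies below \<open>t\<^sup>2 Q\<close>, and norms can be
  compared.\<close>

lemma Cauchy_Schwarz:
  assumes f: "f \<in> X" and h: "h \<in> X" shows "cnorm A (ip f h) \<le> mnorm f * mnorm h"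
proof -
  define a where "a = ip f h"
  define P where "P = ip f f"
  define Q where "Q = ip h h"
  have c: "a \<in> carrier A" "P \<in> carrier A" "Q \<in> carrier A" using f h by (simp_all add: a_def P_def Q_def)
  have P: "adj A P = P" using f by (simp add: P_def ip_adj)
  have key: "(cnorm A a)\<^sup>2 \<le> t * cnorm A Q" if t: "cnorm A P < t" for t
  proof -
    have t0: "t > 0" using t norm_nonneg[OF c(2)] by linarith
    have "sc t \<ominus> (sc t \<ominus> P) = P" using c(2) sc_in[of t] by algebra
    then have "cnorm A (sc t \<ominus> (sc t \<ominus> P)) < t" using t by simp
    moreover have "sc t \<ominus> P \<in> carrier A" "adj A (sc t \<ominus> P) = sc t \<ominus> P"
      using c P by (simp_all only: minus_closed sc_in adj_minus adj_sc)
    ultimately obtain r where r: "r \<in> carrier A" "adj A r = r" "r \<otimes> r = sc t \<ominus> P"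
      using sqrt_exists by blast
    define g where "g = (\<lambda>i. f i \<otimes> a \<oplus> scale A (of_real (- t)) (h i))"
    have g: "g \<in> X" using f h c by (auto simp: g_def)
    define B where "B = adj A a \<otimes> a"
    define tB where "tB = scale A (of_real t) B"
    define R where "R = adj A a \<otimes> P \<otimes> a"
    have BB: "B \<in> carrier A" "tB \<in> carrier A" "R \<in> carrier A" using c by (simp_all add: B_def tB_def R_def)
    have ha: "ip h f = adj A a" using f h by (simp add: a_def ip_adj)
    have "ip g g = R \<ominus> tB \<ominus> tB \<oplus> scale A (of_real (t * t)) Q"
      using f h c unfolding g_def
      by (simp add: ip_plus_left ip_plus_right ip_scale_left ip_scale_right ip_mult_left ip_mult_right
          scale_scale scale_plus ha a_def[symmetric] P_def[symmetric] Q_def[symmetric] mult_scale scale_mult)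
         (simp add: R_def tB_def B_def scale_uminus a_minus_def a_ac mult_assoc)
    moreover have "adj A (r \<otimes> a) \<otimes> (r \<otimes> a) = tB \<ominus> R"
    proof -
      have "adj A (r \<otimes> a) \<otimes> (r \<otimes> a) = adj A a \<otimes> (r \<otimes> r) \<otimes> a"
        using r(1,2) c by (simp add: adj_mult mult_assoc)
      then show ?thesis
        using c by (simp add: r(3) mult_minus minus_mult mult_scale scale_mult one_in tB_def B_def R_def)
    qed
    ultimately have "scale A (of_real (t * t)) Q = tB \<oplus> (ip g g \<oplus> adj A (r \<otimes> a) \<otimes> (r \<otimes> a))"
      using BB scale_in[OF c(3), of "of_real (t * t)"] by (simp only:) algebra
    moreover have "pos tB" unfolding tB_def B_def using t0 c by (intro pos_scale pos_adj_mult) auto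
    ultimately have "cnorm A tB \<le> cnorm A (scale A (of_real (t * t)) Q)"
      using norm_pos_mono[of tB "ip g g \<oplus> adj A (r \<otimes> a) \<otimes> (r \<otimes> a)"] g r(1) c
      by (simp add: pos_plus pos_ip pos_adj_mult)
    then have "t * (cnorm A a)\<^sup>2 \<le> t * (t * cnorm A Q)"
      using t0 c
      by (simp add: tB_def B_def norm_scale cstar_identity real_normed_div_algebra_class.norm_mult)
    then show ?thesis using t0 by simp
  qed
  have "(cnorm A a)\<^sup>2 \<le> cnorm A P * cnorm A Q"
  proof (rule field_le_epsilon)
    fix e :: real assume e: "e > 0"
    have Q: "cnorm A Q \<ge> 0" using c by simp
    \<comment> \<open>The excess of \<open>t\<close> over the norm of \<open>P\<close> is chosen so
      that, multiplied by the norm of \<open>Q\<close>, it costs at most \<open>e\<close>; the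
      summand 1 covers \<open>Q = \<zero>\<close>.\<close>
    then have "e / (cnorm A Q + 1) > 0" using e by simp
    then have "(cnorm A a)\<^sup>2 \<le> (cnorm A P + e / (cnorm A Q + 1)) * cnorm A Q" by (intro key) simp
    also have "\<dots> = cnorm A P * cnorm A Q + e * (cnorm A Q / (cnorm A Q + 1))"
      by (simp add: distrib_right)
    also have "\<dots> \<le> cnorm A P * cnorm A Q + e * 1"
      using e Q by (intro add_left_mono mult_left_mono) auto
    finally show "(cnorm A a)\<^sup>2 \<le> cnorm A P * cnorm A Q + e" by simp
  qed
  also have "\<dots> = (mnorm f * mnorm h)\<^sup>2" using f h by (simp add: P_def Q_def power_mult_distrib mnorm_sq)
  finally show ?thesis unfolding a_def by (rule power2_le_imp_le) (use f h in simp)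
qed

lemma mnorm_plus:
  assumes f: "f \<in> X" and h: "h \<in> X" shows "mnorm (\<lambda>i. f i \<oplus> h i) \<le> mnorm f + mnorm h"
proof (rule power2_le_imp_le)
  have "(mnorm (\<lambda>i. f i \<oplus> h i))\<^sup>2 = cnorm A ((ip f f \<oplus> ip f h) \<oplus> (ip h f \<oplus> ip h h))"
    using f h by (simp add: mnorm_sq ip_plus_left ip_plus_right a_ac)
  also have "\<dots> \<le> (cnorm A (ip f f) + cnorm A (ip f h)) + (cnorm A (ip h f) + cnorm A (ip h h))"
    using f h by (intro order_trans[OF norm_plus] add_mono norm_plus) auto
  also have "\<dots> \<le> ((mnorm f)\<^sup>2 + mnorm f * mnorm h) + (mnorm h * mnorm f + (mnorm h)\<^sup>2)"
    using f h by (intro add_mono Cauchy_Schwarz) (auto simp: mnorm_sq)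
  also have "\<dots> = (mnorm f + mnorm h)\<^sup>2" by (simp add: power2_eq_square algebra_simps)
  finally show "(mnorm (\<lambda>i. f i \<oplus> h i))\<^sup>2 \<le> (mnorm f + mnorm h)\<^sup>2" .
qed (use f h in simp)

lemma mnorm_scale: "f \<in> X \<Longrightarrow> mnorm (\<lambda>i. scale A z (f i)) = cmod z * mnorm f"
  by (simp add: mnorm_def ip_scale_left ip_scale_right norm_scale real_sqrt_mult mult.assoc[symmetric])

text \<open>For \<open>t\<close> above the squared norm of \<open>a\<close> choose \<open>r\<close>
  with \<open>r\<^sup>2 = t - a\<^sup>*a\<close>. The inner squares of \<open>a f\<close> and
  \<open>r f\<close> are positive and add up to \<open>t\<close> times that of \<open>f\<close>, so
  the first is dominated by the sum.\<close>

lemma mnorm_left: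
  assumes f: "f \<in> X" and a: "a \<in> carrier A"
  shows "mnorm (\<lambda>i. a \<otimes> f i) \<le> cnorm A a * mnorm f"
proof (rule power2_le_imp_le)
  let ?af = "\<lambda>i. a \<otimes> f i"
  define p where "p = adj A a \<otimes> a"
  have p: "p \<in> carrier A" "adj A p = p" "cnorm A p = (cnorm A a)\<^sup>2"
    using a by (simp_all add: p_def adj_mult adj_adj cstar_identity)
  have key: "(mnorm ?af)\<^sup>2 \<le> t * (mnorm f)\<^sup>2" if t: "(cnorm A a)\<^sup>2 < t" for t
  proof -
    have t0: "t > 0" using t zero_le_power2[of "cnorm A a"] by linarith
    have "sc t \<ominus> (sc t \<ominus> p) = p" using p(1) sc_in[of t] by algebra
    then have "cnorm A (sc t \<ominus> (sc t \<ominus> p)) < t" using t p by simp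
    moreover have "sc t \<ominus> p \<in> carrier A" "adj A (sc t \<ominus> p) = sc t \<ominus> p"
      using p by (simp_all only: minus_closed sc_in adj_minus adj_sc)
    ultimately obtain r where r: "r \<in> carrier A" "adj A r = r" "r \<otimes> r = sc t \<ominus> p"
      using sqrt_exists by blast
    let ?rf = "\<lambda>i. r \<otimes> f i"
    have "p \<otimes> f i \<oplus> r \<otimes> (r \<otimes> f i) = scale A (of_real t) (f i)" for i
    proof -
      have fi: "f i \<in> carrier A" "scale A (of_real t) (f i) \<in> carrier A" using f by (simp_all add: XD)
      have "r \<otimes> (r \<otimes> f i) = scale A (of_real t) (f i) \<ominus> p \<otimes> f i"
        using r(1) fi p by (simp add: mult_assoc[symmetric] r(3) minus_mult sc_mult)
      then show ?thesis using fi p mult_in[OF p(1) fi(1)] by (simp only:) algebra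
    qed
    then have "ip ?af ?af \<oplus> ip ?rf ?rf = ip f (\<lambda>i. scale A (of_real t) (f i))"
      using f a r(1,2) p by (simp add: ip_left_mult ip_plus_right[symmetric] mult_assoc[symmetric] XD p_def)
    then have "ip ?af ?af \<oplus> ip ?rf ?rf = scale A (of_real t) (ip f f)"
      using f by (simp add: ip_scale_right)
    then have "cnorm A (ip ?af ?af) \<le> cnorm A (scale A (of_real t) (ip f f))"
      using norm_pos_mono[of "ip ?af ?af" "ip ?rf ?rf"] f a r(1) by (simp add: pos_ip)
    then show ?thesis using f a t0 by (simp add: mnorm_sq norm_scale)
  qed
  show "(mnorm ?af)\<^sup>2 \<le> (cnorm A a * mnorm f)\<^sup>2"
  proof (rule field_le_epsilon)
    fix e :: real assume e: "e > 0"
    let ?Q = "(mnorm f)\<^sup>2"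
    have "e / (?Q + 1) > 0" using e by (simp add: add_nonneg_pos)
    then have "(mnorm ?af)\<^sup>2 \<le> ((cnorm A a)\<^sup>2 + e / (?Q + 1)) * ?Q" by (intro key) simp
    also have "\<dots> = (cnorm A a)\<^sup>2 * ?Q + e * (?Q / (?Q + 1))"
      by (simp add: distrib_right)
    also have "\<dots> \<le> (cnorm A a)\<^sup>2 * ?Q + e * 1"
      using e by (intro add_left_mono mult_left_mono) (auto simp: divide_le_eq_1 add_nonneg_pos)
    finally show "(mnorm ?af)\<^sup>2 \<le> (cnorm A a * mnorm f)\<^sup>2 + e" by (simp add: power_mult_distrib)
  qed
qed (use f a in simp)

lemma mnorm_zero [simp]: "mnorm (\<lambda>i. \<zero>) = 0"
  using mnorm_scale[OF X_zero, of 0] by simp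

text \<open>The value off \<open>X\<close> is fixed, so that operators agreeing on \<open>X\<close>
  are equal as functions and the algebra laws hold as equations.\<close>

definition lin_op :: "(('i \<Rightarrow> 'a) \<Rightarrow> 'i \<Rightarrow> 'a) \<Rightarrow> bool" where
  "lin_op L \<longleftrightarrow> (\<forall>f\<in>X. L f \<in> X) \<and> (\<forall>f. f \<notin> X \<longrightarrow> L f = (\<lambda>i. \<zero>)) \<and>
    (\<forall>f\<in>X. \<forall>h\<in>X. L (\<lambda>i. f i \<oplus> h i) = (\<lambda>i. L f i \<oplus> L h i)) \<and>
    (\<forall>z. \<forall>f\<in>X. L (\<lambda>i. scale A z (f i)) = (\<lambda>i. scale A z (L f i))) \<and>
    (\<exists>K\<ge>0. \<forall>f\<in>X. mnorm (L f) \<le> K * mnorm f)"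

lemma lin_opD:
  assumes "lin_op L"
  shows "f \<in> X \<Longrightarrow> L f \<in> X" "f \<notin> X \<Longrightarrow> L f = (\<lambda>i. \<zero>)"
    "f \<in> X \<Longrightarrow> h \<in> X \<Longrightarrow> L (\<lambda>i. f i \<oplus> h i) = (\<lambda>i. L f i \<oplus> L h i)"
    "f \<in> X \<Longrightarrow> L (\<lambda>i. scale A z (f i)) = (\<lambda>i. scale A z (L f i))"
    "\<exists>K\<ge>0. \<forall>f\<in>X. mnorm (L f) \<le> K * mnorm f"
  using assms by (auto simp: lin_op_def)

lemma lin_op_X: "lin_op L \<Longrightarrow> L f \<in> X"
  by (cases "f \<in> X") (simp_all add: lin_opD)

lemma lin_op_in: "lin_op L \<Longrightarrow> L f i \<in> carrier A"
  by (cases "f \<in> X") (simp_all add: lin_opD XD)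

lemma lin_op_zero: "lin_op L \<Longrightarrow> L (\<lambda>i. \<zero>) = (\<lambda>i. \<zero>)"
  using lin_opD(4)[OF _ X_zero, of L 0] by (simp add: lin_op_in)

lemma lin_op_comp: assumes L: "lin_op L" and M: "lin_op M" shows "lin_op (L \<circ> M)"
proof -
  obtain K K' where K: "K \<ge> 0" "\<And>f. f \<in> X \<Longrightarrow> mnorm (L f) \<le> K * mnorm f"
    "K' \<ge> 0" "\<And>f. f \<in> X \<Longrightarrow> mnorm (M f) \<le> K' * mnorm f"
    using lin_opD(5)[OF L] lin_opD(5)[OF M] by blast
  have "mnorm (L (M f)) \<le> K * K' * mnorm f" if "f \<in> X" for f
    using K(2)[OF lin_opD(1)[OF M that]] mult_left_mono[OF K(4)[OF that] K(1)] by (simp add: mult.assoc)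
  then show ?thesis using L M K(1,3) unfolding lin_op_def
    by (intro conjI exI[of _ "K * K'"]) (auto simp: lin_op_zero[OF L])
qed

lemma lin_op_plus: assumes L: "lin_op L" and M: "lin_op M" shows "lin_op (\<lambda>f i. L f i \<oplus> M f i)"
proof -
  obtain K K' where K: "K \<ge> 0" "\<And>f. f \<in> X \<Longrightarrow> mnorm (L f) \<le> K * mnorm f"
    "K' \<ge> 0" "\<And>f. f \<in> X \<Longrightarrow> mnorm (M f) \<le> K' * mnorm f"
    using lin_opD(5)[OF L] lin_opD(5)[OF M] by blast
  have "mnorm (\<lambda>i. L f i \<oplus> M f i) \<le> (K + K') * mnorm f" if "f \<in> X" for f
    using order_trans[OF mnorm_plus add_mono[OF K(2) K(4)], OF _ _ that that] lin_opD(1)[OF L that]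
      lin_opD(1)[OF M that] by (simp add: distrib_right)
  then show ?thesis using K(1,3) unfolding lin_op_def
    by (intro conjI exI[of _ "K + K'"])
       (auto simp: lin_opD[OF L] lin_opD[OF M] lin_op_in[OF L] lin_op_in[OF M] scale_plus a_ac fun_eq_iff)
qed

lemma lin_op_scale: assumes L: "lin_op L" shows "lin_op (\<lambda>f i. scale A z (L f i))"
proof -
  obtain K where K: "K \<ge> 0" "\<And>f. f \<in> X \<Longrightarrow> mnorm (L f) \<le> K * mnorm f"
    using lin_opD(5)[OF L] by blast
  have "mnorm (\<lambda>i. scale A z (L f i)) \<le> cmod z * K * mnorm f" if "f \<in> X" for f
    using mult_left_mono[OF K(2)[OF that], of "cmod z"] lin_opD(1)[OF L that]
    by (simp add: mnorm_scale mult.assoc)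
  then show ?thesis using K(1) unfolding lin_op_def
    by (intro conjI exI[of _ "cmod z * K"])
       (auto simp: lin_opD[OF L] lin_op_in[OF L] scale_plus scale_scale mult.commute)
qed

lemma lin_op_const_zero: "lin_op (\<lambda>f i. \<zero>)"
  unfolding lin_op_def by (auto intro: exI[of _ 0])

text \<open>A bounded operator on an inner product module need not have an adjoint. Each operator is
  therefore paired with one, and the involution becomes the exchange of components.\<close>

definition ops :: "((('i \<Rightarrow> 'a) \<Rightarrow> 'i \<Rightarrow> 'a) \<times> (('i \<Rightarrow> 'a) \<Rightarrow> 'i \<Rightarrow> 'a)) set" where
  "ops = {(L, L'). lin_op L \<and> lin_op L' \<and> (\<forall>f\<in>X. \<forall>h\<in>X. ip (L f) h = ip f (L' h))}"

definition opalg :: "((('i \<Rightarrow> 'a) \<Rightarrow> 'i \<Rightarrow> 'a) \<times> (('i \<Rightarrow> 'a) \<Rightarrow> 'i \<Rightarrow> 'a)) cstar" where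
  "opalg = \<lparr>
    carrier = ops,
    mult = (\<lambda>x y. (fst x \<circ> fst y, snd y \<circ> snd x)),
    one = (\<lambda>f. if f \<in> X then f else (\<lambda>i. \<zero>), \<lambda>f. if f \<in> X then f else (\<lambda>i. \<zero>)),
    zero = (\<lambda>f i. \<zero>, \<lambda>f i. \<zero>),
    add = (\<lambda>x y. (\<lambda>f i. fst x f i \<oplus> fst y f i, \<lambda>f i. snd x f i \<oplus> snd y f i)),
    scale = (\<lambda>z x. (\<lambda>f i. scale A z (fst x f i), \<lambda>f i. scale A (cnj z) (snd x f i))),
    adj = (\<lambda>x. (snd x, fst x)),
    cnorm = (\<lambda>x. opnorm X mnorm (\<lambda>f. mnorm (fst x f)))\<rparr>"

lemma opalg_sel [simp]:
  "carrier opalg = ops"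
  "mult opalg x y = (fst x \<circ> fst y, snd y \<circ> snd x)"
  "zero opalg = (\<lambda>f i. \<zero>, \<lambda>f i. \<zero>)"
  "add opalg x y = (\<lambda>f i. fst x f i \<oplus> fst y f i, \<lambda>f i. snd x f i \<oplus> snd y f i)"
  "scale opalg z x = (\<lambda>f i. scale A z (fst x f i), \<lambda>f i. scale A (cnj z) (snd x f i))"
  "adj opalg x = (snd x, fst x)"
  by (simp_all add: opalg_def)

lemma opsD:
  assumes "x \<in> ops"
  shows "lin_op (fst x)" "lin_op (snd x)" "f \<in> X \<Longrightarrow> h \<in> X \<Longrightarrow> ip (fst x f) h = ip f (snd x h)"
    "f \<in> X \<Longrightarrow> h \<in> X \<Longrightarrow> ip (snd x f) h = ip f (fst x h)"
proof -
  show 1: "lin_op (fst x)" "lin_op (snd x)" using assms by (auto simp: ops_def)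
  show 2: "ip (fst x f) h = ip f (snd x h)" if "f \<in> X" "h \<in> X" for f h
    using assms that by (auto simp: ops_def)
  show "ip (snd x f) h = ip f (fst x h)" if "f \<in> X" "h \<in> X"
    using 2[OF that(2,1)] that ip_adj lin_opD(1) 1 by metis
qed

lemma ops_lin_op: "(L, M) \<in> ops \<Longrightarrow> lin_op L" "(L, M) \<in> ops \<Longrightarrow> lin_op M"
  by (simp_all add: ops_def)

lemma opalg_norm_bound: "x \<in> ops \<Longrightarrow> f \<in> X \<Longrightarrow> mnorm (fst x f) \<le> cnorm opalg x * mnorm f"
  using opnorm_bound[where m = "\<lambda>f. mnorm (fst x f)", OF lin_opD(5)[OF opsD(1)]] by (simp add: opalg_def)

lemma opalg_norm_le: "0 \<le> K \<Longrightarrow> (\<And>f. f \<in> X \<Longrightarrow> mnorm (fst x f) \<le> K * mnorm f) \<Longrightarrow> cnorm opalg x \<le> K"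
  by (simp add: opalg_def opnorm_le)

lemma opalg_norm_nonneg: "x \<in> ops \<Longrightarrow> 0 \<le> cnorm opalg x"
  using opnorm_nonneg[OF lin_opD(5)[OF opsD(1)]] by (simp add: opalg_def)

lemma opalg_norm_mult:
  assumes "x \<in> ops" "y \<in> ops" shows "cnorm opalg (x \<otimes>\<^bsub>opalg\<^esub> y) \<le> cnorm opalg x * cnorm opalg y"
proof (rule opalg_norm_le)
  fix f assume f: "f \<in> X"
  have "mnorm (fst x (fst y f)) \<le> cnorm opalg x * mnorm (fst y f)"
    using assms f by (intro opalg_norm_bound) (auto simp: lin_opD opsD)
  also have "\<dots> \<le> cnorm opalg x * (cnorm opalg y * mnorm f)"
    using assms f by (intro mult_left_mono opalg_norm_bound opalg_norm_nonneg)
  finally show "mnorm (fst (x \<otimes>\<^bsub>opalg\<^esub> y) f) \<le> cnorm opalg x * cnorm opalg y * mnorm f"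
    by (simp add: mult.assoc)
qed (use assms in \<open>simp add: opalg_norm_nonneg\<close>)

lemma opalg_mult_in: "x \<in> ops \<Longrightarrow> y \<in> ops \<Longrightarrow> x \<otimes>\<^bsub>opalg\<^esub> y \<in> ops"
  unfolding ops_def by (auto simp: lin_op_comp lin_opD)

text \<open>The squared norm of \<open>x f\<close> is the norm of the inner product of
  \<open>f\<close> with \<open>x\<^sup>*x f\<close>, to which Cauchy-Schwarz applies. Only the first
  component enters the norm of \<open>opalg\<close>; that the second has the same norm comes out
  afterwards.\<close>

lemma opalg_sq_le:
  assumes x: "x \<in> ops"
  shows "(cnorm opalg x)\<^sup>2 \<le> cnorm opalg (adj opalg x \<otimes>\<^bsub>opalg\<^esub> x)" (is "_ \<le> ?N")
proof -
  have s: "adj opalg x \<in> ops" using opsD[OF x] by (auto simp: ops_def)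
  have sx: "adj opalg x \<otimes>\<^bsub>opalg\<^esub> x \<in> ops" by (rule opalg_mult_in[OF s x])
  then have N0: "0 \<le> ?N" by (rule opalg_norm_nonneg)
  have "cnorm opalg x \<le> sqrt ?N"
  proof (rule opalg_norm_le)
    fix f assume f: "f \<in> X"
    let ?g = "fst (adj opalg x \<otimes>\<^bsub>opalg\<^esub> x) f"
    have g: "?g \<in> X" using lin_opD(1)[OF opsD(1)[OF sx] f] .
    have "(mnorm (fst x f))\<^sup>2 = cnorm A (ip f ?g)"
      using x f by (simp add: mnorm_sq lin_opD opsD)
    also have "\<dots> \<le> mnorm f * mnorm ?g" by (rule Cauchy_Schwarz[OF f g])
    also have "\<dots> \<le> mnorm f * (?N * mnorm f)"
      using f sx by (intro mult_left_mono opalg_norm_bound) auto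
    also have "\<dots> = (sqrt ?N * mnorm f)\<^sup>2"
      using N0 by (simp add: power_mult_distrib power2_eq_square)
    finally show "mnorm (fst x f) \<le> sqrt ?N * mnorm f"
      by (rule power2_le_imp_le) (use N0 f in simp)
  qed (use N0 in simp)
  then have "(cnorm opalg x)\<^sup>2 \<le> (sqrt ?N)\<^sup>2"
    using x by (intro power_mono opalg_norm_nonneg)
  then show ?thesis using N0 by simp
qed

lemma opalg_adj_in: "x \<in> ops \<Longrightarrow> adj opalg x \<in> ops"
  using opsD[of x] by (auto simp: ops_def)

lemma opalg_cstar_identity:
  assumes x: "x \<in> ops"
  shows "cnorm opalg (adj opalg x \<otimes>\<^bsub>opalg\<^esub> x) = (cnorm opalg x)\<^sup>2"
proof -
  let ?s = "adj opalg x"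
  have s: "?s \<in> ops" "adj opalg ?s = x" using opalg_adj_in[OF x] by simp_all
  show ?thesis
    using opalg_sq_le[OF x] opalg_norm_mult[OF s(1) x] opalg_sq_le[OF s(1), unfolded s(2)]
      opalg_norm_mult[OF x s(1)] opalg_norm_nonneg[OF x] opalg_norm_nonneg[OF s(1)]
    by (intro eq_square_of_bounds[of "cnorm opalg x" "cnorm opalg ?s"])
qed


text \<open>The module is not completed, so completeness of the operator algebra cannot be expected.
  This is the reason for \<open>pre_cstar\<close>, which asks for neither completeness nor
  definiteness of the norm; both are supplied afterwards by completing the algebra.\<close>

lemma pre_cstar_opalg: "pre_cstar opalg"
proof -
  have plus: "x \<oplus>\<^bsub>opalg\<^esub> y \<in> ops" if "x \<in> ops" "y \<in> ops" for x y
    using opsD[OF that(1)] opsD[OF that(2)]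
    by (auto simp: ops_def lin_op_plus ip_plus_left ip_plus_right lin_opD)
  have scale: "scale opalg z x \<in> ops" if "x \<in> ops" for x z
    using opsD[OF that]
    by (auto simp: ops_def lin_op_scale ip_scale_left ip_scale_right lin_opD)
  have zero: "(\<lambda>f i. \<zero>, \<lambda>f i. \<zero>) \<in> ops"
    using ip_scale_right[OF _ X_zero, of _ 0]
    by (auto simp: ops_def lin_op_const_zero) (simp add: ip_def)
  note cin = lin_op_in[OF opsD(1)] lin_op_in[OF opsD(2)]
  interpret abelian_group opalg
  proof (rule abelian_groupI)
    fix x assume "x \<in> carrier opalg"
    then have x: "x \<in> ops" by simp
    have "scale opalg (- 1) x \<oplus>\<^bsub>opalg\<^esub> x = \<zero>\<^bsub>opalg\<^esub>"
      using x by (simp add: cin scale_minus_one l_neg)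
    then show "\<exists>y\<in>carrier opalg. y \<oplus>\<^bsub>opalg\<^esub> x = \<zero>\<^bsub>opalg\<^esub>"
      using scale[OF x, of "- 1"] by (intro bexI) (simp_all only: opalg_sel(1))
  qed (use plus zero in \<open>auto simp: cin a_ac prod_eq_iff\<close>)
  show ?thesis
  proof (unfold_locales, goal_cases)
    case (1 x z) then show ?case using scale by simp
  next
    case (6 x y)
    show ?case
    proof (rule opalg_norm_le)
      fix f assume f: "f \<in> X"
      show "mnorm (fst (x \<oplus>\<^bsub>opalg\<^esub> y) f) \<le> (cnorm opalg x + cnorm opalg y) * mnorm f"
        using 6 f order_trans[OF mnorm_plus add_mono[OF opalg_norm_bound opalg_norm_bound]]
        by (simp add: distrib_right lin_opD opsD)
    qed (use 6 opalg_norm_nonneg in simp)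
  next
    case (7 x z)
    then have x: "x \<in> ops" by simp
    have "cnorm opalg (scale opalg z x) = opnorm X mnorm (\<lambda>f. cmod z * mnorm (fst x f))"
      unfolding opalg_def using x by (simp, intro opnorm_cong) (simp add: mnorm_scale lin_opD opsD)
    also have "\<dots> = cmod z * cnorm opalg x"
      using x opnorm_scale[OF lin_opD(5)[OF opsD(1)[OF x]], of "cmod z"] by (simp add: opalg_def)
    finally show ?case .
  next
    case (8 a b) then show ?case using opalg_mult_in by simp
  next
    case (9 a) then show ?case using opalg_adj_in by simp
  next
    case (19 a b) then show ?case using opalg_norm_mult by simp
  next
    case (20 a) then show ?case using opalg_cstar_identity by simp
  qed (auto simp: cin scale_1 scale_scale scale_plus plus_scale o_def fun_eq_iff mult.commute
      lin_opD(3,4) ops_lin_op lin_op_X)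
qed

text \<open>A weighted permutation matrix. Twisted translations on a group are of this form, with
  unimodular weights.\<close>

definition perm_op :: "('i \<Rightarrow> complex) \<Rightarrow> ('i \<Rightarrow> 'i) \<Rightarrow> ('i \<Rightarrow> 'a) \<Rightarrow> 'i \<Rightarrow> 'a" where
  "perm_op u \<tau> f i = (if f \<in> X \<and> i \<in> I then scale A (u i) (f (\<tau> i)) else \<zero>)"

context
  fixes \<tau> \<tau>' :: "'i \<Rightarrow> 'i"
  assumes \<tau>: "\<And>i. i \<in> I \<Longrightarrow> \<tau> i \<in> I \<and> \<tau>' (\<tau> i) = i" and \<tau>': "\<And>i. i \<in> I \<Longrightarrow> \<tau>' i \<in> I \<and> \<tau> (\<tau>' i) = i"
begin

lemma perm_op_in: assumes f: "f \<in> X" shows "perm_op u \<tau> f \<in> X"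
proof -
  have "{i. perm_op u \<tau> f i \<noteq> \<zero>} \<subseteq> \<tau>' ` {i. f i \<noteq> \<zero>}"
  proof
    fix i assume "i \<in> {i. perm_op u \<tau> f i \<noteq> \<zero>}"
    then have "i \<in> I" "f (\<tau> i) \<noteq> \<zero>" by (auto simp: perm_op_def split: if_splits)
    then show "i \<in> \<tau>' ` {i. f i \<noteq> \<zero>}" using \<tau> by (intro image_eqI[of _ _ "\<tau> i"]) auto
  qed
  then have "finite {i. perm_op u \<tau> f i \<noteq> \<zero>}"
    using XD(2)[OF f] by (meson finite_imageI finite_subset)
  then show ?thesis unfolding X_def using XD(1)[OF f] by (auto simp: perm_op_def)
qed

text \<open>Reindexing the sum along the inverse permutation moves the operator to the other
  argument; the weight is conjugated and evaluated at the permuted index.\<close>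

lemma ip_perm_op:
  assumes f: "f \<in> X" and h: "h \<in> X"
  shows "ip (perm_op u \<tau> f) h = ip f (perm_op (\<lambda>i. cnj (u (\<tau>' i))) \<tau>' h)"
proof -
  let ?S = "{i. f i \<noteq> \<zero>}"
  have S: "finite ?S" "?S \<subseteq> I" using XD[OF f] by auto
  have inj: "inj_on \<tau>' ?S" using S(2) \<tau>' by (intro inj_on_inverseI[where g = \<tau>]) auto
  have "{i. perm_op u \<tau> f i \<noteq> \<zero>} \<subseteq> \<tau>' ` ?S"
  proof
    fix i assume "i \<in> {i. perm_op u \<tau> f i \<noteq> \<zero>}"
    then have "i \<in> I" "f (\<tau> i) \<noteq> \<zero>" by (auto simp: perm_op_def split: if_splits)
    then show "i \<in> \<tau>' ` ?S" using \<tau> by (intro image_eqI[of _ _ "\<tau> i"]) auto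
  qed
  then have "ip (perm_op u \<tau> f) h = (\<Oplus>i\<in>\<tau>' ` ?S. adj A (perm_op u \<tau> f i) \<otimes> h i)"
    using perm_op_in[OF f] h S by (intro ip_eq) auto
  also have "\<dots> = (\<Oplus>i\<in>?S. adj A (perm_op u \<tau> f (\<tau>' i)) \<otimes> h (\<tau>' i))"
    using inj perm_op_in[OF f] h by (intro finsum_reindex) (auto simp: XD)
  also have "\<dots> = ip f (perm_op (\<lambda>i. cnj (u (\<tau>' i))) \<tau>' h)"
    unfolding ip_def
  proof (intro finsum_cong')
    fix i assume "i \<in> ?S"
    then have "i \<in> I" using S by blast
    then show "adj A (perm_op u \<tau> f (\<tau>' i)) \<otimes> h (\<tau>' i)
        = adj A (f i) \<otimes> perm_op (\<lambda>i. cnj (u (\<tau>' i))) \<tau>' h i"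
      using f h \<tau>'[of i] by (simp add: perm_op_def adj_scale scale_mult mult_scale XD)
  qed (use f h in \<open>auto simp: XD perm_op_def\<close>)
  finally show ?thesis .
qed

text \<open>With unimodular weights the adjoint undoes the operator, so the operator is isometric
  and bounded by 1.\<close>

lemma lin_op_perm_op:
  assumes u: "\<And>i. i \<in> I \<Longrightarrow> cmod (u i) = 1" shows "lin_op (perm_op u \<tau>)"
proof -
  have "mnorm (perm_op u \<tau> f) = mnorm f" if f: "f \<in> X" for f
  proof -
    have 1: "cnj (u i) * u i = 1" if "i \<in> I" for i
      using complex_norm_square[of "u i"] u[OF that] by (simp add: mult.commute)
    have "perm_op (\<lambda>i. cnj (u (\<tau>' i))) \<tau>' (perm_op u \<tau> f) = f"
    proof
      fix i
      show "perm_op (\<lambda>i. cnj (u (\<tau>' i))) \<tau>' (perm_op u \<tau> f) i = f i"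
        using f perm_op_in[OF f, of u] \<tau>'[of i] 1[of "\<tau>' i"] XD(3)[OF f, of i] 
        by (cases "i \<in> I") (simp_all add: perm_op_def[of _ _ _ i] perm_op_def[of u \<tau> f] scale_scale XD scale_1)
    qed
    then show ?thesis using ip_perm_op[OF f perm_op_in[OF f], of u u] by (simp add: mnorm_def)
  qed
  then show ?thesis unfolding lin_op_def
    by (auto simp: perm_op_in intro!: exI[of _ 1])
       (auto simp: perm_op_def fun_eq_iff scale_plus scale_scale XD mult.commute)
qed

end

lemma perm_op_ops:
  assumes "\<And>i. i \<in> I \<Longrightarrow> \<tau> i \<in> I \<and> \<tau>' (\<tau> i) = i" "\<And>i. i \<in> I \<Longrightarrow> \<tau>' i \<in> I \<and> \<tau> (\<tau>' i) = i"
    and "\<And>i. i \<in> I \<Longrightarrow> cmod (u i) = 1"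
  shows "(perm_op u \<tau>, perm_op (\<lambda>i. cnj (u (\<tau>' i))) \<tau>') \<in> ops"
  unfolding ops_def using assms
  by (auto intro!: lin_op_perm_op[of \<tau> \<tau>'] lin_op_perm_op[of \<tau>' \<tau>] ip_perm_op)

definition left_op :: "'a \<Rightarrow> ('i \<Rightarrow> 'a) \<Rightarrow> 'i \<Rightarrow> 'a" where
  "left_op a f i = (if f \<in> X then a \<otimes> f i else \<zero>)"

lemma left_op_ops:
  assumes a: "a \<in> carrier A" shows "(left_op a, left_op (adj A a)) \<in> ops"
proof -
  have *: "lin_op (left_op a)" if a: "a \<in> carrier A" for a
  proof -
    have e: "left_op a f = (\<lambda>i. a \<otimes> f i)" if "f \<in> X" for f using that by (auto simp: left_op_def)
    show ?thesis unfolding lin_op_def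
    proof (intro conjI)
      show "\<exists>K\<ge>0. \<forall>f\<in>X. mnorm (left_op a f) \<le> K * mnorm f"
        using a by (intro exI[of _ "cnorm A a"]) (auto simp: e mnorm_left)
    qed (use a in \<open>auto simp: e XD mult_plus mult_scale\<close>, auto simp: left_op_def)
  qed
  have "ip (left_op a f) h = ip f (left_op (adj A a) h)" if "f \<in> X" "h \<in> X" for f h
    using ip_left_mult[OF that a] that by (simp add: left_op_def[abs_def])
  then show ?thesis using a by (auto simp: ops_def *)
qed

end

section \<open>Completion\<close>

context pre_cstar begin

definition Cauchy_seqs :: "(nat \<Rightarrow> 'a) set" where
  "Cauchy_seqs = {X. (\<forall>n. X n \<in> carrier A) \<and>
    (\<forall>e>0. \<exists>N. \<forall>m\<ge>N. \<forall>n\<ge>N. cnorm A (X m \<ominus> X n) < e)}"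

definition seq_class :: "(nat \<Rightarrow> 'a) \<Rightarrow> (nat \<Rightarrow> 'a) set" where
  "seq_class X = {Y \<in> Cauchy_seqs. (\<lambda>n. cnorm A (X n \<ominus> Y n)) \<longlonglongrightarrow> 0}"

definition seq_rep :: "(nat \<Rightarrow> 'a) set \<Rightarrow> nat \<Rightarrow> 'a" where
  "seq_rep c = (SOME X. X \<in> c)"

text \<open>The operations act on chosen representatives of classes of Cauchy sequences. The lemmas
  \<open>completion_plus\<close>, \<open>completion_scale\<close>, \<open>completion_adj\<close> and
  \<open>completion_mult\<close> free them from the choice, and \<open>completion_norm\<close> does
  the same for the norm.\<close>

definition completion :: "(nat \<Rightarrow> 'a) set cstar" where
  "completion = \<lparr>
    carrier = seq_class ` Cauchy_seqs,
    mult = (\<lambda>x y. seq_class (\<lambda>n. seq_rep x n \<otimes> seq_rep y n)),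
    one = seq_class (\<lambda>n. \<zero>),
    zero = seq_class (\<lambda>n. \<zero>),
    add = (\<lambda>x y. seq_class (\<lambda>n. seq_rep x n \<oplus> seq_rep y n)),
    scale = (\<lambda>z x. seq_class (\<lambda>n. scale A z (seq_rep x n))),
    adj = (\<lambda>x. seq_class (\<lambda>n. adj A (seq_rep x n))),
    cnorm = (\<lambda>x. lim (\<lambda>n. cnorm A (seq_rep x n)))\<rparr>"

lemma neg_zero: "\<ominus> \<zero> = \<zero>"
  by (rule minus_equality) auto

lemma Cauchy_seqsD: "X \<in> Cauchy_seqs \<Longrightarrow> X n \<in> carrier A"
  "X \<in> Cauchy_seqs \<Longrightarrow> e > 0 \<Longrightarrow> \<exists>N. \<forall>m\<ge>N. \<forall>n\<ge>N. cnorm A (X m \<ominus> X n) < e"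
  by (auto simp: Cauchy_seqs_def)

lemma seq_class_eq:
  assumes X: "X \<in> Cauchy_seqs" and Y: "Y \<in> Cauchy_seqs" and "(\<lambda>n. cnorm A (X n \<ominus> Y n)) \<longlonglongrightarrow> 0"
  shows "seq_class X = seq_class Y"
proof -
  have *: "(\<lambda>n. cnorm A (Y n \<ominus> Z n)) \<longlonglongrightarrow> 0"
    if c: "X \<in> Cauchy_seqs" "Y \<in> Cauchy_seqs" "Z \<in> Cauchy_seqs"
      and l: "(\<lambda>n. cnorm A (X n \<ominus> Y n)) \<longlonglongrightarrow> 0" "(\<lambda>n. cnorm A (X n \<ominus> Z n)) \<longlonglongrightarrow> 0" for X Y Z
  proof (rule tendsto_sandwich[OF _ _ tendsto_const])
    show "(\<lambda>n. cnorm A (X n \<ominus> Y n) + cnorm A (X n \<ominus> Z n)) \<longlonglongrightarrow> 0"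
      using tendsto_add[OF l] by simp
    have "cnorm A (Y n \<ominus> Z n) \<le> cnorm A (X n \<ominus> Y n) + cnorm A (X n \<ominus> Z n)" for n
      using norm_triangle[of "Y n" "X n" "Z n"] norm_minus_commute[of "X n" "Y n"] c
      by (simp add: Cauchy_seqsD)
    then show "\<forall>\<^sub>F n in sequentially. cnorm A (Y n \<ominus> Z n) \<le> cnorm A (X n \<ominus> Y n) + cnorm A (X n \<ominus> Z n)"
      by simp
  qed (use c in \<open>simp add: Cauchy_seqsD\<close>)
  have sym: "(\<lambda>n. cnorm A (Y n \<ominus> X n)) \<longlonglongrightarrow> 0"
    using assms(3) norm_minus_commute[of "X _" "Y _"] X Y by (simp add: Cauchy_seqsD)
  show ?thesis unfolding seq_class_def using *[OF X Y _ assms(3)] *[OF Y X _ sym] by blast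
qed

lemma seq_rep:
  assumes X: "X \<in> Cauchy_seqs"
  shows "seq_rep (seq_class X) \<in> Cauchy_seqs" "(\<lambda>n. cnorm A (X n \<ominus> seq_rep (seq_class X) n)) \<longlonglongrightarrow> 0"
    "seq_rep (seq_class X) n \<in> carrier A"
proof -
  have "X \<in> seq_class X" using X by (simp add: seq_class_def Cauchy_seqsD a_minus_def r_neg)
  then have r: "seq_rep (seq_class X) \<in> seq_class X" unfolding seq_rep_def by (rule someI[of "\<lambda>Y. Y \<in> seq_class X"])
  then show "seq_rep (seq_class X) \<in> Cauchy_seqs" "(\<lambda>n. cnorm A (X n \<ominus> seq_rep (seq_class X) n)) \<longlonglongrightarrow> 0"
    by (simp_all add: seq_class_def)
  with r show "seq_rep (seq_class X) n \<in> carrier A" by (simp add: Cauchy_seqsD)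
qed

lemma Cauchy_norm:
  assumes X: "X \<in> Cauchy_seqs" shows "convergent (\<lambda>n. cnorm A (X n))"
proof -
  have "Cauchy (\<lambda>n. cnorm A (X n))"
    unfolding Cauchy_def dist_real_def
  proof (intro allI impI)
    fix e :: real assume "e > 0"
    then obtain N where "\<forall>m\<ge>N. \<forall>n\<ge>N. cnorm A (X m \<ominus> X n) < e" using Cauchy_seqsD(2)[OF X] by blast
    then show "\<exists>M. \<forall>m\<ge>M. \<forall>n\<ge>M. \<bar>cnorm A (X m) - cnorm A (X n)\<bar> < e"
      using norm_diff_abs Cauchy_seqsD(1)[OF X] by (meson le_less_trans)
  qed
  then show ?thesis by (simp add: Cauchy_convergent_iff)
qed

lemma completion_norm:
  assumes X: "X \<in> Cauchy_seqs" shows "(\<lambda>n. cnorm A (X n)) \<longlonglongrightarrow> cnorm completion (seq_class X)"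
proof -
  let ?R = "seq_rep (seq_class X)"
  have R: "(\<lambda>n. cnorm A (?R n)) \<longlonglongrightarrow> cnorm completion (seq_class X)"
    using Cauchy_norm[OF seq_rep(1)[OF X]] by (simp add: completion_def convergent_LIMSEQ_iff)
  have "(\<lambda>n. cnorm A (X n) - cnorm A (?R n)) \<longlonglongrightarrow> 0"
    by (rule metric_tendsto_imp_tendsto[OF seq_rep(2)[OF X]])
       (use X seq_rep(3)[OF X] norm_diff_abs in \<open>auto simp: dist_real_def Cauchy_seqsD\<close>)
  from tendsto_add[OF this R] show ?thesis by simp
qed

lemma Cauchy_plus:
  assumes X: "X \<in> Cauchy_seqs" and Y: "Y \<in> Cauchy_seqs" shows "(\<lambda>n. X n \<oplus> Y n) \<in> Cauchy_seqs"
  unfolding Cauchy_seqs_def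
proof (intro CollectI conjI allI impI)
  fix e :: real assume "e > 0"
  then have e: "e/2 > 0" by simp
  obtain N M where N: "\<forall>m\<ge>N. \<forall>n\<ge>N. cnorm A (X m \<ominus> X n) < e/2"
    and M: "\<forall>m\<ge>M. \<forall>n\<ge>M. cnorm A (Y m \<ominus> Y n) < e/2"
    using Cauchy_seqsD(2)[OF X e] Cauchy_seqsD(2)[OF Y e] by blast
  have "cnorm A (X m \<oplus> Y m \<ominus> (X n \<oplus> Y n)) < e" if "m \<ge> max N M" "n \<ge> max N M" for m n
  proof -
    have "cnorm A (X m \<ominus> X n) < e/2" "cnorm A (Y m \<ominus> Y n) < e/2" using N M that by auto
    then show ?thesis
      using norm_diff_plus[of "X m" "Y m" "X n" "Y n"] X Y by (simp add: Cauchy_seqsD)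
  qed
  then show "\<exists>N. \<forall>m\<ge>N. \<forall>n\<ge>N. cnorm A (X m \<oplus> Y m \<ominus> (X n \<oplus> Y n)) < e" by blast
qed (use X Y in \<open>simp add: Cauchy_seqsD\<close>)

lemma Cauchy_lipschitz:
  assumes X: "X \<in> Cauchy_seqs" and \<phi>: "\<And>x. x \<in> carrier A \<Longrightarrow> \<phi> x \<in> carrier A"
    and K: "\<And>x y. x \<in> carrier A \<Longrightarrow> y \<in> carrier A \<Longrightarrow> cnorm A (\<phi> x \<ominus> \<phi> y) \<le> K * cnorm A (x \<ominus> y)"
      "0 \<le> K"
  shows "(\<lambda>n. \<phi> (X n)) \<in> Cauchy_seqs"
  unfolding Cauchy_seqs_def
proof (intro CollectI conjI allI impI)
  fix e :: real assume e: "e > 0"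
  then have "e / (K + 1) > 0" using K by simp
  then obtain N where N: "\<forall>m\<ge>N. \<forall>n\<ge>N. cnorm A (X m \<ominus> X n) < e / (K + 1)"
    using Cauchy_seqsD(2)[OF X] by blast
  have "cnorm A (\<phi> (X m) \<ominus> \<phi> (X n)) < e" if mn: "m \<ge> N" "n \<ge> N" for m n
  proof -
    have "cnorm A (\<phi> (X m) \<ominus> \<phi> (X n)) \<le> K * cnorm A (X m \<ominus> X n)" using X by (intro K) (simp_all add: Cauchy_seqsD)
    also have "\<dots> \<le> K * (e / (K + 1))" using N mn K by (intro mult_left_mono) (auto intro: less_imp_le)
    also have "\<dots> < e" using e K by (simp add: field_simps)
    finally show ?thesis .
  qed
  then show "\<exists>N. \<forall>m\<ge>N. \<forall>n\<ge>N. cnorm A (\<phi> (X m) \<ominus> \<phi> (X n)) < e" by blast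
qed (use X \<phi> in \<open>simp add: Cauchy_seqsD\<close>)

lemma Cauchy_scale: "X \<in> Cauchy_seqs \<Longrightarrow> (\<lambda>n. scale A z (X n)) \<in> Cauchy_seqs"
  by (rule Cauchy_lipschitz[where K = "cmod z"]) (simp_all add: scale_minus[symmetric] norm_scale)

lemma Cauchy_adj: "X \<in> Cauchy_seqs \<Longrightarrow> (\<lambda>n. adj A (X n)) \<in> Cauchy_seqs"
  by (rule Cauchy_lipschitz[where K = 1]) (simp_all add: adj_minus[symmetric])

lemma Cauchy_bounded:
  assumes X: "X \<in> Cauchy_seqs" obtains K where "K > 0" "\<And>n. cnorm A (X n) \<le> K"
proof -
  have "Bseq (\<lambda>n. cnorm A (X n))" using Cauchy_norm[OF X] by (rule convergent_imp_Bseq)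
  then obtain K where "K > 0" "\<And>n. \<bar>cnorm A (X n)\<bar> \<le> K" by (auto elim: BseqE)
  then show ?thesis using that[of K] by (meson abs_le_D1)
qed

lemma Cauchy_mult:
  assumes X: "X \<in> Cauchy_seqs" and Y: "Y \<in> Cauchy_seqs" shows "(\<lambda>n. X n \<otimes> Y n) \<in> Cauchy_seqs"
  unfolding Cauchy_seqs_def
proof (intro CollectI conjI allI impI)
  fix e :: real assume "e > 0"
  obtain K where K: "K > 0" "\<And>n. cnorm A (X n) \<le> K" using Cauchy_bounded[OF X] by blast
  obtain L where L: "L > 0" "\<And>n. cnorm A (Y n) \<le> L" using Cauchy_bounded[OF Y] by blast
  have e: "e / (2 * K) > 0" "e / (2 * L) > 0" using \<open>e > 0\<close> K L by simp_all
  obtain N M where N: "\<forall>m\<ge>N. \<forall>n\<ge>N. cnorm A (X m \<ominus> X n) < e / (2 * L)"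
    and M: "\<forall>m\<ge>M. \<forall>n\<ge>M. cnorm A (Y m \<ominus> Y n) < e / (2 * K)"
    using Cauchy_seqsD(2)[OF X e(2)] Cauchy_seqsD(2)[OF Y e(1)] by blast
  have "cnorm A (X m \<otimes> Y m \<ominus> X n \<otimes> Y n) < e" if "m \<ge> max N M" "n \<ge> max N M" for m n
  proof -
    have lt: "cnorm A (X m \<ominus> X n) < e / (2 * L)" "cnorm A (Y m \<ominus> Y n) < e / (2 * K)" using N M that by auto
    have "cnorm A (X m \<otimes> Y m \<ominus> X n \<otimes> Y n)
        \<le> cnorm A (X m) * cnorm A (Y m \<ominus> Y n) + cnorm A (X m \<ominus> X n) * cnorm A (Y n)"
      using X Y by (intro norm_diff_mult) (simp_all add: Cauchy_seqsD)
    also have "\<dots> \<le> K * cnorm A (Y m \<ominus> Y n) + cnorm A (X m \<ominus> X n) * L"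
      using X Y K L by (intro add_mono mult_right_mono mult_left_mono) (simp_all add: Cauchy_seqsD)
    also have "\<dots> < K * (e / (2 * K)) + (e / (2 * L)) * L"
      using lt K L by (intro add_strict_mono mult_strict_left_mono mult_strict_right_mono) auto
    also have "\<dots> = e" using K L by simp
    finally show ?thesis .
  qed
  then show "\<exists>N. \<forall>m\<ge>N. \<forall>n\<ge>N. cnorm A (X m \<otimes> Y m \<ominus> X n \<otimes> Y n) < e" by blast
qed (use X Y in \<open>simp add: Cauchy_seqsD\<close>)

lemma Cauchy_const: "a \<in> carrier A \<Longrightarrow> (\<lambda>n. a) \<in> Cauchy_seqs"
  by (auto simp: Cauchy_seqs_def a_minus_def r_neg)

lemma completion_carrier: "carrier completion = seq_class ` Cauchy_seqs"
  "\<zero>\<^bsub>completion\<^esub> = seq_class (\<lambda>n. \<zero>)"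
  by (simp_all add: completion_def)

lemma completion_plus:
  assumes X: "X \<in> Cauchy_seqs" and Y: "Y \<in> Cauchy_seqs"
  shows "seq_class X \<oplus>\<^bsub>completion\<^esub> seq_class Y = seq_class (\<lambda>n. X n \<oplus> Y n)"
proof -
  let ?R = "seq_rep (seq_class X)" and ?S = "seq_rep (seq_class Y)"
  have "(\<lambda>n. cnorm A (X n \<oplus> Y n \<ominus> (?R n \<oplus> ?S n))) \<longlonglongrightarrow> 0"
  proof (rule tendsto_sandwich[OF _ _ tendsto_const])
    show "(\<lambda>n. cnorm A (X n \<ominus> ?R n) + cnorm A (Y n \<ominus> ?S n)) \<longlonglongrightarrow> 0"
      using tendsto_add[OF seq_rep(2)[OF X] seq_rep(2)[OF Y]] by simp
  qed (use X Y seq_rep(3)[OF X] seq_rep(3)[OF Y] norm_diff_plus in \<open>simp_all add: Cauchy_seqsD\<close>)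
  then have "seq_class (\<lambda>n. X n \<oplus> Y n) = seq_class (\<lambda>n. ?R n \<oplus> ?S n)"
    using X Y by (intro seq_class_eq Cauchy_plus seq_rep(1))
  then show ?thesis by (simp add: completion_def)
qed

lemma completion_scale:
  assumes X: "X \<in> Cauchy_seqs"
  shows "scale completion z (seq_class X) = seq_class (\<lambda>n. scale A z (X n))"
proof -
  let ?R = "seq_rep (seq_class X)"
  have "(\<lambda>n. cnorm A (scale A z (X n) \<ominus> scale A z (?R n))) \<longlonglongrightarrow> 0"
    using tendsto_mult_left[OF seq_rep(2)[OF X], of "cmod z"] X seq_rep(3)[OF X]
    by (simp add: scale_minus[symmetric] norm_scale Cauchy_seqsD)
  then have "seq_class (\<lambda>n. scale A z (X n)) = seq_class (\<lambda>n. scale A z (?R n))"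
    using X by (intro seq_class_eq Cauchy_scale seq_rep(1))
  then show ?thesis by (simp add: completion_def)
qed

lemma completion_adj:
  assumes X: "X \<in> Cauchy_seqs"
  shows "adj completion (seq_class X) = seq_class (\<lambda>n. adj A (X n))"
proof -
  let ?R = "seq_rep (seq_class X)"
  have "(\<lambda>n. cnorm A (adj A (X n) \<ominus> adj A (?R n))) \<longlonglongrightarrow> 0"
    using seq_rep(2)[OF X] X seq_rep(3)[OF X] by (simp add: adj_minus[symmetric] Cauchy_seqsD)
  then have "seq_class (\<lambda>n. adj A (X n)) = seq_class (\<lambda>n. adj A (?R n))"
    using X by (intro seq_class_eq Cauchy_adj seq_rep(1))
  then show ?thesis by (simp add: completion_def)
qed

lemma completion_mult:
  assumes X: "X \<in> Cauchy_seqs" and Y: "Y \<in> Cauchy_seqs"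
  shows "seq_class X \<otimes>\<^bsub>completion\<^esub> seq_class Y = seq_class (\<lambda>n. X n \<otimes> Y n)"
proof -
  let ?R = "seq_rep (seq_class X)" and ?S = "seq_rep (seq_class Y)"
  have "(\<lambda>n. cnorm A (X n \<otimes> Y n \<ominus> ?R n \<otimes> ?S n)) \<longlonglongrightarrow> 0"
  proof (rule tendsto_sandwich[OF _ _ tendsto_const])
    show "(\<lambda>n. cnorm A (X n) * cnorm A (Y n \<ominus> ?S n) + cnorm A (X n \<ominus> ?R n) * cnorm A (?S n)) \<longlonglongrightarrow> 0"
      using tendsto_add[OF tendsto_mult[OF completion_norm[OF X] seq_rep(2)[OF Y]]
        tendsto_mult[OF seq_rep(2)[OF X] completion_norm[OF seq_rep(1)[OF Y]]]] by simp
  qed (use X Y seq_rep(3)[OF X] seq_rep(3)[OF Y] norm_diff_mult in \<open>simp_all add: Cauchy_seqsD\<close>)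
  then have "seq_class (\<lambda>n. X n \<otimes> Y n) = seq_class (\<lambda>n. ?R n \<otimes> ?S n)"
    using X Y by (intro seq_class_eq Cauchy_mult seq_rep(1))
  then show ?thesis by (simp add: completion_def)
qed

text \<open>Algebraic identities hold termwise on Cauchy sequences. Norm inequalities and the
  C*-identity pass to the limit, since \<open>completion_norm\<close> computes the norm along any
  representative.\<close>

lemma pre_cstar_completion: "pre_cstar completion"
proof -
  note ops = completion_plus completion_mult completion_scale completion_adj
  note cs = Cauchy_plus Cauchy_mult Cauchy_scale Cauchy_adj Cauchy_const
  note cd = Cauchy_seqsD(1)
  interpret K: abelian_group completion
  proof (rule abelian_groupI, unfold completion_carrier)
    fix x assume "x \<in> seq_class ` Cauchy_seqs"
    then obtain X where X: "X \<in> Cauchy_seqs" "x = seq_class X" by blast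
    then have "scale completion (- 1) x \<oplus>\<^bsub>completion\<^esub> x = seq_class (\<lambda>n. \<zero>)"
      by (simp add: ops cs) (simp add: cd scale_minus_one l_neg)
    then show "\<exists>y\<in>seq_class ` Cauchy_seqs. y \<oplus>\<^bsub>completion\<^esub> x = seq_class (\<lambda>n. \<zero>)"
      using X by (intro bexI[of _ "scale completion (- 1) x"]) (auto simp: ops cs)
  qed (auto simp: ops cs cd a_ac)
  show ?thesis
  proof (unfold_locales, unfold completion_carrier, goal_cases)
    case (6 x y)
    then obtain X Y where X: "X \<in> Cauchy_seqs" "x = seq_class X" and Y: "Y \<in> Cauchy_seqs" "y = seq_class Y"
      by blast
    show ?case
      unfolding X(2) Y(2) completion_plus[OF X(1) Y(1)]
      by (rule LIMSEQ_le[OF completion_norm tendsto_add[OF completion_norm completion_norm]])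
         (use X Y norm_plus in \<open>auto simp: cs cd\<close>)
  next
    case (7 x z)
    then obtain X where X: "X \<in> Cauchy_seqs" "x = seq_class X" by blast
    have "(\<lambda>n. cnorm A (scale A z (X n))) \<longlonglongrightarrow> cmod z * cnorm completion (seq_class X)"
      using tendsto_mult_left[OF completion_norm[OF X(1)], of "cmod z"] X by (simp add: norm_scale cd)
    from LIMSEQ_unique[OF completion_norm[OF Cauchy_scale[OF X(1)]] this] show ?case
      using X by (simp add: ops)
  next
    case (19 x y)
    then obtain X Y where X: "X \<in> Cauchy_seqs" "x = seq_class X" and Y: "Y \<in> Cauchy_seqs" "y = seq_class Y"
      by blast
    show ?case
      unfolding X(2) Y(2) completion_mult[OF X(1) Y(1)]
      by (rule LIMSEQ_le[OF completion_norm tendsto_mult[OF completion_norm completion_norm]])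
         (use X Y norm_mult in \<open>auto simp: cs cd\<close>)
  next
    case (20 x)
    then obtain X where X: "X \<in> Cauchy_seqs" "x = seq_class X" by blast
    have "(\<lambda>n. cnorm A (adj A (X n) \<otimes> X n)) \<longlonglongrightarrow> (cnorm completion (seq_class X))\<^sup>2"
      using tendsto_power[OF completion_norm[OF X(1)], of 2] X by (simp add: cstar_identity cd)
    from LIMSEQ_unique[OF completion_norm[OF Cauchy_mult[OF Cauchy_adj[OF X(1)] X(1)]] this] show ?case
      using X by (simp add: ops cs)
  qed (auto simp: ops cs cd scale_1 scale_scale scale_plus plus_scale mult_plus plus_mult mult_assoc
      scale_mult mult_scale adj_adj adj_plus adj_scale adj_mult)
qed

lemma completion_minus:
  assumes X: "X \<in> Cauchy_seqs" and Y: "Y \<in> Cauchy_seqs"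
  shows "seq_class X \<ominus>\<^bsub>completion\<^esub> seq_class Y = seq_class (\<lambda>n. X n \<ominus> Y n)"
proof -
  interpret K: pre_cstar completion by (rule pre_cstar_completion)
  have "seq_class Y \<in> carrier completion" using Y by (simp add: completion_carrier)
  then show ?thesis using X Y
    by (simp add: a_minus_def K.scale_minus_one[symmetric] completion_scale completion_plus Cauchy_scale)
       (simp add: scale_minus_one Cauchy_seqsD)
qed

definition embed :: "'a \<Rightarrow> (nat \<Rightarrow> 'a) set" where "embed a = seq_class (\<lambda>n. a)"

lemma embed_in: "a \<in> carrier A \<Longrightarrow> embed a \<in> carrier completion"
  by (simp add: embed_def completion_carrier Cauchy_const)

lemma embed_hom: "cstar_hom A completion embed"
  unfolding cstar_hom_def using embed_in
  by (auto simp: embed_def completion_plus completion_mult completion_scale completion_adj Cauchy_const)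

lemma embed_norm: "a \<in> carrier A \<Longrightarrow> cnorm completion (embed a) = cnorm A a"
  using LIMSEQ_unique[OF completion_norm[OF Cauchy_const] tendsto_const] by (auto simp: embed_def)

lemma embed_minus: "a \<in> carrier A \<Longrightarrow> b \<in> carrier A \<Longrightarrow> embed a \<ominus>\<^bsub>completion\<^esub> embed b = embed (a \<ominus> b)"
  by (simp add: embed_def completion_minus Cauchy_const)

lemma embed_approx:
  assumes x: "x \<in> carrier completion" and e: "e > 0"
  obtains a where "a \<in> carrier A" "cnorm completion (x \<ominus>\<^bsub>completion\<^esub> embed a) \<le> e"
proof -
  obtain X where X: "X \<in> Cauchy_seqs" "x = seq_class X" using x by (auto simp: completion_carrier)
  obtain N where N: "\<forall>m\<ge>N. \<forall>n\<ge>N. cnorm A (X m \<ominus> X n) < e" using Cauchy_seqsD(2)[OF X(1) e] by blast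
  let ?Y = "\<lambda>n. X n \<ominus> X N"
  have XN: "X N \<in> carrier A" using X by (simp add: Cauchy_seqsD)
  have "?Y \<in> Cauchy_seqs"
    using Cauchy_plus[OF X(1) Cauchy_const[of "\<ominus> X N"]] XN by (simp add: a_minus_def)
  from completion_norm[OF this] have "cnorm completion (seq_class ?Y) \<le> e"
    by (rule LIMSEQ_le_const2) (use N in \<open>auto intro: less_imp_le\<close>)
  then show ?thesis using that[of "X N"] XN X by (simp add: embed_def completion_minus Cauchy_const)
qed

text \<open>Given a Cauchy sequence \<open>Y\<close> of classes, choose \<open>Z n\<close> in
  \<open>A\<close> within \<open>1 / (n + 1)\<close> of \<open>Y n\<close>. Then \<open>Z\<close> is
  a Cauchy sequence in \<open>A\<close>, and its own class is the limit of \<open>Y\<close>.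
  Definiteness holds because null sequences have been divided out.\<close>

lemma cstar_completion: "cstar_algebra completion"
proof -
  interpret K: pre_cstar completion by (rule pre_cstar_completion)
  let ?K = completion
  have eq0: "cnorm ?K x = 0 \<longleftrightarrow> x = \<zero>\<^bsub>?K\<^esub>" if x: "x \<in> carrier ?K" for x
  proof
    assume 0: "cnorm ?K x = 0"
    obtain X where X: "X \<in> Cauchy_seqs" "x = seq_class X" using x by (auto simp: completion_carrier)
    then have "(\<lambda>n. cnorm A (X n \<ominus> \<zero>)) \<longlonglongrightarrow> 0"
      using completion_norm[OF X(1)] 0 by (simp add: a_minus_def Cauchy_seqsD neg_zero)
    then show "x = \<zero>\<^bsub>?K\<^esub>" using seq_class_eq[OF X(1) Cauchy_const] X by (simp add: completion_carrier)
  qed simp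
  have complete: "\<exists>x\<in>carrier ?K. (\<lambda>n. cnorm ?K (Y n \<oplus>\<^bsub>?K\<^esub> scale ?K (- 1) x)) \<longlonglongrightarrow> 0"
    if Y: "\<forall>n. Y n \<in> carrier ?K"
      and C: "\<forall>e>0. \<exists>N. \<forall>m\<ge>N. \<forall>n\<ge>N. cnorm ?K (Y m \<oplus>\<^bsub>?K\<^esub> scale ?K (- 1) (Y n)) < e" for Y
  proof -
    have d: "u \<oplus>\<^bsub>?K\<^esub> scale ?K (- 1) v = u \<ominus>\<^bsub>?K\<^esub> v" if "v \<in> carrier ?K" for u v
      using that by (simp add: a_minus_def K.scale_minus_one)
    have "\<exists>a. a \<in> carrier A \<and> cnorm ?K (Y n \<ominus>\<^bsub>?K\<^esub> embed a) \<le> inverse (real (Suc n))" for n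
      using embed_approx[of "Y n" "inverse (real (Suc n))"] Y by (metis inverse_positive_iff_positive of_nat_0_less_iff zero_less_Suc)
    then obtain Z where Z: "\<And>n. Z n \<in> carrier A" "\<And>n. cnorm ?K (Y n \<ominus>\<^bsub>?K\<^esub> embed (Z n)) \<le> inverse (real (Suc n))"
      by metis
    have ZK: "embed (Z n) \<in> carrier ?K" for n using Z by (simp add: embed_in)
    have Yc: "Y n \<in> carrier ?K" for n using Y by simp
    have inv: "(\<lambda>n. inverse (real (Suc n))) \<longlonglongrightarrow> 0" by (rule LIMSEQ_inverse_real_of_nat)
    have "Z \<in> Cauchy_seqs" unfolding Cauchy_seqs_def
    proof (intro CollectI conjI allI impI Z)
      fix e :: real assume "e > 0"
      then have e: "e/3 > 0" by simp
      obtain N where N: "\<And>m n. m \<ge> N \<Longrightarrow> n \<ge> N \<Longrightarrow> cnorm ?K (Y m \<ominus>\<^bsub>?K\<^esub> Y n) < e/3"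
        using C e d[OF Yc] by metis
      obtain M where M: "\<And>n. n \<ge> M \<Longrightarrow> inverse (real (Suc n)) < e/3"
        using order_tendstoD(2)[OF inv e] by (auto simp: eventually_sequentially)
      have "cnorm A (Z m \<ominus> Z n) < e" if mn: "m \<ge> max N M" "n \<ge> max N M" for m n
      proof -
        have "cnorm A (Z m \<ominus> Z n) = cnorm ?K (embed (Z m) \<ominus>\<^bsub>?K\<^esub> embed (Z n))"
          using Z by (simp add: embed_minus embed_norm)
        also have "\<dots> \<le> cnorm ?K (embed (Z m) \<ominus>\<^bsub>?K\<^esub> Y m) + cnorm ?K (Y m \<ominus>\<^bsub>?K\<^esub> embed (Z n))"
          using ZK Yc by (intro K.norm_triangle)
        also have "\<dots> \<le> cnorm ?K (Y m \<ominus>\<^bsub>?K\<^esub> embed (Z m)) + (cnorm ?K (Y m \<ominus>\<^bsub>?K\<^esub> Y n)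
            + cnorm ?K (Y n \<ominus>\<^bsub>?K\<^esub> embed (Z n)))"
          using ZK Yc K.norm_triangle[of "Y m" "Y n" "embed (Z n)"] K.norm_minus_commute[of "Y m"] by simp
        also have "\<dots> < e" using Z(2)[of m] Z(2)[of n] N[of m n] M[of m] M[of n] mn by simp
        finally show ?thesis .
      qed
      then show "\<exists>N. \<forall>m\<ge>N. \<forall>n\<ge>N. cnorm A (Z m \<ominus> Z n) < e" by blast
    qed
    define x where "x = seq_class Z"
    have x: "x \<in> carrier ?K" using \<open>Z \<in> Cauchy_seqs\<close> by (simp add: x_def completion_carrier)
    have "(\<lambda>n. cnorm ?K (Y n \<ominus>\<^bsub>?K\<^esub> x)) \<longlonglongrightarrow> 0"
    proof (rule LIMSEQ_I)
      fix e :: real assume "e > 0"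
      then have e: "e/3 > 0" by simp
      obtain N where N: "\<forall>m\<ge>N. \<forall>n\<ge>N. cnorm A (Z m \<ominus> Z n) < e/3"
        using Cauchy_seqsD(2)[OF \<open>Z \<in> Cauchy_seqs\<close> e] by blast
      obtain M where M: "\<And>n. n \<ge> M \<Longrightarrow> inverse (real (Suc n)) < e/3"
        using order_tendstoD(2)[OF inv e] by (auto simp: eventually_sequentially)
      have "norm (cnorm ?K (Y m \<ominus>\<^bsub>?K\<^esub> x) - 0) < e" if m: "m \<ge> max N M" for m
      proof -
        have "(\<lambda>n. Z m \<ominus> Z n) \<in> Cauchy_seqs"
          using Cauchy_plus[OF Cauchy_const[OF Z(1)] Cauchy_scale[OF \<open>Z \<in> Cauchy_seqs\<close>, of "- 1"]] Z(1)
          by (simp add: scale_minus_one a_minus_def)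
        from completion_norm[OF this] have "cnorm ?K (seq_class (\<lambda>n. Z m \<ominus> Z n)) \<le> e/3"
          by (rule LIMSEQ_le_const2) (use N m in \<open>auto intro!: exI[of _ N] less_imp_le\<close>)
        then have "cnorm ?K (embed (Z m) \<ominus>\<^bsub>?K\<^esub> x) \<le> e/3"
          using Z(1) \<open>Z \<in> Cauchy_seqs\<close> by (simp add: embed_def x_def completion_minus Cauchy_const)
        then have "cnorm ?K (Y m \<ominus>\<^bsub>?K\<^esub> x) < e"
          using K.norm_triangle[OF Yc ZK x, of m m] Z(2)[of m] M[of m] m \<open>e > 0\<close> by simp
        then show ?thesis using K.norm_nonneg[of "Y m \<ominus>\<^bsub>?K\<^esub> x"] Yc x by simp
      qed
      then show "\<exists>no. \<forall>n\<ge>no. norm (cnorm ?K (Y n \<ominus>\<^bsub>?K\<^esub> x) - 0) < e" by blast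
    qed
    then show ?thesis using x by (intro bexI[of _ x]) (simp_all add: d)
  qed
  show ?thesis
  proof (unfold_locales, goal_cases)
    case (15 Y)
    then show ?case by (rule complete)
  qed (simp_all add: K.scale_1 K.scale_scale K.scale_plus K.plus_scale K.mult_plus K.plus_mult
        K.mult_assoc K.scale_mult K.mult_scale K.adj_adj K.adj_plus K.adj_scale K.adj_mult
        K.a_ac K.scale_minus_one K.l_neg K.r_neg K.norm_plus K.norm_scale K.norm_mult
        K.cstar_identity eq0)
qed

end

section \<open>Generated C*-algebras on the test type\<close>

text \<open>The copy of a subalgebra \<open>S\<close> on another type along an injection. It carries
  generated C*-algebras to the test types, where the universal properties can be applied.\<close>

definition transport :: "'a cstar \<Rightarrow> 'a set \<Rightarrow> ('a \<Rightarrow> 'b) \<Rightarrow> 'b cstar" where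
  "transport A S \<iota> = (let j = inv_into S \<iota> in \<lparr>
    carrier = \<iota> ` S,
    mult = (\<lambda>x y. \<iota> (j x \<otimes>\<^bsub>A\<^esub> j y)),
    one = \<iota> \<zero>\<^bsub>A\<^esub>,
    zero = \<iota> \<zero>\<^bsub>A\<^esub>,
    add = (\<lambda>x y. \<iota> (j x \<oplus>\<^bsub>A\<^esub> j y)),
    scale = (\<lambda>z x. \<iota> (scale A z (j x))),
    adj = (\<lambda>x. \<iota> (adj A (j x))),
    cnorm = (\<lambda>x. cnorm A (j x))\<rparr>)"

text \<open>Completeness of the copy is where closedness of \<open>S\<close> enters: the limit in
  \<open>A\<close> of a sequence from \<open>S\<close> stays in \<open>S\<close>. The remaining
  axioms are pulled back from \<open>A\<close> through the inverse of \<iota>.\<close>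

lemma (in cstar_algebra) transport:
  assumes S: "cstar_subalgebra A S" and inj: "inj_on \<iota> S"
  shows "cstar_algebra (transport A S \<iota>)" "cstar_hom (transport A S \<iota>) A (inv_into S \<iota>)"
    "inv_into S \<iota> ` carrier (transport A S \<iota>) = S" "inj_on (inv_into S \<iota>) (carrier (transport A S \<iota>))"
    "cnorm (transport A S \<iota>) e = cnorm A (inv_into S \<iota> e)"
proof -
  let ?E = "transport A S \<iota>"
  let ?j = "inv_into S \<iota>"
  have ss: "lin_subspace A S" "\<And>a b. a \<in> S \<Longrightarrow> b \<in> S \<Longrightarrow> a \<otimes> b \<in> S" "\<And>a. a \<in> S \<Longrightarrow> adj A a \<in> S"
      "norm_closure A S = S"
    using S by (auto simp: cstar_subalgebra_def)
  note sp = subspaceD[OF ss(1)]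
  have c: "a \<in> carrier A" if "a \<in> S" for a using sp(1) that by blast
  have neg: "\<ominus> a \<in> S" if "a \<in> S" for a
    using sp(4)[OF that, of "- 1"] c[OF that] by (simp add: scale_minus_one)
  have ji: "?j (\<iota> a) = a" if "a \<in> S" for a using inj that by (rule inv_into_f_f)
  have sel: "carrier ?E = \<iota> ` S" "x \<otimes>\<^bsub>?E\<^esub> y = \<iota> (?j x \<otimes> ?j y)" "\<zero>\<^bsub>?E\<^esub> = \<iota> \<zero>"
      "x \<oplus>\<^bsub>?E\<^esub> y = \<iota> (?j x \<oplus> ?j y)" "scale ?E z x = \<iota> (scale A z (?j x))" "adj ?E x = \<iota> (adj A (?j x))"
      "cnorm ?E x = cnorm A (?j x)" for x y z
    by (simp_all add: transport_def Let_def)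
  have complete: "\<exists>x\<in>carrier ?E. (\<lambda>n. cnorm ?E (Y n \<oplus>\<^bsub>?E\<^esub> scale ?E (- 1) x)) \<longlonglongrightarrow> 0"
    if Y: "\<forall>n. Y n \<in> carrier ?E"
      and C: "\<forall>e>0. \<exists>N. \<forall>m\<ge>N. \<forall>n\<ge>N. cnorm ?E (Y m \<oplus>\<^bsub>?E\<^esub> scale ?E (- 1) (Y n)) < e" for Y
  proof -
    have "\<forall>n. \<exists>a. a \<in> S \<and> Y n = \<iota> a" using Y by (auto simp: sel)
    then obtain a where a: "\<And>n. a n \<in> S" "\<And>n. Y n = \<iota> (a n)" by metis
    have d: "cnorm ?E (Y m \<oplus>\<^bsub>?E\<^esub> scale ?E (- 1) (\<iota> b)) = cnorm A (a m \<ominus> b)" if "b \<in> S" for m b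
      using that a sp(4)[OF that, of "- 1"] sp(3)[OF a(1) sp(4)[OF that, of "- 1"]]
      by (simp add: sel ji c) (simp add: a_minus_def scale_minus_one c)
    have "\<exists>N. \<forall>m\<ge>N. \<forall>n\<ge>N. cnorm A (a m \<ominus> a n) < e" if "e > 0" for e
      using C[rule_format, OF that] unfolding a(2) unfolding a(2)[symmetric] using d[OF a(1)] a(2) by simp
    then obtain b where b: "b \<in> carrier A" "(\<lambda>n. cnorm A (a n \<ominus> b)) \<longlonglongrightarrow> 0"
      by (rule complete'[OF c[OF a(1)]])
    have "b \<in> S" using limit_in_closure[OF sp(1) a(1) b] ss(4) by simp
    then show ?thesis using b(2) by (intro bexI[of _ "\<iota> b"]) (simp_all only: d sel(1) imageI)
  qed
  show "cstar_algebra ?E"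
  proof (unfold_locales, goal_cases)
    case (15 Y)
    then show ?case by (rule complete)
  next
    case (12 x)
    then show ?case using sp(2) by (auto simp: sel ji c nrm_eq_0)
  qed (auto simp: sel ji ss sp c scale_1 scale_scale scale_plus plus_scale mult_plus plus_mult
        mult_assoc scale_mult mult_scale adj_adj adj_plus adj_scale adj_mult
        a_ac norm_plus norm_scale norm_mult cstar_identity scale_minus_one l_neg r_neg neg)
  show "cnorm ?E e = cnorm A (?j e)" by (rule sel)
  show "cstar_hom ?E A ?j"
    unfolding cstar_hom_def using ss sp by (auto simp: sel ji c)
  show "?j ` carrier ?E = S" by (force simp: sel ji image_iff)
  show "inj_on ?j (carrier ?E)" unfolding sel using ji by (auto intro!: inj_onI)
qed

text \<open>The empty word has the junk value zero, since there need not be a unit.\<close>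

fun word_prod :: "'a cstar \<Rightarrow> 'x set \<Rightarrow> ('x \<Rightarrow> 'a) \<Rightarrow> ('x \<times> bool) list \<Rightarrow> 'a" where
  "word_prod A J x [] = \<zero>\<^bsub>A\<^esub>"
| "word_prod A J x [p] =
    (if fst p \<in> J then if snd p then adj A (x (fst p)) else x (fst p) else \<zero>\<^bsub>A\<^esub>)"
| "word_prod A J x (p # q # w) = word_prod A J x [p] \<otimes>\<^bsub>A\<^esub> word_prod A J x (q # w)"

context cstar_algebra begin

context
  fixes J :: "'x set" and x :: "'x \<Rightarrow> 'a"
  assumes x: "\<And>i. i \<in> J \<Longrightarrow> x i \<in> carrier A"
begin

lemma word_prod_in [simp]: "word_prod A J x w \<in> carrier A"
  by (induction w rule: induct_list012) (auto simp: x)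

lemma word_prod_append: "u \<noteq> [] \<Longrightarrow> v \<noteq> [] \<Longrightarrow>
    word_prod A J x (u @ v) = word_prod A J x u \<otimes> word_prod A J x v"
proof (induction u rule: induct_list012)
  case (2 p)
  then show ?case by (cases v) auto
next
  case (3 p q u)
  then show ?case by (simp add: mult_assoc del: word_prod.simps(2))
qed simp

lemma word_prod_adj:
  "adj A (word_prod A J x w) = word_prod A J x (rev (map (\<lambda>(i, b). (i, \<not> b)) w))"
proof (induction w rule: induct_list012)
  case (2 p)
  then show ?case by (auto simp: adj_adj x split: prod.splits)
next
  case (3 p q u)
  have 1: "adj A (word_prod A J x [p]) = word_prod A J x [(\<lambda>(i, b). (i, \<not> b)) p]"
    by (auto simp: adj_adj x split: prod.splits)
  let ?r = "rev (map (\<lambda>(i, b). (i, \<not> b)) (q # u))"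
  have "adj A (word_prod A J x (p # q # u)) = adj A (word_prod A J x (q # u)) \<otimes> adj A (word_prod A J x [p])"
    by (simp only: word_prod.simps(3) adj_mult word_prod_in)
  also have "\<dots> = word_prod A J x (?r @ [(\<lambda>(i, b). (i, \<not> b)) p])"
    unfolding 3(2) 1 by (intro word_prod_append[symmetric]) auto
  finally show ?case by simp
qed simp

definition word_eval :: "(('x \<times> bool) list \<Rightarrow> complex) \<Rightarrow> 'a" where
  "word_eval p = (\<Oplus>w\<in>{w. p w \<noteq> 0}. scale A (p w) (word_prod A J x w))"

lemma word_eval_eq:
  "finite F \<Longrightarrow> {w. p w \<noteq> 0} \<subseteq> F \<Longrightarrow> word_eval p = (\<Oplus>w\<in>F. scale A (p w) (word_prod A J x w))"
  unfolding word_eval_def by (intro add.finprod_mono_neutral_cong_left) auto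

lemma word_eval_in [simp]: "word_eval p \<in> carrier A"
  unfolding word_eval_def by (intro finsum_closed) auto

text \<open>Values of finitely supported functions on words form a subspace, as coefficients can be
  added and scaled over a common finite support; single words are values of indicator
  functions.\<close>

lemma word_span_subset:
  "lin_span A (range (word_prod A J x)) \<subseteq> word_eval ` {p. finite {w. p w \<noteq> 0}}" (is "_ \<subseteq> ?R")
proof (rule span_least)
  show "lin_subspace A ?R" unfolding lin_subspace_def
  proof (intro conjI ballI allI)
    show "?R \<subseteq> carrier A" by auto
    show "\<zero> \<in> ?R" by (rule image_eqI[of _ _ "\<lambda>w. 0"]) (simp_all add: word_eval_def)
    fix a assume "a \<in> ?R"
    then obtain p where p: "finite {w. p w \<noteq> 0}" "a = word_eval p" by blast
    { fix b assume "b \<in> ?R"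
      then obtain q where q: "finite {w. q w \<noteq> 0}" "b = word_eval q" by blast
      let ?F = "{w. p w \<noteq> 0} \<union> {w. q w \<noteq> 0}"
      have sub: "{w. p w + q w \<noteq> 0} \<subseteq> ?F" by auto
      have "word_eval (\<lambda>w. p w + q w) = (\<Oplus>w\<in>?F. scale A (p w) (word_prod A J x w) \<oplus> scale A (q w) (word_prod A J x w))"
        using word_eval_eq[OF _ sub] p q by (simp add: plus_scale)
      also have "\<dots> = (\<Oplus>w\<in>?F. scale A (p w) (word_prod A J x w)) \<oplus> (\<Oplus>w\<in>?F. scale A (q w) (word_prod A J x w))"
        by (intro finsum_addf) auto
      also have "\<dots> = a \<oplus> b"
        using word_eval_eq[of ?F p] word_eval_eq[of ?F q] p q by simp
      finally have "word_eval (\<lambda>w. p w + q w) = a \<oplus> b" .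
      moreover have "finite {w. p w + q w \<noteq> 0}" using sub p q by (auto intro: finite_subset)
      ultimately show "a \<oplus> b \<in> ?R" by (intro image_eqI[of _ _ "\<lambda>w. p w + q w"]) auto }
    fix z
    have sub: "{w. z * p w \<noteq> 0} \<subseteq> {w. p w \<noteq> 0}" by auto
    have "scale A z a = (\<Oplus>w\<in>{w. p w \<noteq> 0}. scale A z (scale A (p w) (word_prod A J x w)))"
      unfolding p(2) word_eval_def using abelian_group_axioms
      by (intro finsum_additive) (auto simp: scale_plus)
    also have "\<dots> = word_eval (\<lambda>w. z * p w)"
      using word_eval_eq[OF p(1) sub] by (simp add: scale_scale)
    finally show "scale A z a \<in> ?R"
      using sub p(1) by (intro image_eqI[of _ _ "\<lambda>w. z * p w"]) (auto intro: finite_subset)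
  qed
  show "range (word_prod A J x) \<subseteq> ?R"
  proof
    fix a assume "a \<in> range (word_prod A J x)"
    then obtain w where w: "a = word_prod A J x w" by blast
    have "{v. (if v = w then 1 else 0) \<noteq> (0 :: complex)} = {w}" by auto
    then show "a \<in> ?R"
      by (intro image_eqI[of _ _ "\<lambda>v. if v = w then 1 else 0"]) (auto simp: w word_eval_def scale_1)
  qed
qed

text \<open>An element of the generated C*-subalgebra is encoded by a sequence of *-polynomials converging
  to it.\<close>

lemma generated_test_algebra:
  obtains E :: "'x test_elem cstar" and j where "cstar_algebra E" "cstar_hom E A j" "inj_on j (carrier E)"
    "x ` J \<subseteq> j ` carrier E" "\<And>S. cstar_subalgebra A S \<Longrightarrow> x ` J \<subseteq> S \<Longrightarrow> j ` carrier E \<subseteq> S"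
    "\<And>e. cnorm E e = cnorm A (j e)"
proof -
  let ?W = "range (word_prod A J x)"
  define S where "S = norm_closure A (lin_span A ?W)"
  have W: "?W \<subseteq> carrier A" by auto
  have mult: "a \<otimes> b \<in> ?W" if "a \<in> ?W" "b \<in> ?W" for a b
  proof -
    obtain u v where uv: "a = word_prod A J x u" "b = word_prod A J x v"
      using \<open>a \<in> ?W\<close> \<open>b \<in> ?W\<close> by blast
    show ?thesis
    \<comment> \<open>A factor given by the empty word is zero, and zero is again the value of a
      word, namely of the empty one.\<close>
    proof (cases "u = [] \<or> v = []")
      case True
      then have "a \<otimes> b = word_prod A J x []" using uv by auto
      then show ?thesis by blast
    next
      case False
      then show ?thesis using uv word_prod_append[of u v] by (metis rangeI)
    qed
  qed
  have adj: "adj A a \<in> ?W" if "a \<in> ?W" for a using that word_prod_adj by auto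
  have S: "cstar_subalgebra A S" unfolding S_def by (rule subalgebra_closure_span[OF W mult adj])
  have WS: "?W \<subseteq> S" unfolding S_def
    using closure_subset[OF span_carrier[OF W]] span_superset[of ?W] by blast
  have SA: "S \<subseteq> carrier A" unfolding S_def by (rule closure_in_carrier)
  have ex: "\<exists>P. \<forall>n. cnorm A (a \<ominus> word_eval (P n)) < inverse (real (Suc n))" if a: "a \<in> S" for a
  proof -
    have "\<exists>p. cnorm A (a \<ominus> word_eval p) < inverse (real (Suc n))" for n
    proof -
      obtain b where "b \<in> lin_span A ?W" "cnorm A (a \<ominus> b) < inverse (real (Suc n))"
        using closure_approx[OF a[unfolded S_def] span_carrier[OF W], of "inverse (real (Suc n))"] by auto
      then show ?thesis using word_span_subset by blast
    qed
    then show ?thesis by metis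
  qed
  \<comment> \<open>A prescribed rate of approximation singles out sequences converging to
    \<open>a\<close>; the encoding is injective because limits are unique.\<close>
  define enc :: "'a \<Rightarrow> 'x test_elem"
    where "enc a = (SOME P. \<forall>n. cnorm A (a \<ominus> word_eval (P n)) < inverse (real (Suc n)))" for a
  have enc: "cnorm A (a \<ominus> word_eval (enc a n)) < inverse (real (Suc n))" if "a \<in> S" for a n
    using someI_ex[OF ex[OF that]] unfolding enc_def by blast
  have inj: "inj_on enc S"
  proof (rule inj_onI)
    fix a b assume ab: "a \<in> S" "b \<in> S" and eq: "enc a = enc b"
    then have c: "a \<in> carrier A" "b \<in> carrier A" using SA by auto
    have lim: "(\<lambda>n. cnorm A (word_eval (enc y n) \<ominus> y)) \<longlonglongrightarrow> 0" if y: "y \<in> S" for y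
    proof (rule tendsto_sandwich[OF _ _ tendsto_const LIMSEQ_inverse_real_of_nat])
      have "y \<in> carrier A" using y SA by blast
      then show "\<forall>\<^sub>F n in sequentially. cnorm A (word_eval (enc y n) \<ominus> y) \<le> inverse (real (Suc n))"
        using enc[OF y] by (simp add: norm_minus_commute[of _ y] less_imp_le del: of_nat_Suc)
      show "\<forall>\<^sub>F n in sequentially. 0 \<le> cnorm A (word_eval (enc y n) \<ominus> y)"
        using \<open>y \<in> carrier A\<close> by simp
    qed
    show "a = b" using limit_unique[OF c _ lim[OF ab(1)] lim[OF ab(2), folded eq]] by simp
  qed
  note T = transport[OF S inj]
  show ?thesis
  proof (rule that[OF T(1,2,4) _ _ T(5), unfolded T(3)])
    show "x ` J \<subseteq> S"
    proof
      fix a assume "a \<in> x ` J"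
      then obtain i where "i \<in> J" "a = x i" by blast
      then have "a = word_prod A J x [(i, False)]" by simp
      then show "a \<in> S" using WS by blast
    qed
    fix S' assume S': "cstar_subalgebra A S'" "x ` J \<subseteq> S'"
    then have ss: "lin_subspace A S'" "\<And>a b. a \<in> S' \<Longrightarrow> b \<in> S' \<Longrightarrow> a \<otimes> b \<in> S'"
      "\<And>a. a \<in> S' \<Longrightarrow> adj A a \<in> S'" "norm_closure A S' = S'"
      by (auto simp: cstar_subalgebra_def)
    have "word_prod A J x w \<in> S'" for w
      using S'(2) ss(2,3) subspaceD(2)[OF ss(1)] by (induction w rule: induct_list012) auto
    then have "lin_span A ?W \<subseteq> S'" using ss(1) by (intro span_least) auto
    then show "S \<subseteq> S'" unfolding S_def using closure_mono ss(4) by blast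
  qed
qed

end
end

section \<open>Twisted regular representations\<close>

context free_module begin

lemma point_in: "i \<in> I \<Longrightarrow> a \<in> carrier A \<Longrightarrow> (\<lambda>j. if j = i then a else \<zero>) \<in> X"
  unfolding X_def by (auto intro: finite_subset[of _ "{i}"])

lemma ip_point:
  assumes "i \<in> I" "a \<in> carrier A" "f \<in> X"
  shows "ip (\<lambda>j. if j = i then a else \<zero>) f = adj A a \<otimes> f i"
proof -
  have "ip (\<lambda>j. if j = i then a else \<zero>) f = (\<Oplus>j\<in>{i}. adj A (if j = i then a else \<zero>) \<otimes> f j)"
    using assms by (intro ip_eq point_in) auto
  then show ?thesis using assms by (simp add: XD)
qed

lemma mnorm_point: "i \<in> I \<Longrightarrow> a \<in> carrier A \<Longrightarrow> mnorm (\<lambda>j. if j = i then a else \<zero>) = cnorm A a"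
  using ip_point[OF _ _ point_in] by (simp add: mnorm_def cstar_identity)

text \<open>Adjoints are unique because the inner product is nondegenerate.\<close>

lemma ops_eqI:
  assumes x: "x \<in> ops" and y: "y \<in> ops" and eq: "\<And>f i. f \<in> X \<Longrightarrow> i \<in> I \<Longrightarrow> fst x f i = fst y f i"
  shows "x = y"
proof (rule prod_eqI)
  have X: "fst x f \<in> X" "fst y f \<in> X" "snd x f \<in> X" "snd y f \<in> X" for f
    using lin_op_X opsD(1,2) x y by blast+
  show f: "fst x = fst y"
  proof (intro ext)
    fix f i show "fst x f i = fst y f i"
      using eq lin_opD(2)[OF opsD(1)[OF x]] lin_opD(2)[OF opsD(1)[OF y]] XD(3)[OF X(1), of i f] XD(3)[OF X(2), of i f]
      by (cases "f \<in> X"; cases "i \<in> I") auto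
  qed
  show "snd x = snd y"
  proof (intro ext)
    fix h i
    consider "h \<notin> X" | "i \<notin> I" | "h \<in> X" "i \<in> I" by blast
    then show "snd x h i = snd y h i"
    proof cases
      case 3
      \<comment> \<open>Pairing with the unit mass at \<open>i\<close> reads off the coordinate
        \<open>i\<close> and expresses the second component of an operator through the
        first.\<close>
      let ?p = "\<lambda>j. if j = i then \<one> else \<zero>"
      have p: "?p \<in> X" using 3 one_in by (intro point_in)
      have "snd z h i = ip (fst z ?p) h" if "z \<in> ops" for z
        using that 3 opsD(3)[OF that p 3(1)] ip_point[OF 3(2) one_in lin_op_X[OF opsD(2)[OF that]]]
        by (simp add: lin_op_in[OF opsD(2)])
      then show ?thesis using x y f by simp
    qed (use lin_opD(2)[OF opsD(2)[OF x]] lin_opD(2)[OF opsD(2)[OF y]] XD(3)[OF X(3), of i h] XD(3)[OF X(4), of i h] in auto)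
  qed
qed

definition left_mult where "left_mult a = (left_op a, left_op (adj A a))"

lemma left_mult_in: "a \<in> carrier A \<Longrightarrow> left_mult a \<in> ops"
  unfolding left_mult_def by (rule left_op_ops)

lemma left_mult_apply: "f \<in> X \<Longrightarrow> fst (left_mult a) f i = a \<otimes> f i"
  by (simp add: left_mult_def left_op_def)

lemma left_mult_plus:
  assumes "a \<in> carrier A" "b \<in> carrier A"
  shows "left_mult (a \<oplus> b) = left_mult a \<oplus>\<^bsub>opalg\<^esub> left_mult b"
proof -
  interpret O: pre_cstar opalg by (rule pre_cstar_opalg)
  show ?thesis
    using O.a_closed[of "left_mult a" "left_mult b"] assms
    by (intro ops_eqI) (auto simp: left_mult_in left_mult_apply plus_mult XD)
qed

lemma left_mult_scale:
  assumes "a \<in> carrier A" shows "left_mult (scale A z a) = scale opalg z (left_mult a)"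
proof -
  interpret O: pre_cstar opalg by (rule pre_cstar_opalg)
  show ?thesis
    using O.scale_in[of "left_mult a" z] assms
    by (intro ops_eqI) (auto simp: left_mult_in left_mult_apply scale_mult XD)
qed

lemma left_mult_mult:
  assumes "a \<in> carrier A" "b \<in> carrier A"
  shows "left_mult (a \<otimes> b) = left_mult a \<otimes>\<^bsub>opalg\<^esub> left_mult b"
  using assms lin_op_X[OF opsD(1)[OF left_mult_in]] opalg_mult_in[of "left_mult a" "left_mult b"]
  by (intro ops_eqI) (auto simp: left_mult_in left_mult_apply mult_assoc XD)

lemma left_mult_adj: "a \<in> carrier A \<Longrightarrow> left_mult (adj A a) = adj opalg (left_mult a)"
  by (simp add: left_mult_def adj_adj)

lemma left_mult_norm_le: "a \<in> carrier A \<Longrightarrow> cnorm opalg (left_mult a) \<le> cnorm A a"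
proof (rule opalg_norm_le)
  fix f assume a: "a \<in> carrier A" and f: "f \<in> X"
  have "fst (left_mult a) f = (\<lambda>i. a \<otimes> f i)" using f by (intro ext left_mult_apply)
  then show "mnorm (fst (left_mult a) f) \<le> cnorm A a * mnorm f" using mnorm_left[OF f a] by simp
qed simp

end

lemma cocycleD:
  assumes "cocycle G \<sigma>"
  shows "\<lbrakk>g \<in> carrier G; h \<in> carrier G\<rbrakk> \<Longrightarrow> cmod (\<sigma> g h) = 1"
    "g \<in> carrier G \<Longrightarrow> \<sigma> \<one>\<^bsub>G\<^esub> g = 1" "g \<in> carrier G \<Longrightarrow> \<sigma> g \<one>\<^bsub>G\<^esub> = 1"
    "\<lbrakk>g \<in> carrier G; h \<in> carrier G; k \<in> carrier G\<rbrakk>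
      \<Longrightarrow> \<sigma> g h * \<sigma> (g \<otimes>\<^bsub>G\<^esub> h) k = \<sigma> g (h \<otimes>\<^bsub>G\<^esub> k) * \<sigma> h k"
    "\<lbrakk>g \<in> carrier G; h \<in> carrier G\<rbrakk> \<Longrightarrow> cnj (\<sigma> g h) * \<sigma> g h = 1"
  using assms complex_norm_square[of "\<sigma> g h"] by (simp_all add: cocycle_def mult.commute)

lemma cocycle_cnj: "cocycle G \<sigma> \<Longrightarrow> cocycle G (\<lambda>g h. cnj (\<sigma> g h))"
  unfolding cocycle_def by (auto simp flip: complex_cnj_mult)

lemma cocycle_inv_sym:
  assumes "group G" "cocycle G \<sigma>" "g \<in> carrier G"
  shows "\<sigma> (inv\<^bsub>G\<^esub> g) g = \<sigma> g (inv\<^bsub>G\<^esub> g)"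
proof -
  interpret group G by fact
  show ?thesis using cocycleD(4)[OF assms(2), of g "inv\<^bsub>G\<^esub> g" g] assms(3) by (simp add: cocycleD(2,3)[OF assms(2)])
qed

locale regular_rep = free_module A "carrier G" + G: group G
  for A :: "'a cstar" (structure) and G :: "'g monoid" +
  fixes \<omega> :: "'g \<Rightarrow> 'g \<Rightarrow> complex"
  assumes cocycle: "cocycle G \<omega>"
begin

text \<open>On point masses \<open>shift g\<close> acts by \<open>\<delta>\<^sub>h \<mapsto>
  \<omega>(g,h) \<delta>\<^sub>g\<^sub>h\<close>; the weight appears with \<open>h\<close> solved
  from \<open>i = gh\<close>. The second component is written exactly as \<open>perm_op_ops\<close>
  produces it.\<close>

definition shift :: "'g \<Rightarrow> (('g \<Rightarrow> 'a) \<Rightarrow> 'g \<Rightarrow> 'a) \<times> (('g \<Rightarrow> 'a) \<Rightarrow> 'g \<Rightarrow> 'a)" where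
  "shift g = (perm_op (\<lambda>i. \<omega> g (inv\<^bsub>G\<^esub> g \<otimes>\<^bsub>G\<^esub> i)) (\<lambda>i. inv\<^bsub>G\<^esub> g \<otimes>\<^bsub>G\<^esub> i),
     perm_op (\<lambda>i. cnj (\<omega> g (inv\<^bsub>G\<^esub> g \<otimes>\<^bsub>G\<^esub> (g \<otimes>\<^bsub>G\<^esub> i)))) (\<lambda>i. g \<otimes>\<^bsub>G\<^esub> i))"

lemma cancel: "g \<in> carrier G \<Longrightarrow> i \<in> carrier G \<Longrightarrow> inv\<^bsub>G\<^esub> g \<otimes>\<^bsub>G\<^esub> (g \<otimes>\<^bsub>G\<^esub> i) = i"
  "g \<in> carrier G \<Longrightarrow> i \<in> carrier G \<Longrightarrow> g \<otimes>\<^bsub>G\<^esub> (inv\<^bsub>G\<^esub> g \<otimes>\<^bsub>G\<^esub> i) = i"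
  by (simp_all flip: G.m_assoc)

lemma shift_in: "g \<in> carrier G \<Longrightarrow> shift g \<in> ops"
  unfolding shift_def by (rule perm_op_ops) (auto simp: cancel cocycleD(1)[OF cocycle])

lemma shift_apply: "f \<in> X \<Longrightarrow> i \<in> carrier G \<Longrightarrow>
    fst (shift g) f i = scale A (\<omega> g (inv\<^bsub>G\<^esub> g \<otimes>\<^bsub>G\<^esub> i)) (f (inv\<^bsub>G\<^esub> g \<otimes>\<^bsub>G\<^esub> i))"
  by (simp add: shift_def perm_op_def)

lemma shift_apply_adj: "f \<in> X \<Longrightarrow> g \<in> carrier G \<Longrightarrow> i \<in> carrier G \<Longrightarrow>
    fst (adj opalg (shift g)) f i = scale A (cnj (\<omega> g i)) (f (g \<otimes>\<^bsub>G\<^esub> i))"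
  by (simp add: shift_def perm_op_def cancel)

text \<open>At the point \<open>i\<close> this is the cocycle identity for \<open>g\<close>,
  \<open>h\<close> and \<open>k\<close>, where \<open>ghk = i\<close>.\<close>

lemma shift_mult:
  assumes g: "g \<in> carrier G" and h: "h \<in> carrier G"
  shows "shift g \<otimes>\<^bsub>opalg\<^esub> shift h = scale opalg (\<omega> g h) (shift (g \<otimes>\<^bsub>G\<^esub> h))"
proof -
  interpret O: pre_cstar opalg by (rule pre_cstar_opalg)
  show ?thesis
  proof (rule ops_eqI)
    fix f i assume f: "f \<in> X" and i: "i \<in> carrier G"
    let ?k = "inv\<^bsub>G\<^esub> h \<otimes>\<^bsub>G\<^esub> (inv\<^bsub>G\<^esub> g \<otimes>\<^bsub>G\<^esub> i)"
    have k: "?k \<in> carrier G" "h \<otimes>\<^bsub>G\<^esub> ?k = inv\<^bsub>G\<^esub> g \<otimes>\<^bsub>G\<^esub> i" "inv\<^bsub>G\<^esub> (g \<otimes>\<^bsub>G\<^esub> h) \<otimes>\<^bsub>G\<^esub> i = ?k"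
      using g h i by (simp_all add: cancel G.inv_mult_group G.m_assoc)
    have fX: "fst (shift h) f \<in> X" using lin_op_X[OF opsD(1)[OF shift_in[OF h]]] .
    have "fst (shift g \<otimes>\<^bsub>opalg\<^esub> shift h) f i
        = scale A (\<omega> g (inv\<^bsub>G\<^esub> g \<otimes>\<^bsub>G\<^esub> i) * \<omega> h ?k) (f ?k)"
      using f g h i fX by (simp add: shift_apply scale_scale XD)
    also have "\<omega> g (inv\<^bsub>G\<^esub> g \<otimes>\<^bsub>G\<^esub> i) * \<omega> h ?k = \<omega> g h * \<omega> (g \<otimes>\<^bsub>G\<^esub> h) ?k"
      using cocycleD(4)[OF cocycle g h k(1)] k(2) by simp
    also have "scale A \<dots> (f ?k) = fst (scale opalg (\<omega> g h) (shift (g \<otimes>\<^bsub>G\<^esub> h))) f i"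
      using f g h i k(3) by (simp add: shift_apply scale_scale XD)
    finally show "fst (shift g \<otimes>\<^bsub>opalg\<^esub> shift h) f i
        = fst (scale opalg (\<omega> g h) (shift (g \<otimes>\<^bsub>G\<^esub> h))) f i" .
  qed (use opalg_mult_in[OF shift_in shift_in] O.scale_in[of "shift (g \<otimes>\<^bsub>G\<^esub> h)"] g h shift_in in simp_all)
qed

text \<open>At the point \<open>i\<close> this is the cocycle identity for the inverse of
  \<open>g\<close>, \<open>g\<close> and \<open>i\<close>, combined with the symmetry
  \<open>cocycle_inv_sym\<close>.\<close>

lemma shift_adj:
  assumes g: "g \<in> carrier G"
  shows "adj opalg (shift g) = scale opalg (cnj (\<omega> g (inv\<^bsub>G\<^esub> g))) (shift (inv\<^bsub>G\<^esub> g))"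
proof -
  interpret O: pre_cstar opalg by (rule pre_cstar_opalg)
  show ?thesis
  proof (rule ops_eqI)
    fix f i assume f: "f \<in> X" and i: "i \<in> carrier G"
    have gi: "inv\<^bsub>G\<^esub> g \<in> carrier G" "g \<otimes>\<^bsub>G\<^esub> i \<in> carrier G" using g i by auto
    have "\<omega> (inv\<^bsub>G\<^esub> g) (g \<otimes>\<^bsub>G\<^esub> i) * \<omega> g i = \<omega> g (inv\<^bsub>G\<^esub> g)"
      using cocycleD(4)[OF cocycle gi(1) g i] g i
      by (simp add: cocycleD(2)[OF cocycle] cocycle_inv_sym[OF G.is_group cocycle])
    then have "cnj (\<omega> g (inv\<^bsub>G\<^esub> g)) * \<omega> (inv\<^bsub>G\<^esub> g) (g \<otimes>\<^bsub>G\<^esub> i)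
        = cnj (\<omega> g i) * (cnj (\<omega> (inv\<^bsub>G\<^esub> g) (g \<otimes>\<^bsub>G\<^esub> i)) * \<omega> (inv\<^bsub>G\<^esub> g) (g \<otimes>\<^bsub>G\<^esub> i))"
      by (metis complex_cnj_mult mult.assoc mult.commute)
    then have c: "cnj (\<omega> g (inv\<^bsub>G\<^esub> g)) * \<omega> (inv\<^bsub>G\<^esub> g) (g \<otimes>\<^bsub>G\<^esub> i) = cnj (\<omega> g i)"
      using cocycleD(5)[OF cocycle gi] by simp
    show "fst (adj opalg (shift g)) f i
        = fst (scale opalg (cnj (\<omega> g (inv\<^bsub>G\<^esub> g))) (shift (inv\<^bsub>G\<^esub> g))) f i"
      unfolding shift_apply_adj[OF f g i] using f g i c by (simp add: shift_apply scale_scale XD)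
  qed (use opalg_adj_in[OF shift_in[OF g]] shift_in[OF G.inv_closed[OF g]] O.scale_in in \<open>simp_all only: opalg_sel(1)\<close>)
qed

lemma left_mult_shift:
  assumes g: "g \<in> carrier G" and a: "a \<in> carrier A"
  shows "left_mult a \<otimes>\<^bsub>opalg\<^esub> shift g = shift g \<otimes>\<^bsub>opalg\<^esub> left_mult a"
proof (rule ops_eqI)
  fix f i assume f: "f \<in> X" and i: "i \<in> carrier G"
  have "fst (shift g) f \<in> X" "fst (left_mult a) f \<in> X"
    using lin_op_X opsD(1) shift_in left_mult_in g a by blast+
  then show "fst (left_mult a \<otimes>\<^bsub>opalg\<^esub> shift g) f i = fst (shift g \<otimes>\<^bsub>opalg\<^esub> left_mult a) f i"
    using f i a by (simp add: left_mult_apply shift_apply mult_scale XD)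
qed (use opalg_mult_in shift_in left_mult_in g a in auto)

text \<open>The product of the adjoint of \<open>shift g\<close> with \<open>shift g\<close> is the
  shift by the neutral element, because the two phases cancel; that shift fixes every
  vector.\<close>

lemma shift_norm_le:
  assumes g: "g \<in> carrier G" shows "cnorm opalg (shift g) \<le> 1"
proof -
  interpret O: pre_cstar opalg by (rule pre_cstar_opalg)
  let ?n = "cnorm opalg (shift \<one>\<^bsub>G\<^esub>)"
  have "fst (shift \<one>\<^bsub>G\<^esub>) f = f" if f: "f \<in> X" for f
  proof
    fix i
    have "fst (shift \<one>\<^bsub>G\<^esub>) f \<in> X" using lin_op_X[OF opsD(1)[OF shift_in[OF G.one_closed]]] .
    then show "fst (shift \<one>\<^bsub>G\<^esub>) f i = f i"
      using f by (cases "i \<in> carrier G") (simp_all add: shift_apply cocycleD(2)[OF cocycle] scale_1 XD)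
  qed
  then have 1: "?n \<le> 1" by (intro opalg_norm_le) simp_all
  have sg: "shift g \<in> carrier opalg" "shift (inv\<^bsub>G\<^esub> g) \<in> carrier opalg" "shift \<one>\<^bsub>G\<^esub> \<in> carrier opalg"
    using shift_in g by simp_all
  have "(cnorm opalg (shift g))\<^sup>2 = cnorm opalg (adj opalg (shift g) \<otimes>\<^bsub>opalg\<^esub> shift g)"
    using O.cstar_identity[OF sg(1)] ..
  also have "adj opalg (shift g) \<otimes>\<^bsub>opalg\<^esub> shift g = scale opalg (cnj (\<omega> g (inv\<^bsub>G\<^esub> g)) * \<omega> (inv\<^bsub>G\<^esub> g) g) (shift \<one>\<^bsub>G\<^esub>)"
    unfolding shift_adj[OF g] using g sg
    by (simp only: O.scale_mult shift_mult[OF G.inv_closed] O.scale_scale G.l_inv)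
  also have "cnj (\<omega> g (inv\<^bsub>G\<^esub> g)) * \<omega> (inv\<^bsub>G\<^esub> g) g = 1"
    using g cocycleD(5)[OF cocycle g G.inv_closed[OF g]] by (simp add: cocycle_inv_sym[OF G.is_group cocycle])
  also have "cnorm opalg (scale opalg 1 (shift \<one>\<^bsub>G\<^esub>)) = ?n" using O.scale_1[OF sg(3)] by simp
  finally have "(cnorm opalg (shift g))\<^sup>2 \<le> 1\<^sup>2" using 1 by simp
  then show ?thesis by (rule power2_le_imp_le) simp
qed

text \<open>The operator \<open>a \<otimes> u\<^sub>g\<close>. The two factors commute by
  \<open>left_mult_shift\<close>: one acts on coefficients from the left, the other moves and
  rescales them.\<close>

definition reg :: "'g \<Rightarrow> 'a \<Rightarrow> (('g \<Rightarrow> 'a) \<Rightarrow> 'g \<Rightarrow> 'a) \<times> (('g \<Rightarrow> 'a) \<Rightarrow> 'g \<Rightarrow> 'a)" where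
  "reg g a = shift g \<otimes>\<^bsub>opalg\<^esub> left_mult a"

lemma reg_in: "g \<in> carrier G \<Longrightarrow> a \<in> carrier A \<Longrightarrow> reg g a \<in> carrier opalg"
  using opalg_mult_in[OF shift_in left_mult_in] by (simp add: reg_def)

lemma reg:
  assumes g: "g \<in> carrier G" and a: "a \<in> carrier A"
  shows "b \<in> carrier A \<Longrightarrow> reg g (a \<oplus> b) = reg g a \<oplus>\<^bsub>opalg\<^esub> reg g b"
    "reg g (scale A z a) = scale opalg z (reg g a)"
    "h \<in> carrier G \<Longrightarrow> b \<in> carrier A \<Longrightarrow>
      reg g a \<otimes>\<^bsub>opalg\<^esub> reg h b = scale opalg (\<omega> g h) (reg (g \<otimes>\<^bsub>G\<^esub> h) (a \<otimes> b))"
    "adj opalg (reg g a) = scale opalg (cnj (\<omega> g (inv\<^bsub>G\<^esub> g))) (reg (inv\<^bsub>G\<^esub> g) (adj A a))"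
    "cnorm opalg (reg g a) = cnorm A a"
proof -
  interpret O: pre_cstar opalg by (rule pre_cstar_opalg)
  have s: "shift g \<in> carrier opalg" if "g \<in> carrier G" for g using that shift_in by simp
  have l: "left_mult a \<in> carrier opalg" if "a \<in> carrier A" for a using that left_mult_in by simp
  show "reg g (a \<oplus> b) = reg g a \<oplus>\<^bsub>opalg\<^esub> reg g b" if "b \<in> carrier A"
    using a that s[OF g] l by (simp only: reg_def left_mult_plus O.mult_plus)
  show "reg g (scale A z a) = scale opalg z (reg g a)"
    using a s[OF g] l by (simp only: reg_def left_mult_scale O.mult_scale)
  show "reg g a \<otimes>\<^bsub>opalg\<^esub> reg h b = scale opalg (\<omega> g h) (reg (g \<otimes>\<^bsub>G\<^esub> h) (a \<otimes> b))"
    if h: "h \<in> carrier G" and b: "b \<in> carrier A"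
  proof -
    have "reg g a \<otimes>\<^bsub>opalg\<^esub> reg h b
        = shift g \<otimes>\<^bsub>opalg\<^esub> (left_mult a \<otimes>\<^bsub>opalg\<^esub> shift h) \<otimes>\<^bsub>opalg\<^esub> left_mult b"
      using s[OF g] s[OF h] l[OF a] l[OF b] by (simp only: reg_def O.mult_assoc O.mult_in)
    also have "\<dots> = (shift g \<otimes>\<^bsub>opalg\<^esub> shift h) \<otimes>\<^bsub>opalg\<^esub> (left_mult a \<otimes>\<^bsub>opalg\<^esub> left_mult b)"
      unfolding left_mult_shift[OF h a]
      using s[OF g] s[OF h] l[OF a] l[OF b] by (simp only: O.mult_assoc O.mult_in)
    also have "\<dots> = scale opalg (\<omega> g h) (reg (g \<otimes>\<^bsub>G\<^esub> h) (a \<otimes> b))"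
      unfolding shift_mult[OF g h] left_mult_mult[OF a b, symmetric] reg_def
      using s[OF G.m_closed[OF g h]] l[OF mult_in[OF a b]] by (rule O.scale_mult)
    finally show ?thesis .
  qed
  show "adj opalg (reg g a) = scale opalg (cnj (\<omega> g (inv\<^bsub>G\<^esub> g))) (reg (inv\<^bsub>G\<^esub> g) (adj A a))"
  proof -
    have "adj opalg (reg g a) = left_mult (adj A a) \<otimes>\<^bsub>opalg\<^esub> adj opalg (shift g)"
      unfolding reg_def left_mult_adj[OF a] using s[OF g] l[OF a] by (rule O.adj_mult)
    also have "\<dots> = scale opalg (cnj (\<omega> g (inv\<^bsub>G\<^esub> g))) (left_mult (adj A a) \<otimes>\<^bsub>opalg\<^esub> shift (inv\<^bsub>G\<^esub> g))"
      unfolding shift_adj[OF g] using l[OF adj_in[OF a]] s[OF G.inv_closed[OF g]] by (rule O.mult_scale)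
    finally show ?thesis unfolding left_mult_shift[OF G.inv_closed[OF g] adj_in[OF a]] reg_def .
  qed
  show "cnorm opalg (reg g a) = cnorm A a"
  proof (rule antisym)
    have "cnorm opalg (reg g a) \<le> cnorm opalg (shift g) * cnorm opalg (left_mult a)"
      unfolding reg_def using s[OF g] l[OF a] by (rule O.norm_mult)
    also have "\<dots> \<le> 1 * cnorm A a"
      using s[OF g] l[OF a] by (intro mult_mono shift_norm_le left_mult_norm_le g a O.norm_nonneg) auto
    finally show "cnorm opalg (reg g a) \<le> cnorm A a" by simp
    \<comment> \<open>The vector \<one> at the neutral element is sent to \<open>a\<close> at the
      place \<open>g\<close>, with weight \<open>\<omega> g \<one> = 1\<close>. Its own norm is at
      most 1, so the operator norm is at least that of \<open>a\<close>.\<close>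
    let ?p = "\<lambda>i b j. if j = i then b else \<zero>"
    have p: "?p \<one>\<^bsub>G\<^esub> \<one> \<in> X" by (intro point_in) (auto simp: one_in)
    have X: "fst (left_mult a) (?p \<one>\<^bsub>G\<^esub> \<one>) \<in> X" using lin_op_X opsD(1) left_mult_in a by blast
    have X': "fst (reg g a) (?p \<one>\<^bsub>G\<^esub> \<one>) \<in> X" using lin_op_X opsD(1) reg_in[OF g a] by (metis opalg_sel(1))
    have "fst (reg g a) (?p \<one>\<^bsub>G\<^esub> \<one>) = ?p g a"
    proof
      fix i
      show "fst (reg g a) (?p \<one>\<^bsub>G\<^esub> \<one>) i = ?p g a i"
      proof (cases "i \<in> carrier G")
        case True
        have "inv\<^bsub>G\<^esub> g \<otimes>\<^bsub>G\<^esub> i = \<one>\<^bsub>G\<^esub> \<longleftrightarrow> i = g"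
          using g True by (metis G.l_inv cancel(2) G.r_one)
        moreover have "fst (reg g a) (?p \<one>\<^bsub>G\<^esub> \<one>) i = fst (shift g) (fst (left_mult a) (?p \<one>\<^bsub>G\<^esub> \<one>)) i"
          by (simp add: reg_def)
        ultimately show ?thesis
          using True X p a g by (simp add: shift_apply left_mult_apply cocycleD(3)[OF cocycle] scale_1 mult_one)
      qed (use XD(3)[OF X'] g in auto)
    qed
    then have "cnorm A a = mnorm (fst (reg g a) (?p \<one>\<^bsub>G\<^esub> \<one>))" using mnorm_point[OF g a] by simp
    also have "\<dots> \<le> cnorm opalg (reg g a) * mnorm (?p \<one>\<^bsub>G\<^esub> \<one>)"
      using reg_in[OF g a] p by (intro opalg_norm_bound) auto
    also have "\<dots> \<le> cnorm opalg (reg g a) * 1"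
      using reg_in[OF g a] mnorm_point[OF G.one_closed one_in] norm_one_le opalg_norm_nonneg
      by (intro mult_left_mono) auto
    finally show "cnorm A a \<le> cnorm opalg (reg g a)" by simp
  qed
qed

end

text \<open>A concrete form of the map \<open>a \<mapsto> a \<otimes> u\<^sub>g\<close> into the tensor product of \<open>A\<close> with the twisted
  reduced group C*-algebra.\<close>

lemma twisted_regular_representation:
  fixes A :: "'a cstar" and G :: "'g monoid"
  assumes A: "cstar_algebra A" and G: "group G" and \<omega>: "cocycle G \<omega>"
  obtains K :: "(nat \<Rightarrow> (('g \<Rightarrow> complex \<times> 'a) \<Rightarrow> 'g \<Rightarrow> complex \<times> 'a) \<times>
      (('g \<Rightarrow> complex \<times> 'a) \<Rightarrow> 'g \<Rightarrow> complex \<times> 'a)) set cstar" and m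
  where "cstar_algebra K"
    "\<And>g a. g \<in> carrier G \<Longrightarrow> a \<in> carrier A \<Longrightarrow> m g a \<in> carrier K"
    "\<And>g a b. g \<in> carrier G \<Longrightarrow> a \<in> carrier A \<Longrightarrow> b \<in> carrier A \<Longrightarrow> m g (a \<oplus>\<^bsub>A\<^esub> b) = m g a \<oplus>\<^bsub>K\<^esub> m g b"
    "\<And>g a z. g \<in> carrier G \<Longrightarrow> a \<in> carrier A \<Longrightarrow> m g (scale A z a) = scale K z (m g a)"
    "\<And>g h a b. g \<in> carrier G \<Longrightarrow> h \<in> carrier G \<Longrightarrow> a \<in> carrier A \<Longrightarrow> b \<in> carrier A \<Longrightarrow>
      m g a \<otimes>\<^bsub>K\<^esub> m h b = scale K (\<omega> g h) (m (g \<otimes>\<^bsub>G\<^esub> h) (a \<otimes>\<^bsub>A\<^esub> b))"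
    "\<And>g a. g \<in> carrier G \<Longrightarrow> a \<in> carrier A \<Longrightarrow>
      adj K (m g a) = scale K (cnj (\<omega> g (inv\<^bsub>G\<^esub> g))) (m (inv\<^bsub>G\<^esub> g) (adj A a))"
    "\<And>g a. g \<in> carrier G \<Longrightarrow> a \<in> carrier A \<Longrightarrow> cnorm K (m g a) = cnorm A a"
proof -
  interpret A: cstar_algebra A by fact
  interpret G: group G by fact
  \<comment> \<open>The module is built over the unitization, which provides the vector \<one>
    needed for the lower norm bound; \<open>A\<close> enters isometrically as the ideal of pairs
    \<open>(0, a)\<close>.\<close>
  interpret U: unital_cstar "unitization A" by (rule A.unital_cstar_unitization)
  interpret R: regular_rep "unitization A" G \<omega>
    by (intro regular_rep.intro free_module.intro regular_rep_axioms.intro U.unital_cstar_axioms G \<omega>)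
  interpret O: pre_cstar R.opalg by (rule R.pre_cstar_opalg)
  note h = cstar_homD[OF O.embed_hom]
  let ?m = "\<lambda>g a. O.embed (R.reg g (0, a))"
  have in': "R.reg g (0, a) \<in> carrier R.opalg" if "g \<in> carrier G" "a \<in> carrier A" for g a
    using that R.reg_in[of g "(0, a)"] by simp
  have c: "(0, a) \<in> carrier (unitization A)" if "a \<in> carrier A" for a using that by simp
  show ?thesis
  proof (rule that[of O.completion ?m])
    show "cstar_algebra O.completion" by (rule O.cstar_completion)
    fix g a assume g: "g \<in> carrier G" and a: "a \<in> carrier A"
    note r = R.reg[OF g c[OF a]]
    show "?m g a \<in> carrier O.completion" by (intro O.embed_in in' g a)
    show "?m g (a \<oplus>\<^bsub>A\<^esub> b) = ?m g a \<oplus>\<^bsub>O.completion\<^esub> ?m g b" if b: "b \<in> carrier A" for b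
      using h(2)[OF in'[OF g a] in'[OF g b]] r(1)[OF c[OF b]] by simp
    show "?m g (scale A z a) = scale O.completion z (?m g a)" for z
      using h(3)[OF in'[OF g a], of z] r(2)[of z] by simp
    show "?m g a \<otimes>\<^bsub>O.completion\<^esub> ?m k b = scale O.completion (\<omega> g k) (?m (g \<otimes>\<^bsub>G\<^esub> k) (a \<otimes>\<^bsub>A\<^esub> b))"
      if k: "k \<in> carrier G" and b: "b \<in> carrier A" for k b
    proof -
      have "(0, a) \<otimes>\<^bsub>unitization A\<^esub> (0, b) = (0, a \<otimes>\<^bsub>A\<^esub> b)" using a b by simp
      then have "R.reg g (0, a) \<otimes>\<^bsub>R.opalg\<^esub> R.reg k (0, b)
          = scale R.opalg (\<omega> g k) (R.reg (g \<otimes>\<^bsub>G\<^esub> k) (0, a \<otimes>\<^bsub>A\<^esub> b))"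
        using r(3)[OF k c[OF b]] by simp
      then show ?thesis
        using h(4)[OF in'[OF g a] in'[OF k b]] h(3)[OF in'[OF G.m_closed[OF g k] A.mult_in[OF a b]]]
        by simp
    qed
    have "adj (unitization A) (0, a) = (0, adj A a)" by simp
    then have "adj R.opalg (R.reg g (0, a))
        = scale R.opalg (cnj (\<omega> g (inv\<^bsub>G\<^esub> g))) (R.reg (inv\<^bsub>G\<^esub> g) (0, adj A a))"
      using r(4) by (simp only:)
    then show "adj O.completion (?m g a) = scale O.completion (cnj (\<omega> g (inv\<^bsub>G\<^esub> g))) (?m (inv\<^bsub>G\<^esub> g) (adj A a))"
      using h(5)[OF in'[OF g a]] h(3)[OF in'[OF G.inv_closed[OF g] A.adj_in[OF a]]]
      by (simp only:)
    show "cnorm O.completion (?m g a) = cnorm A a"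
      unfolding O.embed_norm[OF in'[OF g a]] r(5) using a by (simp add: A.unit_opnorm_snd)
  qed
qed

section \<open>Twisted Cuntz-Krieger families\<close>

lemma cstar_hom_comp:
  assumes "cstar_hom A B \<rho>" "cstar_hom B C \<tau>" shows "cstar_hom A C (\<tau> \<circ> \<rho>)"
  using cstar_homD[OF assms(1)] cstar_homD[OF assms(2)] by (simp add: cstar_hom_def)

text \<open>The density argument used below for all passages from spanning sets to closures. The map
  is taken on a subset \<open>D\<close> because some of the maps concerned are controlled only on
  one fibre; \<open>\<bar>L\<bar> + 1\<close> serves as a positive Lipschitz constant.\<close>

lemma closure_preimage:
  assumes "pre_cstar A" "pre_cstar B" and D: "X \<subseteq> D" "D \<subseteq> carrier A"
    and \<phi>: "\<And>a. a \<in> D \<Longrightarrow> \<phi> a \<in> carrier B"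
      "\<And>a b. a \<in> D \<Longrightarrow> b \<in> D \<Longrightarrow> cnorm B (\<phi> a \<ominus>\<^bsub>B\<^esub> \<phi> b) \<le> L * cnorm A (a \<ominus>\<^bsub>A\<^esub> b)"
    and N: "N \<subseteq> carrier B" "norm_closure B N \<subseteq> N" "\<And>a. a \<in> X \<Longrightarrow> \<phi> a \<in> N"
    and a: "a \<in> norm_closure A X" "a \<in> D"
  shows "\<phi> a \<in> N"
proof -
  interpret A: pre_cstar A by fact
  interpret B: pre_cstar B by fact
  have "\<exists>y\<in>N. cnorm B (\<phi> a \<ominus>\<^bsub>B\<^esub> y) < e" if e: "e > 0" for e
  proof -
    have "e / (\<bar>L\<bar> + 1) > 0" using e by simp
    then obtain x where x: "x \<in> X" "x \<in> carrier A" "cnorm A (a \<ominus>\<^bsub>A\<^esub> x) < e / (\<bar>L\<bar> + 1)"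
      using A.closure_approx[OF a(1), of "e / (\<bar>L\<bar> + 1)"] D by blast
    have n: "0 \<le> cnorm A (a \<ominus>\<^bsub>A\<^esub> x)" using a(2) D x by (intro A.norm_nonneg) auto
    have "cnorm B (\<phi> a \<ominus>\<^bsub>B\<^esub> \<phi> x) \<le> L * cnorm A (a \<ominus>\<^bsub>A\<^esub> x)" using a x D by (intro \<phi>) auto
    also have "\<dots> \<le> (\<bar>L\<bar> + 1) * cnorm A (a \<ominus>\<^bsub>A\<^esub> x)" using n by (intro mult_right_mono) auto
    also have "\<dots> < e" using x(3) by (simp add: pos_less_divide_eq mult.commute)
    finally show ?thesis using N(3) x(1) by blast
  qed
  then have "\<phi> a \<in> norm_closure B N" using \<phi>(1)[OF a(2)] by (simp add: B.norm_closure_iff[OF N(1)])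
  then show ?thesis using N(2) by blast
qed

text \<open>A sequence in the image that converges in \<open>A\<close> comes from a Cauchy sequence
  in \<open>R\<close>, by isometry. Its limit exists in \<open>E\<close>, stays in the closed set
  \<open>R\<close>, and is mapped to the given point.\<close>

lemma complete_image_closed:
  assumes "cstar_algebra E" "cstar_algebra A" and R: "R \<subseteq> carrier E" "norm_closure E R \<subseteq> R"
    and j: "\<And>a. a \<in> carrier E \<Longrightarrow> j a \<in> carrier A"
      "\<And>a b. a \<in> carrier E \<Longrightarrow> b \<in> carrier E \<Longrightarrow> cnorm A (j a \<ominus>\<^bsub>A\<^esub> j b) = cnorm E (a \<ominus>\<^bsub>E\<^esub> b)"
  shows "norm_closure A (j ` R) \<subseteq> j ` R"
proof
  interpret E: cstar_algebra E by fact
  interpret A: cstar_algebra A by fact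
  fix a assume a: "a \<in> norm_closure A (j ` R)"
  then have ac: "a \<in> carrier A" by (simp add: norm_closure_def)
  have jR: "j ` R \<subseteq> carrier A" using R j by auto
  have "\<exists>r\<in>R. cnorm A (a \<ominus>\<^bsub>A\<^esub> j r) < inverse (real (Suc n))" for n
    using A.closure_approx[OF a jR, of "inverse (real (Suc n))"] by auto
  then obtain r where r: "\<And>n. r n \<in> R" "\<And>n. cnorm A (a \<ominus>\<^bsub>A\<^esub> j (r n)) < inverse (real (Suc n))" by metis
  have rc: "r n \<in> carrier E" "j (r n) \<in> carrier A" for n using r(1)[of n] R(1) j(1) by blast+
  have lim: "(\<lambda>n. cnorm A (j (r n) \<ominus>\<^bsub>A\<^esub> a)) \<longlonglongrightarrow> 0"
  proof (rule tendsto_sandwich[OF _ _ tendsto_const LIMSEQ_inverse_real_of_nat])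
    show "\<forall>\<^sub>F n in sequentially. cnorm A (j (r n) \<ominus>\<^bsub>A\<^esub> a) \<le> inverse (real (Suc n))"
      using r(2) A.norm_minus_commute[OF rc(2) ac] by (simp add: less_imp_le del: of_nat_Suc)
    show "\<forall>\<^sub>F n in sequentially. 0 \<le> cnorm A (j (r n) \<ominus>\<^bsub>A\<^esub> a)" using rc ac by simp
  qed
  have C: "\<exists>N. \<forall>m\<ge>N. \<forall>n\<ge>N. cnorm E (r m \<ominus>\<^bsub>E\<^esub> r n) < e" if "e > 0" for e
  proof -
    have "e/2 > 0" using that by simp
    then obtain N where N: "\<And>n. n \<ge> N \<Longrightarrow> cnorm A (j (r n) \<ominus>\<^bsub>A\<^esub> a) < e/2"
      using order_tendstoD(2)[OF lim \<open>e/2 > 0\<close>] by (auto simp: eventually_sequentially)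
    have "cnorm E (r m \<ominus>\<^bsub>E\<^esub> r n) < e" if "m \<ge> N" "n \<ge> N" for m n
      using A.norm_triangle[OF rc(2) ac rc(2), of m n] A.norm_minus_commute[OF rc(2) ac, of n]
        N[OF that(1)] N[OF that(2)] j(2)[OF rc(1) rc(1), of m n] by simp
    then show ?thesis by blast
  qed
  obtain x where x: "x \<in> carrier E" "(\<lambda>n. cnorm E (r n \<ominus>\<^bsub>E\<^esub> x)) \<longlonglongrightarrow> 0"
    by (rule E.complete'[OF rc(1) C])
  have "x \<in> R" using E.limit_in_closure[OF R(1) r(1) x] R(2) by blast
  moreover have "(\<lambda>n. cnorm A (j (r n) \<ominus>\<^bsub>A\<^esub> j x)) \<longlonglongrightarrow> 0" using x(2) j(2)[OF rc(1) x(1)] by simp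
  then have "a = j x" using A.limit_unique[OF ac j(1)[OF x(1)] rc(2) lim] by blast
  ultimately show "a \<in> j ` R" by blast
qed

lemma twisted_CK_familyD:
  assumes "twisted_CK_family k \<Lambda> c A T"
  shows "\<kappa> \<in> paths \<Lambda> \<Longrightarrow> T \<kappa> \<in> carrier A"
    "v \<in> vertices \<Lambda> \<Longrightarrow> T v \<otimes>\<^bsub>A\<^esub> T v = T v" "v \<in> vertices \<Lambda> \<Longrightarrow> adj A (T v) = T v"
    "v \<in> vertices \<Lambda> \<Longrightarrow> w \<in> vertices \<Lambda> \<Longrightarrow> v \<noteq> w \<Longrightarrow> T v \<otimes>\<^bsub>A\<^esub> T w = \<zero>\<^bsub>A\<^esub>"
    "\<kappa> \<in> paths \<Lambda> \<Longrightarrow> \<mu> \<in> paths \<Lambda> \<Longrightarrow> rng \<Lambda> \<mu> = src \<Lambda> \<kappa> \<Longrightarrow>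
      T \<kappa> \<otimes>\<^bsub>A\<^esub> T \<mu> = scale A (c \<kappa> \<mu>) (T (pcomp \<Lambda> \<kappa> \<mu>))"
    "\<kappa> \<in> paths \<Lambda> \<Longrightarrow> adj A (T \<kappa>) \<otimes>\<^bsub>A\<^esub> T \<kappa> = T (src \<Lambda> \<kappa>)"
    "v \<in> vertices \<Lambda> \<Longrightarrow> n \<in> Nk k \<Longrightarrow>
      T v = (\<Oplus>\<^bsub>A\<^esub>\<kappa>\<in>paths_into \<Lambda> v n. T \<kappa> \<otimes>\<^bsub>A\<^esub> adj A (T \<kappa>))"
  using assms unfolding twisted_CK_family_def by (auto simp del: Pi_split_insert_domain)

lemma (in k_graph) vertex_in: "\<kappa> \<in> paths \<Lambda> \<Longrightarrow> rng \<Lambda> \<kappa> \<in> vertices \<Lambda>" "\<kappa> \<in> paths \<Lambda> \<Longrightarrow> src \<Lambda> \<kappa> \<in> vertices \<Lambda>"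
  by (simp_all add: vertices_def rng_in src_in deg_rng deg_src)

text \<open>Needed with \<open>\<omega> = \<sigma>\<close> and the fibres of the bundle for \<open>F\<close>, and with the conjugate of \<open>\<sigma>\<close> and
  the constant family \<open>F = A\<close>.\<close>

lemma twist_family:
  fixes m :: "'g \<Rightarrow> 'a \<Rightarrow> 'b"
  assumes "k_graph k \<Lambda>" "group G" "graph_functor \<Lambda> G \<eta>" "cocycle G \<omega>"
    and "cstar_algebra A" "cstar_algebra K" and T: "twisted_CK_family k \<Lambda> c A T"
    and F: "\<And>g. g \<in> carrier G \<Longrightarrow> lin_subspace A (F g)"
      "\<And>\<kappa>. \<kappa> \<in> paths \<Lambda> \<Longrightarrow> T \<kappa> \<in> F (\<eta> \<kappa>)"
      "\<And>\<kappa>. \<kappa> \<in> paths \<Lambda> \<Longrightarrow> adj A (T \<kappa>) \<in> F (inv\<^bsub>G\<^esub> \<eta> \<kappa>)"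
      "\<And>\<kappa>. \<kappa> \<in> paths \<Lambda> \<Longrightarrow> T \<kappa> \<otimes>\<^bsub>A\<^esub> adj A (T \<kappa>) \<in> F \<one>\<^bsub>G\<^esub>"
    and m: "\<And>g a. g \<in> carrier G \<Longrightarrow> a \<in> F g \<Longrightarrow> m g a \<in> carrier K"
      "\<And>g a b. g \<in> carrier G \<Longrightarrow> a \<in> F g \<Longrightarrow> b \<in> F g \<Longrightarrow> m g (a \<oplus>\<^bsub>A\<^esub> b) = m g a \<oplus>\<^bsub>K\<^esub> m g b"
      "\<And>g a z. g \<in> carrier G \<Longrightarrow> a \<in> F g \<Longrightarrow> m g (scale A z a) = scale K z (m g a)"
      "\<And>g h a b. g \<in> carrier G \<Longrightarrow> h \<in> carrier G \<Longrightarrow> a \<in> F g \<Longrightarrow> b \<in> F h \<Longrightarrow>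
        m g a \<otimes>\<^bsub>K\<^esub> m h b = m (g \<otimes>\<^bsub>G\<^esub> h) (scale A (\<omega> g h) (a \<otimes>\<^bsub>A\<^esub> b))"
      "\<And>g a. g \<in> carrier G \<Longrightarrow> a \<in> F g \<Longrightarrow>
        adj K (m g a) = m (inv\<^bsub>G\<^esub> g) (scale A (cnj (\<omega> g (inv\<^bsub>G\<^esub> g))) (adj A a))"
  shows "twisted_CK_family k \<Lambda> (\<lambda>\<kappa> \<mu>. \<omega> (\<eta> \<kappa>) (\<eta> \<mu>) * c \<kappa> \<mu>) K (\<lambda>\<kappa>. m (\<eta> \<kappa>) (T \<kappa>))"
proof -
  interpret \<Lambda>: k_graph k \<Lambda> by fact
  interpret G: group G by fact
  interpret A: cstar_algebra A by fact
  interpret K: cstar_algebra K by fact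
  note T = twisted_CK_familyD[OF T]
  note w = cocycleD[OF assms(4)]
  have \<eta>: "\<eta> \<kappa> \<in> carrier G" if "\<kappa> \<in> paths \<Lambda>" for \<kappa> using assms(3) that by (auto simp: graph_functor_def)
  have \<eta>c: "\<eta> (pcomp \<Lambda> \<kappa> \<mu>) = \<eta> \<kappa> \<otimes>\<^bsub>G\<^esub> \<eta> \<mu>"
    if "\<kappa> \<in> paths \<Lambda>" "\<mu> \<in> paths \<Lambda>" "rng \<Lambda> \<mu> = src \<Lambda> \<kappa>" for \<kappa> \<mu>
    using assms(3) that by (auto simp: graph_functor_def)
  have \<eta>v: "\<eta> v = \<one>\<^bsub>G\<^esub>" if "v \<in> vertices \<Lambda>" for v using assms(3) that by (auto simp: graph_functor_def)
  have vp: "v \<in> paths \<Lambda>" if "v \<in> vertices \<Lambda>" for v using that by (simp add: vertices_def)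
  note sub = A.subspaceD[OF F(1)]
  have Fv: "T v \<in> F \<one>\<^bsub>G\<^esub>" if "v \<in> vertices \<Lambda>" for v using F(2)[OF vp[OF that]] \<eta>v[OF that] by simp
  have m0: "m \<one>\<^bsub>G\<^esub> \<zero>\<^bsub>A\<^esub> = \<zero>\<^bsub>K\<^esub>"
    using m(3)[OF G.one_closed sub(2)[OF G.one_closed], of 0] m(1)[OF G.one_closed sub(2)[OF G.one_closed]]
    by simp
  \<comment> \<open>The product contributes the value of \<omega> at \<open>\<eta> \<kappa>\<close>
    and its inverse, the adjoint contributes its conjugate, and the two cancel.\<close>
  have star: "m (\<eta> \<kappa>) (T \<kappa>) \<otimes>\<^bsub>K\<^esub> adj K (m (\<eta> \<kappa>) (T \<kappa>)) = m \<one>\<^bsub>G\<^esub> (T \<kappa> \<otimes>\<^bsub>A\<^esub> adj A (T \<kappa>))"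
    if k: "\<kappa> \<in> paths \<Lambda>" for \<kappa>
  proof -
    let ?g = "\<eta> \<kappa>"
    have g: "?g \<in> carrier G" "inv\<^bsub>G\<^esub> ?g \<in> carrier G" using \<eta>[OF k] by auto
    have ta: "T \<kappa> \<in> carrier A" "adj A (T \<kappa>) \<in> carrier A" using T(1)[OF k] by auto
    have "m ?g (T \<kappa>) \<otimes>\<^bsub>K\<^esub> adj K (m ?g (T \<kappa>))
        = m (?g \<otimes>\<^bsub>G\<^esub> inv\<^bsub>G\<^esub> ?g) (scale A (\<omega> ?g (inv\<^bsub>G\<^esub> ?g))
          (T \<kappa> \<otimes>\<^bsub>A\<^esub> scale A (cnj (\<omega> ?g (inv\<^bsub>G\<^esub> ?g))) (adj A (T \<kappa>))))"
      unfolding m(5)[OF g(1) F(2)[OF k]]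
      by (rule m(4)[OF g F(2)[OF k] sub(4)[OF g(2) F(3)[OF k]]])
    also have "\<dots> = m \<one>\<^bsub>G\<^esub> (T \<kappa> \<otimes>\<^bsub>A\<^esub> adj A (T \<kappa>))"
      using ta g w(5)[OF g] by (simp add: A.mult_scale A.scale_scale A.scale_1 mult.commute)
    finally show ?thesis .
  qed
  show ?thesis unfolding twisted_CK_family_def
  proof (intro conjI ballI impI)
    show "(\<lambda>\<kappa>. m (\<eta> \<kappa>) (T \<kappa>)) \<in> paths \<Lambda> \<rightarrow> carrier K" using m(1) F(2) \<eta> by auto
  next
    fix v assume v: "v \<in> vertices \<Lambda>"
    have Tv: "T v \<in> carrier A" using T(1) vp[OF v] by blast
    show "m (\<eta> v) (T v) \<otimes>\<^bsub>K\<^esub> m (\<eta> v) (T v) = m (\<eta> v) (T v)"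
      using m(4)[OF G.one_closed G.one_closed Fv[OF v] Fv[OF v]] v Tv
      by (simp add: \<eta>v T(2) w(2) A.scale_1)
    show "adj K (m (\<eta> v) (T v)) = m (\<eta> v) (T v)"
      using m(5)[OF G.one_closed Fv[OF v]] v Tv by (simp add: \<eta>v T(3) w(2) A.scale_1)
  next
    fix v u assume v: "v \<in> vertices \<Lambda>" and u: "u \<in> vertices \<Lambda>" and "v \<noteq> u"
    then show "m (\<eta> v) (T v) \<otimes>\<^bsub>K\<^esub> m (\<eta> u) (T u) = \<zero>\<^bsub>K\<^esub>"
      using m(4)[OF G.one_closed G.one_closed Fv[OF v] Fv[OF u]]
      by (simp add: \<eta>v T(4) m0)
  next
    fix \<kappa> \<mu> assume k: "\<kappa> \<in> paths \<Lambda>" "\<mu> \<in> paths \<Lambda>" "rng \<Lambda> \<mu> = src \<Lambda> \<kappa>"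
    let ?p = "pcomp \<Lambda> \<kappa> \<mu>"
    have p: "?p \<in> paths \<Lambda>" using \<Lambda>.comp_in k by simp
    have "m (\<eta> \<kappa>) (T \<kappa>) \<otimes>\<^bsub>K\<^esub> m (\<eta> \<mu>) (T \<mu>)
        = m (\<eta> ?p) (scale A (\<omega> (\<eta> \<kappa>) (\<eta> \<mu>) * c \<kappa> \<mu>) (T ?p))"
      using m(4)[OF \<eta> \<eta> F(2) F(2), OF k(1,2,1,2)] T(1)[OF p] by (simp add: \<eta>c k T(5) A.scale_scale)
    also have "\<dots> = scale K (\<omega> (\<eta> \<kappa>) (\<eta> \<mu>) * c \<kappa> \<mu>) (m (\<eta> ?p) (T ?p))"
      by (rule m(3)[OF \<eta>[OF p] F(2)[OF p]])
    finally show "m (\<eta> \<kappa>) (T \<kappa>) \<otimes>\<^bsub>K\<^esub> m (\<eta> \<mu>) (T \<mu>)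
        = scale K (\<omega> (\<eta> \<kappa>) (\<eta> \<mu>) * c \<kappa> \<mu>) (m (\<eta> ?p) (T ?p))" .
  next
    fix \<kappa> assume k: "\<kappa> \<in> paths \<Lambda>"
    let ?g = "\<eta> \<kappa>"
    have g: "?g \<in> carrier G" "inv\<^bsub>G\<^esub> ?g \<in> carrier G" using \<eta>[OF k] by auto
    have ta: "T \<kappa> \<in> carrier A" "adj A (T \<kappa>) \<in> carrier A" "T (src \<Lambda> \<kappa>) \<in> carrier A"
      using T(1)[OF k] T(1)[OF \<Lambda>.src_in[OF k]] by auto
    have "adj K (m ?g (T \<kappa>)) \<otimes>\<^bsub>K\<^esub> m ?g (T \<kappa>)
        = m (inv\<^bsub>G\<^esub> ?g \<otimes>\<^bsub>G\<^esub> ?g) (scale A (\<omega> (inv\<^bsub>G\<^esub> ?g) ?g)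
          (scale A (cnj (\<omega> ?g (inv\<^bsub>G\<^esub> ?g))) (adj A (T \<kappa>)) \<otimes>\<^bsub>A\<^esub> T \<kappa>))"
      unfolding m(5)[OF g(1) F(2)[OF k]]
      by (rule m(4)[OF g(2,1) sub(4)[OF g(2) F(3)[OF k]] F(2)[OF k]])
    also have "\<dots> = m (\<eta> (src \<Lambda> \<kappa>)) (T (src \<Lambda> \<kappa>))"
      using ta g w(5)[OF g] k
      by (simp add: A.scale_mult A.scale_scale A.scale_1 T(6) \<eta>v \<Lambda>.vertex_in mult.commute
          cocycle_inv_sym[OF assms(2,4)])
    finally show "adj K (m ?g (T \<kappa>)) \<otimes>\<^bsub>K\<^esub> m ?g (T \<kappa>) = m (\<eta> (src \<Lambda> \<kappa>)) (T (src \<Lambda> \<kappa>))" .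
  next
    fix v n assume v: "v \<in> vertices \<Lambda>" and n: "n \<in> Nk k"
    let ?P = "paths_into \<Lambda> v n"
    have P: "\<kappa> \<in> paths \<Lambda>" if "\<kappa> \<in> ?P" for \<kappa> using that by (simp add: paths_into_def)
    \<comment> \<open>All range projections lie over the unit, whatever
      \<open>\<eta> \<kappa>\<close> is, so (CK4) is a sum within a single fibre, where
      \<open>m\<close> is additive.\<close>
    have "m (\<eta> v) (T v) = m \<one>\<^bsub>G\<^esub> (\<Oplus>\<^bsub>A\<^esub>\<kappa>\<in>?P. T \<kappa> \<otimes>\<^bsub>A\<^esub> adj A (T \<kappa>))"
      using T(7)[OF v n] \<eta>v[OF v] by simp
    also have "\<dots> = (\<Oplus>\<^bsub>K\<^esub>\<kappa>\<in>?P. m \<one>\<^bsub>G\<^esub> (T \<kappa> \<otimes>\<^bsub>A\<^esub> adj A (T \<kappa>)))"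
      by (rule finsum_additive_on[OF A.abelian_group_axioms K.abelian_group_axioms sub(1-3)])
         (use m(1,2) F(4) P in auto)
    also have "\<dots> = (\<Oplus>\<^bsub>K\<^esub>\<kappa>\<in>?P. m (\<eta> \<kappa>) (T \<kappa>) \<otimes>\<^bsub>K\<^esub> adj K (m (\<eta> \<kappa>) (T \<kappa>)))"
      using star P m(1) F(4) by (intro K.finsum_cong') auto
    finally show "m (\<eta> v) (T v) = (\<Oplus>\<^bsub>K\<^esub>\<kappa>\<in>?P. m (\<eta> \<kappa>) (T \<kappa>) \<otimes>\<^bsub>K\<^esub> adj K (m (\<eta> \<kappa>) (T \<kappa>)))" .
  qed
qed

lemma twisted_CK_family_cong:
  assumes "\<And>\<kappa> \<mu>. \<kappa> \<in> paths \<Lambda> \<Longrightarrow> \<mu> \<in> paths \<Lambda> \<Longrightarrow> c \<kappa> \<mu> = c' \<kappa> \<mu>"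
  shows "twisted_CK_family k \<Lambda> c A T \<longleftrightarrow> twisted_CK_family k \<Lambda> c' A T"
  unfolding twisted_CK_family_def by (simp add: assms cong: ball_cong)

text \<open>All relations are equations between elements of \<open>E\<close>, and the injective
  homomorphism \<open>j\<close> reflects equations.\<close>

lemma twisted_CK_family_inv_into:
  assumes "k_graph k \<Lambda>" "cstar_algebra E" "cstar_algebra K" and j: "cstar_hom E K j" "inj_on j (carrier E)"
    and V: "twisted_CK_family k \<Lambda> c K V" "V ` paths \<Lambda> \<subseteq> j ` carrier E"
  shows "twisted_CK_family k \<Lambda> c E (\<lambda>\<kappa>. inv_into (carrier E) j (V \<kappa>))"
proof -
  interpret \<Lambda>: k_graph k \<Lambda> by fact
  interpret E: cstar_algebra E by fact
  interpret K: cstar_algebra K by fact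
  note h = cstar_homD[OF j(1)]
  note T = twisted_CK_familyD[OF V(1)]
  let ?S = "\<lambda>\<kappa>. inv_into (carrier E) j (V \<kappa>)"
  have S: "?S \<kappa> \<in> carrier E" "j (?S \<kappa>) = V \<kappa>" if "\<kappa> \<in> paths \<Lambda>" for \<kappa>
    using V(2) that by (auto intro!: inv_into_into f_inv_into_f)
  have vp: "v \<in> paths \<Lambda>" if "v \<in> vertices \<Lambda>" for v using that by (simp add: vertices_def)
  have eq: "x = y" if "x \<in> carrier E" "y \<in> carrier E" "j x = j y" for x y
    using j(2) that by (auto dest: inj_onD)
  have z: "j \<zero>\<^bsub>E\<^esub> = \<zero>\<^bsub>K\<^esub>" by (rule cstar_hom_zero[OF E.pre_cstar_axioms K.pre_cstar_axioms j(1)])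
  show ?thesis unfolding twisted_CK_family_def
  proof (intro conjI ballI impI)
    fix v n assume v: "v \<in> vertices \<Lambda>" and n: "n \<in> Nk k"
    have P: "\<kappa> \<in> paths \<Lambda>" if "\<kappa> \<in> paths_into \<Lambda> v n" for \<kappa> using that by (simp add: paths_into_def)
    show "?S v = (\<Oplus>\<^bsub>E\<^esub>\<kappa>\<in>paths_into \<Lambda> v n. ?S \<kappa> \<otimes>\<^bsub>E\<^esub> adj E (?S \<kappa>))"
    proof (rule eq)
      show "(\<Oplus>\<^bsub>E\<^esub>\<kappa>\<in>paths_into \<Lambda> v n. ?S \<kappa> \<otimes>\<^bsub>E\<^esub> adj E (?S \<kappa>)) \<in> carrier E"
        using S P by (intro E.finsum_closed) auto
      have "j (\<Oplus>\<^bsub>E\<^esub>\<kappa>\<in>paths_into \<Lambda> v n. ?S \<kappa> \<otimes>\<^bsub>E\<^esub> adj E (?S \<kappa>))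
          = (\<Oplus>\<^bsub>K\<^esub>\<kappa>\<in>paths_into \<Lambda> v n. j (?S \<kappa> \<otimes>\<^bsub>E\<^esub> adj E (?S \<kappa>)))"
        using S P h by (intro finsum_additive[OF E.abelian_group_axioms K.abelian_group_axioms]) auto
      also have "\<dots> = (\<Oplus>\<^bsub>K\<^esub>\<kappa>\<in>paths_into \<Lambda> v n. V \<kappa> \<otimes>\<^bsub>K\<^esub> adj K (V \<kappa>))"
        using S P T(1) by (intro K.finsum_cong') (auto simp: h)
      finally show "j (?S v) = j (\<Oplus>\<^bsub>E\<^esub>\<kappa>\<in>paths_into \<Lambda> v n. ?S \<kappa> \<otimes>\<^bsub>E\<^esub> adj E (?S \<kappa>))"
        using T(7)[OF v n] S[OF vp[OF v]] by simp
    qed (use S vp v in blast)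
  qed (use S vp \<Lambda>.src_in \<Lambda>.comp_in in \<open>auto intro!: eq simp: h z T\<close>)
qed


section \<open>The deformed graph bundle and its representations\<close>

lemma fibre_deform_graph_bundle:
  "g \<in> carrier G \<Longrightarrow> fibre (deform G \<sigma> (graph_bundle G \<Lambda> \<eta> C s)) g = {g} \<times> graph_fibre G \<Lambda> \<eta> C s g"
  by (auto simp: fibre_def deform_def graph_bundle_def)

lemma deform_graph_bundle_sel:
  "badd (deform G \<sigma> (graph_bundle G \<Lambda> \<eta> C s)) (g, a) (h, b) = (g, a \<oplus>\<^bsub>C\<^esub> b)"
  "bscale (deform G \<sigma> (graph_bundle G \<Lambda> \<eta> C s)) z (g, a) = (g, scale C z a)"
  "bmult (deform G \<sigma> (graph_bundle G \<Lambda> \<eta> C s)) (g, a) (h, b) = (g \<otimes>\<^bsub>G\<^esub> h, scale C (\<sigma> g h) (a \<otimes>\<^bsub>C\<^esub> b))"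
  "badj (deform G \<sigma> (graph_bundle G \<Lambda> \<eta> C s)) (g, a)
    = (inv\<^bsub>G\<^esub> g, scale C (cnj (\<sigma> g (inv\<^bsub>G\<^esub> g))) (adj C a))"
  by (simp_all add: deform_def graph_bundle_def)

locale graph_setting = k_graph k \<Lambda> + G: group G + C: cstar_algebra C
  for k :: nat and \<Lambda> :: "'l graph_cat" and G :: "'g monoid" and C :: "'a cstar" +
  fixes \<eta> :: "'l \<Rightarrow> 'g" and s :: "'l \<Rightarrow> 'a" and \<sigma> :: "'g \<Rightarrow> 'g \<Rightarrow> complex"
  assumes \<eta>: "graph_functor \<Lambda> G \<eta>" and s: "CK_family k \<Lambda> C s" and \<sigma>: "cocycle G \<sigma>"
begin

definition fib_gens :: "'g \<Rightarrow> 'a set" where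
  "fib_gens g = {s \<kappa> \<otimes>\<^bsub>C\<^esub> adj C (s \<mu>) |\<kappa> \<mu>.
    \<kappa> \<in> paths \<Lambda> \<and> \<mu> \<in> paths \<Lambda> \<and> \<eta> \<kappa> \<otimes>\<^bsub>G\<^esub> inv\<^bsub>G\<^esub> \<eta> \<mu> = g}"

abbreviation fib :: "'g \<Rightarrow> 'a set" where "fib \<equiv> graph_fibre G \<Lambda> \<eta> C s"

lemma fib_eq: "fib g = norm_closure C (lin_span C (fib_gens g))"
  by (simp add: graph_fibre_def fib_gens_def)

lemmas s' = twisted_CK_familyD[OF s[unfolded CK_family_def]]

lemma \<eta>_in: "\<kappa> \<in> paths \<Lambda> \<Longrightarrow> \<eta> \<kappa> \<in> carrier G" using \<eta> by (auto simp: graph_functor_def)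

lemma \<eta>_vertex: "v \<in> vertices \<Lambda> \<Longrightarrow> \<eta> v = \<one>\<^bsub>G\<^esub>" using \<eta> by (auto simp: graph_functor_def)

lemma fib_gens_in: "fib_gens g \<subseteq> carrier C" using s'(1) by (auto simp: fib_gens_def)

lemma fib_subspace: "lin_subspace C (fib g)"
  unfolding fib_eq by (intro C.subspace_closure C.subspace_span fib_gens_in)

lemma fib_in: "b \<in> fib g \<Longrightarrow> b \<in> carrier C"
  using C.subspaceD(1)[OF fib_subspace] by blast

lemma fib_gens_fib: "fib_gens g \<subseteq> fib g"
  unfolding fib_eq using C.closure_subset[OF C.span_carrier[OF fib_gens_in]] C.span_superset by blast

lemma s_unit:
  assumes k: "\<kappa> \<in> paths \<Lambda>"
  shows "s (rng \<Lambda> \<kappa>) \<otimes>\<^bsub>C\<^esub> s \<kappa> = s \<kappa>" "s \<kappa> \<otimes>\<^bsub>C\<^esub> s (src \<Lambda> \<kappa>) = s \<kappa>"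
    "s (src \<Lambda> \<kappa>) \<otimes>\<^bsub>C\<^esub> adj C (s \<kappa>) = adj C (s \<kappa>)"
proof -
  show "s (rng \<Lambda> \<kappa>) \<otimes>\<^bsub>C\<^esub> s \<kappa> = s \<kappa>"
    using s'(5)[OF rng_in[OF k] k] k by (simp add: src_rng comp_rng C.scale_1 s'(1))
  show 2: "s \<kappa> \<otimes>\<^bsub>C\<^esub> s (src \<Lambda> \<kappa>) = s \<kappa>"
    using s'(5)[OF k src_in[OF k]] k by (simp add: rng_src comp_src C.scale_1 s'(1))
  have "adj C (s \<kappa> \<otimes>\<^bsub>C\<^esub> s (src \<Lambda> \<kappa>)) = adj C (s (src \<Lambda> \<kappa>)) \<otimes>\<^bsub>C\<^esub> adj C (s \<kappa>)"
    using k src_in[OF k] by (intro C.adj_mult s'(1))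
  then show "s (src \<Lambda> \<kappa>) \<otimes>\<^bsub>C\<^esub> adj C (s \<kappa>) = adj C (s \<kappa>)"
    unfolding 2 using s'(3)[OF vertex_in(2)[OF k]] by simp
qed

text \<open>The vertex projection at the source is self-adjoint, has degree \<one> and is a right
  unit for \<open>s \<kappa>\<close>; so \<open>s \<kappa>\<close> is itself one of the spanning
  products, with \<open>\<mu> = src \<Lambda> \<kappa>\<close>.\<close>

lemma s_fib:
  assumes k: "\<kappa> \<in> paths \<Lambda>"
  shows "s \<kappa> \<in> fib (\<eta> \<kappa>)" "adj C (s \<kappa>) \<in> fib (inv\<^bsub>G\<^esub> \<eta> \<kappa>)" "s \<kappa> \<otimes>\<^bsub>C\<^esub> adj C (s \<kappa>) \<in> fib \<one>\<^bsub>G\<^esub>"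
proof -
  note v = vertex_in(2)[OF k]
  have g: "\<eta> \<kappa> \<in> carrier G" "\<eta> (src \<Lambda> \<kappa>) = \<one>\<^bsub>G\<^esub>" "src \<Lambda> \<kappa> \<in> paths \<Lambda>"
    using \<eta>_in[OF k] \<eta>_vertex[OF v] src_in[OF k] by auto
  have "s \<kappa> = s \<kappa> \<otimes>\<^bsub>C\<^esub> adj C (s (src \<Lambda> \<kappa>))" using s_unit(2)[OF k] s'(3)[OF v] by simp
  then have "s \<kappa> \<in> fib_gens (\<eta> \<kappa>)"
    unfolding fib_gens_def using k g by (intro CollectI exI[of _ \<kappa>] exI[of _ "src \<Lambda> \<kappa>"]) auto
  then show "s \<kappa> \<in> fib (\<eta> \<kappa>)" using fib_gens_fib by blast
  have "adj C (s \<kappa>) \<in> fib_gens (inv\<^bsub>G\<^esub> \<eta> \<kappa>)"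
    unfolding fib_gens_def using k g s_unit(3)[OF k]
    by (intro CollectI exI[of _ "src \<Lambda> \<kappa>"] exI[of _ \<kappa>]) auto
  then show "adj C (s \<kappa>) \<in> fib (inv\<^bsub>G\<^esub> \<eta> \<kappa>)" using fib_gens_fib by blast
  have "s \<kappa> \<otimes>\<^bsub>C\<^esub> adj C (s \<kappa>) \<in> fib_gens \<one>\<^bsub>G\<^esub>"
    unfolding fib_gens_def using k g by (intro CollectI exI[of _ \<kappa>]) auto
  then show "s \<kappa> \<otimes>\<^bsub>C\<^esub> adj C (s \<kappa>) \<in> fib \<one>\<^bsub>G\<^esub>" using fib_gens_fib by blast
qed

abbreviation "B\<sigma> \<equiv> deform G \<sigma> (graph_bundle G \<Lambda> \<eta> C s)"

lemma fell_repD: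
  assumes \<pi>: "fell_rep G B\<sigma> D \<pi>" and g: "g \<in> carrier G" and a: "a \<in> fib g"
  shows "\<pi> g (g, a) \<in> carrier D"
    "\<pi> g (g, scale C z a) = scale D z (\<pi> g (g, a))"
    "adj D (\<pi> g (g, a)) = \<pi> (inv\<^bsub>G\<^esub> g) (inv\<^bsub>G\<^esub> g, scale C (cnj (\<sigma> g (inv\<^bsub>G\<^esub> g))) (adj C a))"
    "b \<in> fib g \<Longrightarrow> \<pi> g (g, a \<oplus>\<^bsub>C\<^esub> b) = \<pi> g (g, a) \<oplus>\<^bsub>D\<^esub> \<pi> g (g, b)"
    "h \<in> carrier G \<Longrightarrow> b \<in> fib h \<Longrightarrow> \<pi> g (g, a) \<otimes>\<^bsub>D\<^esub> \<pi> h (h, b)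
      = \<pi> (g \<otimes>\<^bsub>G\<^esub> h) (g \<otimes>\<^bsub>G\<^esub> h, scale C (\<sigma> g h) (a \<otimes>\<^bsub>C\<^esub> b))"
proof -
  have f: "(g, a) \<in> fibre B\<sigma> g \<longleftrightarrow> a \<in> fib g" if "g \<in> carrier G" for g a
    using that by (simp add: fibre_deform_graph_bundle)
  note r = \<pi>[unfolded fell_rep_def]
  have r1: "\<pi> g \<in> fibre B\<sigma> g \<rightarrow> carrier D" using r g by blast
  have r2: "\<pi> g (badd B\<sigma> b c) = \<pi> g b \<oplus>\<^bsub>D\<^esub> \<pi> g c" if "b \<in> fibre B\<sigma> g" "c \<in> fibre B\<sigma> g" for b c
    using r g that by blast
  have r3: "\<pi> g (bscale B\<sigma> z b) = scale D z (\<pi> g b)" if "b \<in> fibre B\<sigma> g" for b z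
    using r g that by metis
  have r4: "\<pi> (g \<otimes>\<^bsub>G\<^esub> h) (bmult B\<sigma> b c) = \<pi> g b \<otimes>\<^bsub>D\<^esub> \<pi> h c"
    if "h \<in> carrier G" "b \<in> fibre B\<sigma> g" "c \<in> fibre B\<sigma> h" for b c h
    using r g that by blast
  have r5: "adj D (\<pi> g b) = \<pi> (inv\<^bsub>G\<^esub> g) (badj B\<sigma> b)" if "b \<in> fibre B\<sigma> g" for b
    using r g that by blast
  show "\<pi> g (g, a) \<in> carrier D" using r1 a f[OF g] by auto
  show "\<pi> g (g, scale C z a) = scale D z (\<pi> g (g, a))"
    using r3[of "(g, a)" z] a f[OF g] by (simp add: deform_graph_bundle_sel)
  show "adj D (\<pi> g (g, a)) = \<pi> (inv\<^bsub>G\<^esub> g) (inv\<^bsub>G\<^esub> g, scale C (cnj (\<sigma> g (inv\<^bsub>G\<^esub> g))) (adj C a))"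
    using r5[of "(g, a)"] a f[OF g] by (simp add: deform_graph_bundle_sel)
  show "\<pi> g (g, a \<oplus>\<^bsub>C\<^esub> b) = \<pi> g (g, a) \<oplus>\<^bsub>D\<^esub> \<pi> g (g, b)" if "b \<in> fib g"
    using r2[of "(g, a)" "(g, b)"] a that f[OF g] by (simp add: deform_graph_bundle_sel)
  show "\<pi> g (g, a) \<otimes>\<^bsub>D\<^esub> \<pi> h (h, b)
      = \<pi> (g \<otimes>\<^bsub>G\<^esub> h) (g \<otimes>\<^bsub>G\<^esub> h, scale C (\<sigma> g h) (a \<otimes>\<^bsub>C\<^esub> b))" if "h \<in> carrier G" "b \<in> fib h"
    using r4[of h "(g, a)" "(h, b)"] a that f by (simp add: deform_graph_bundle_sel f[OF g])
qed

text \<open>Here the initial family is untwisted, and the whole scalar in (CK2) is the one that the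
  deformed product puts in.\<close>

lemma canonical_family:
  assumes "cstar_algebra D" and \<pi>: "fell_rep G B\<sigma> D \<pi>"
  shows "twisted_CK_family k \<Lambda> (\<lambda>\<kappa> \<mu>. \<sigma> (\<eta> \<kappa>) (\<eta> \<mu>)) D (\<lambda>\<kappa>. \<pi> (\<eta> \<kappa>) (\<eta> \<kappa>, s \<kappa>))"
proof -
  have "twisted_CK_family k \<Lambda> (\<lambda>\<kappa> \<mu>. \<sigma> (\<eta> \<kappa>) (\<eta> \<mu>) * 1) D (\<lambda>\<kappa>. \<pi> (\<eta> \<kappa>) (\<eta> \<kappa>, s \<kappa>))"
  proof (rule twist_family[where F = fib and m = "\<lambda>g a. \<pi> g (g, a)", OF k_graph_axioms G.is_group \<eta> \<sigma>
        C.cstar_algebra_axioms assms(1) s[unfolded CK_family_def] fib_subspace s_fib])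
  qed (assumption | rule fell_repD[OF \<pi>])+
  then show ?thesis by simp
qed

text \<open>A representation of the deformed bundle on untagged fibres: the arguments on the left
  are the deformed product and the deformed adjoint. Nondegeneracy is left out because it can fail
  in \<open>A\<close>. The contractivity clause is what lets \<open>corestriction\<close> argue by
  density inside a fibre.\<close>

definition graded_rep :: "'d cstar \<Rightarrow> ('g \<Rightarrow> 'a \<Rightarrow> 'd) \<Rightarrow> bool" where
  "graded_rep A \<psi> \<longleftrightarrow>
    (\<forall>g\<in>carrier G. \<forall>b\<in>fib g. \<psi> g b \<in> carrier A) \<and>
    (\<forall>g\<in>carrier G. \<forall>b\<in>fib g. \<forall>c\<in>fib g. \<psi> g (b \<oplus>\<^bsub>C\<^esub> c) = \<psi> g b \<oplus>\<^bsub>A\<^esub> \<psi> g c) \<and>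
    (\<forall>g\<in>carrier G. \<forall>b\<in>fib g. \<forall>z. \<psi> g (scale C z b) = scale A z (\<psi> g b)) \<and>
    (\<forall>g\<in>carrier G. \<forall>h\<in>carrier G. \<forall>b\<in>fib g. \<forall>c\<in>fib h.
      \<psi> (g \<otimes>\<^bsub>G\<^esub> h) (scale C (\<sigma> g h) (b \<otimes>\<^bsub>C\<^esub> c)) = \<psi> g b \<otimes>\<^bsub>A\<^esub> \<psi> h c) \<and>
    (\<forall>g\<in>carrier G. \<forall>b\<in>fib g.
      \<psi> (inv\<^bsub>G\<^esub> g) (scale C (cnj (\<sigma> g (inv\<^bsub>G\<^esub> g))) (adj C b)) = adj A (\<psi> g b)) \<and>
    (\<forall>g\<in>carrier G. \<forall>b\<in>fib g. \<forall>c\<in>fib g.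
      cnorm A (\<psi> g b \<ominus>\<^bsub>A\<^esub> \<psi> g c) \<le> cnorm C (b \<ominus>\<^bsub>C\<^esub> c))"

text \<open>\<psi> is obtained from a homomorphism on all of the graph algebra, so relations and
  limits among the products in a fibre cause no ambiguity. Its contractivity is that of
  \<open>\<Phi>\<close> combined with isometry of each \<open>m g\<close>.\<close>

lemma graded_map:
  fixes A :: "'d cstar"
  assumes univ: "\<And>(E :: 'l test_elem cstar) S. cstar_algebra E \<Longrightarrow> CK_family k \<Lambda> E S \<Longrightarrow>
      \<exists>\<rho>. cstar_hom C E \<rho> \<and> (\<forall>\<kappa>\<in>paths \<Lambda>. \<rho> (s \<kappa>) = S \<kappa>)"
    and A: "cstar_algebra A" and T: "twisted_CK_family k \<Lambda> (\<lambda>\<kappa> \<mu>. \<sigma> (\<eta> \<kappa>) (\<eta> \<mu>)) A T"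
  obtains \<psi> where "graded_rep A \<psi>"
    "\<And>\<kappa>. \<kappa> \<in> paths \<Lambda> \<Longrightarrow> \<psi> (\<eta> \<kappa>) (s \<kappa>) = T \<kappa>"
proof -
  interpret A: cstar_algebra A by fact
  let ?\<omega> = "\<lambda>g h. cnj (\<sigma> g h)"
  have \<omega>: "cocycle G ?\<omega>" by (rule cocycle_cnj[OF \<sigma>])
  note T' = twisted_CK_familyD[OF T]
  obtain K :: "(nat \<Rightarrow> (('g \<Rightarrow> complex \<times> 'd) \<Rightarrow> 'g \<Rightarrow> complex \<times> 'd) \<times>
      (('g \<Rightarrow> complex \<times> 'd) \<Rightarrow> 'g \<Rightarrow> complex \<times> 'd)) set cstar" and m
    where K: "cstar_algebra K"
    and m: "\<And>g a. g \<in> carrier G \<Longrightarrow> a \<in> carrier A \<Longrightarrow> m g a \<in> carrier K"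
    "\<And>g a b. g \<in> carrier G \<Longrightarrow> a \<in> carrier A \<Longrightarrow> b \<in> carrier A \<Longrightarrow> m g (a \<oplus>\<^bsub>A\<^esub> b) = m g a \<oplus>\<^bsub>K\<^esub> m g b"
    "\<And>g a z. g \<in> carrier G \<Longrightarrow> a \<in> carrier A \<Longrightarrow> m g (scale A z a) = scale K z (m g a)"
    "\<And>g h a b. g \<in> carrier G \<Longrightarrow> h \<in> carrier G \<Longrightarrow> a \<in> carrier A \<Longrightarrow> b \<in> carrier A \<Longrightarrow>
      m g a \<otimes>\<^bsub>K\<^esub> m h b = scale K (?\<omega> g h) (m (g \<otimes>\<^bsub>G\<^esub> h) (a \<otimes>\<^bsub>A\<^esub> b))"
    "\<And>g a. g \<in> carrier G \<Longrightarrow> a \<in> carrier A \<Longrightarrow>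
      adj K (m g a) = scale K (cnj (?\<omega> g (inv\<^bsub>G\<^esub> g))) (m (inv\<^bsub>G\<^esub> g) (adj A a))"
    "\<And>g a. g \<in> carrier G \<Longrightarrow> a \<in> carrier A \<Longrightarrow> cnorm K (m g a) = cnorm A a"
    by (rule twisted_regular_representation[OF A G.is_group \<omega>]) blast
  interpret K: cstar_algebra K by fact
  have m_minus: "m g (a \<ominus>\<^bsub>A\<^esub> b) = m g a \<ominus>\<^bsub>K\<^esub> m g b"
    if "g \<in> carrier G" "a \<in> carrier A" "b \<in> carrier A" for g a b
    using m(2)[OF that(1,2), of "\<ominus>\<^bsub>A\<^esub> b"] m(3)[OF that(1,3), of "-1"] m(1)[OF that(1,3)] that
    by (simp add: a_minus_def A.scale_minus_one K.scale_minus_one)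
  have m_inj: "a = b" if "g \<in> carrier G" "a \<in> carrier A" "b \<in> carrier A" "m g a = m g b" for g a b
  proof -
    have "cnorm A (a \<ominus>\<^bsub>A\<^esub> b) = cnorm K (m g a \<ominus>\<^bsub>K\<^esub> m g b)"
      using that m(6)[OF that(1), of "a \<ominus>\<^bsub>A\<^esub> b"] by (simp add: m_minus)
    also have "\<dots> = 0" using K.norm_minus_eq_zero m(1) that by metis
    finally show ?thesis using A.norm_minus_eq_zero that by blast
  qed
  define V where "V \<kappa> = m (\<eta> \<kappa>) (T \<kappa>)" for \<kappa>
  have "twisted_CK_family k \<Lambda> (\<lambda>\<kappa> \<mu>. ?\<omega> (\<eta> \<kappa>) (\<eta> \<mu>) * \<sigma> (\<eta> \<kappa>) (\<eta> \<mu>)) K V"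
    unfolding V_def
  proof (rule twist_family[where F = "\<lambda>g. carrier A", OF k_graph_axioms G.is_group \<eta> \<omega> A K T])
    show "lin_subspace A (carrier A)" by (simp add: lin_subspace_def)
    show "m g a \<otimes>\<^bsub>K\<^esub> m h b = m (g \<otimes>\<^bsub>G\<^esub> h) (scale A (?\<omega> g h) (a \<otimes>\<^bsub>A\<^esub> b))"
      if "g \<in> carrier G" "h \<in> carrier G" "a \<in> carrier A" "b \<in> carrier A" for g h a b
      using that by (simp add: m)
    show "adj K (m g a) = m (inv\<^bsub>G\<^esub> g) (scale A (cnj (?\<omega> g (inv\<^bsub>G\<^esub> g))) (adj A a))"
      if "g \<in> carrier G" "a \<in> carrier A" for g a
      using that by (simp add: m)
  qed (use T'(1) m in auto)
  \<comment> \<open>The scalar of the family \<open>V\<close> is the product of a value of \<sigma>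
    with its conjugate, hence 1.\<close>
  then have V: "CK_family k \<Lambda> K V"
    unfolding CK_family_def
    by (subst twisted_CK_family_cong[where c' = "\<lambda>\<kappa> \<mu>. ?\<omega> (\<eta> \<kappa>) (\<eta> \<mu>) * \<sigma> (\<eta> \<kappa>) (\<eta> \<mu>)"])
       (simp_all add: cocycleD(5)[OF \<sigma>] \<eta>_in)
  note V' = twisted_CK_familyD[OF V[unfolded CK_family_def]]
  \<comment> \<open>\<open>K\<close> is not carried by the test type of the graph algebra; the
    C*-subalgebra generated by \<open>V\<close> has a copy \<open>E\<close> that is, and
    \<open>j\<close> leads back to \<open>K\<close>.\<close>
  obtain E :: "'l test_elem cstar" and j where E: "cstar_algebra E" "cstar_hom E K j" "inj_on j (carrier E)"
    "V ` paths \<Lambda> \<subseteq> j ` carrier E"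
    using K.generated_test_algebra[of "paths \<Lambda>" V, OF V'(1)] by metis
  interpret E: cstar_algebra E by fact
  let ?S = "\<lambda>\<kappa>. inv_into (carrier E) j (V \<kappa>)"
  have "CK_family k \<Lambda> E ?S"
    using twisted_CK_family_inv_into[OF k_graph_axioms E(1) K E(2,3) _ E(4)] V by (simp add: CK_family_def)
  then obtain \<rho> where \<rho>: "cstar_hom C E \<rho>" "\<And>\<kappa>. \<kappa> \<in> paths \<Lambda> \<Longrightarrow> \<rho> (s \<kappa>) = ?S \<kappa>"
    using univ[OF E(1)] by metis
  define \<Phi> where "\<Phi> = j \<circ> \<rho>"
  have \<Phi>: "cstar_hom C K \<Phi>" unfolding \<Phi>_def by (rule cstar_hom_comp[OF \<rho>(1) E(2)])
  note h = cstar_homD[OF \<Phi>]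
  have \<Phi>s: "\<Phi> (s \<kappa>) = V \<kappa>" if "\<kappa> \<in> paths \<Lambda>" for \<kappa>
    using \<rho>(2)[OF that] E(4) that f_inv_into_f[of "V \<kappa>" j "carrier E"] by (auto simp: \<Phi>_def)
  have \<Phi>_lip: "cnorm K (\<Phi> a \<ominus>\<^bsub>K\<^esub> \<Phi> b) \<le> 1 * cnorm C (a \<ominus>\<^bsub>C\<^esub> b)" if "a \<in> carrier C" "b \<in> carrier C" for a b
    using cstar_hom_contractive[OF C.cstar_algebra_axioms K \<Phi>, of "a \<ominus>\<^bsub>C\<^esub> b"] that
      cstar_hom_minus[OF C.pre_cstar_axioms K.pre_cstar_axioms \<Phi> that] by simp
  \<comment> \<open>The image of \<open>m g\<close> is a closed subspace, so by continuity and
    linearity of \<open>\<Phi>\<close> it suffices to look at the spanning products.\<close>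
  have range: "\<Phi> b \<in> m g ` carrier A" if g: "g \<in> carrier G" and b: "b \<in> fib g" for g b
  proof (rule closure_preimage[OF C.pre_cstar_axioms K.pre_cstar_axioms _ subset_refl h(1) \<Phi>_lip])
    show "lin_span C (fib_gens g) \<subseteq> carrier C" by (rule C.span_carrier[OF fib_gens_in])
    show "m g ` carrier A \<subseteq> carrier K" using m(1) g by auto
    show "norm_closure K (m g ` carrier A) \<subseteq> m g ` carrier A"
    proof (rule complete_image_closed[OF A K subset_refl A.closure_in_carrier])
      show "cnorm K (m g a \<ominus>\<^bsub>K\<^esub> m g b) = cnorm A (a \<ominus>\<^bsub>A\<^esub> b)" if "a \<in> carrier A" "b \<in> carrier A" for a b
        using m(6)[OF g, of "a \<ominus>\<^bsub>A\<^esub> b"] that by (simp add: m_minus g)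
    qed (use m(1) g in blast)
    show "b \<in> norm_closure C (lin_span C (fib_gens g))" using b by (simp add: fib_eq)
    show "b \<in> carrier C" using b by (rule fib_in)
    let ?Z = "{b \<in> carrier C. \<Phi> b \<in> m g ` carrier A}"
    have "lin_subspace C ?Z" unfolding lin_subspace_def
    proof (intro conjI ballI allI)
      have "m g \<zero>\<^bsub>A\<^esub> = \<zero>\<^bsub>K\<^esub>" using m(3)[OF g A.zero_closed, of 0] m(1)[OF g A.zero_closed] by simp
      then show "\<zero>\<^bsub>C\<^esub> \<in> ?Z"
        using cstar_hom_zero[OF C.pre_cstar_axioms K.pre_cstar_axioms \<Phi>]
        by (auto intro!: image_eqI[of _ _ "\<zero>\<^bsub>A\<^esub>"])
      fix a assume "a \<in> ?Z"
      then obtain x where x: "a \<in> carrier C" "\<Phi> a = m g x" "x \<in> carrier A" by blast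
      show "scale C z a \<in> ?Z" for z
        using x g by (auto simp: h(3) m(3)[symmetric] intro!: imageI)
      fix b assume "b \<in> ?Z"
      then obtain y where y: "b \<in> carrier C" "\<Phi> b = m g y" "y \<in> carrier A" by blast
      show "a \<oplus>\<^bsub>C\<^esub> b \<in> ?Z"
        using x y g by (auto simp: h(2) m(2)[symmetric] intro!: imageI)
    qed auto
    moreover have "fib_gens g \<subseteq> ?Z"
    proof
      fix a assume "a \<in> fib_gens g"
      then obtain \<kappa> \<mu> where km: "\<kappa> \<in> paths \<Lambda>" "\<mu> \<in> paths \<Lambda>" "\<eta> \<kappa> \<otimes>\<^bsub>G\<^esub> inv\<^bsub>G\<^esub> \<eta> \<mu> = g"
        "a = s \<kappa> \<otimes>\<^bsub>C\<^esub> adj C (s \<mu>)" by (auto simp: fib_gens_def)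
      \<comment> \<open>The adjoint of \<open>V \<mu>\<close> contributes the conjugate of a value
        of \<open>?\<omega>\<close>, that is, a value of \<sigma>; the product contributes a value
        of \<open>?\<omega>\<close>. The group elements multiply to \<open>g\<close>, and
        \<open>m g\<close> absorbs the scalars by linearity.\<close>
      have "\<Phi> a = V \<kappa> \<otimes>\<^bsub>K\<^esub> adj K (V \<mu>)"
        using km s'(1) by (simp add: h \<Phi>s)
      also have "\<dots> = scale K (\<sigma> (\<eta> \<mu>) (inv\<^bsub>G\<^esub> \<eta> \<mu>) * ?\<omega> (\<eta> \<kappa>) (inv\<^bsub>G\<^esub> \<eta> \<mu>)) (m g (T \<kappa> \<otimes>\<^bsub>A\<^esub> adj A (T \<mu>)))"
        using km g T'(1) \<eta>_in by (simp add: V_def m K.mult_scale K.scale_scale)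
      also have "\<dots> = m g (scale A (\<sigma> (\<eta> \<mu>) (inv\<^bsub>G\<^esub> \<eta> \<mu>) * ?\<omega> (\<eta> \<kappa>) (inv\<^bsub>G\<^esub> \<eta> \<mu>)) (T \<kappa> \<otimes>\<^bsub>A\<^esub> adj A (T \<mu>)))"
        using km g T'(1) by (simp add: m(3))
      finally show "a \<in> ?Z" using km T'(1) s'(1) by auto
    qed
    ultimately have "lin_span C (fib_gens g) \<subseteq> ?Z" by (rule C.span_least)
    then show "\<Phi> a \<in> m g ` carrier A" if "a \<in> lin_span C (fib_gens g)" for a using that by blast
  qed
  define \<psi> where "\<psi> g b = inv_into (carrier A) (m g) (\<Phi> b)" for g b
  have \<psi>: "\<psi> g b \<in> carrier A" "m g (\<psi> g b) = \<Phi> b" if "g \<in> carrier G" "b \<in> fib g" for g b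
    unfolding \<psi>_def by (rule inv_into_into[OF range[OF that]], rule f_inv_into_f[OF range[OF that]])
  have \<psi>I: "\<psi> g b = a" if "g \<in> carrier G" "a \<in> carrier A" "\<Phi> b = m g a" for g b a
    unfolding \<psi>_def that(3) using m_inj that(1,2) by (intro inv_into_f_f inj_onI) auto
  show ?thesis
  proof (rule that[of \<psi>], unfold graded_rep_def, intro conjI ballI allI)
    fix g b assume g: "g \<in> carrier G" and b: "b \<in> fib g"
    note bc = fib_in[OF b]
    show "\<psi> g b \<in> carrier A" by (rule \<psi>(1)[OF g b])
    show "\<psi> g (scale C z b) = scale A z (\<psi> g b)" for z
      using g \<psi>[OF g b] by (intro \<psi>I) (simp_all add: m(3) h(3) bc)
    show "\<psi> (inv\<^bsub>G\<^esub> g) (scale C (cnj (\<sigma> g (inv\<^bsub>G\<^esub> g))) (adj C b)) = adj A (\<psi> g b)"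
    proof (rule \<psi>I)
      \<comment> \<open>The conjugate of \<sigma> in the deformed adjoint meets the value of
        \<sigma> produced by the adjoint of \<open>m g\<close>, and they cancel.\<close>
      have "\<Phi> (scale C (cnj (\<sigma> g (inv\<^bsub>G\<^esub> g))) (adj C b)) = scale K (cnj (\<sigma> g (inv\<^bsub>G\<^esub> g))) (adj K (m g (\<psi> g b)))"
        using bc \<psi>(2)[OF g b] by (simp add: h)
      also have "\<dots> = m (inv\<^bsub>G\<^esub> g) (adj A (\<psi> g b))"
        using g \<psi>(1)[OF g b] m(1)[OF G.inv_closed[OF g] A.adj_in[OF \<psi>(1)[OF g b]]]
        by (simp add: m(5) K.scale_scale cocycleD(5)[OF \<sigma>] K.scale_1)
      finally show "\<Phi> (scale C (cnj (\<sigma> g (inv\<^bsub>G\<^esub> g))) (adj C b)) = m (inv\<^bsub>G\<^esub> g) (adj A (\<psi> g b))" .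
    qed (use g \<psi>[OF g b] in auto)
    { fix c assume c: "c \<in> fib g"
      note cc = fib_in[OF c]
      show "\<psi> g (b \<oplus>\<^bsub>C\<^esub> c) = \<psi> g b \<oplus>\<^bsub>A\<^esub> \<psi> g c"
        using g \<psi>[OF g b] \<psi>[OF g c] by (intro \<psi>I) (simp_all add: m(2) h(2) bc cc)
      have "cnorm A (\<psi> g b \<ominus>\<^bsub>A\<^esub> \<psi> g c) = cnorm K (\<Phi> b \<ominus>\<^bsub>K\<^esub> \<Phi> c)"
        using m(6)[OF g, of "\<psi> g b \<ominus>\<^bsub>A\<^esub> \<psi> g c"] \<psi>[OF g b] \<psi>[OF g c] by (simp add: m_minus g)
      then show "cnorm A (\<psi> g b \<ominus>\<^bsub>A\<^esub> \<psi> g c) \<le> cnorm C (b \<ominus>\<^bsub>C\<^esub> c)" using \<Phi>_lip[OF bc cc] by simp }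
    fix k c assume k: "k \<in> carrier G" and c: "c \<in> fib k"
    note cc = fib_in[OF c]
    have gk: "g \<otimes>\<^bsub>G\<^esub> k \<in> carrier G" using g k by simp
    show "\<psi> (g \<otimes>\<^bsub>G\<^esub> k) (scale C (\<sigma> g k) (b \<otimes>\<^bsub>C\<^esub> c)) = \<psi> g b \<otimes>\<^bsub>A\<^esub> \<psi> k c"
    proof (rule \<psi>I[OF gk])
      have "\<Phi> (scale C (\<sigma> g k) (b \<otimes>\<^bsub>C\<^esub> c)) = scale K (\<sigma> g k) (m g (\<psi> g b) \<otimes>\<^bsub>K\<^esub> m k (\<psi> k c))"
        using bc cc \<psi>(2)[OF g b] \<psi>(2)[OF k c] by (simp add: h)
      also have "\<dots> = m (g \<otimes>\<^bsub>G\<^esub> k) (\<psi> g b \<otimes>\<^bsub>A\<^esub> \<psi> k c)"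
        using g k \<psi>(1)[OF g b] \<psi>(1)[OF k c] m(1)[OF gk A.mult_in[OF \<psi>(1)[OF g b] \<psi>(1)[OF k c]]]
          cocycleD(5)[OF \<sigma> g k]
        by (simp add: m(4) K.scale_scale K.scale_1 mult.commute)
      finally show "\<Phi> (scale C (\<sigma> g k) (b \<otimes>\<^bsub>C\<^esub> c)) = m (g \<otimes>\<^bsub>G\<^esub> k) (\<psi> g b \<otimes>\<^bsub>A\<^esub> \<psi> k c)" .
    qed (use \<psi>(1)[OF g b] \<psi>(1)[OF k c] in simp)
  next
    fix \<kappa> assume "\<kappa> \<in> paths \<Lambda>"
    then show "\<psi> (\<eta> \<kappa>) (s \<kappa>) = T \<kappa>" using \<eta>_in T'(1) by (intro \<psi>I) (auto simp: \<Phi>s V_def)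
  qed
qed

text \<open>Nondegeneracy: the closed right ideal \<open>N\<close> generated by the values of \<open>\<psi>\<close> over the unit contains
  all values of \<open>\<psi>\<close> and their adjoints, because the vertex projections are local units.\<close>

lemma corestriction:
  fixes A :: "'d cstar"
  assumes A: "cstar_algebra A"
    and "graded_rep A \<psi>"
  obtains E :: "('g \<times> 'a) test_elem cstar" and j \<pi> where "cstar_algebra E" "cstar_hom E A j"
    "fell_rep G B\<sigma> E \<pi>" "\<And>g b. g \<in> carrier G \<Longrightarrow> b \<in> fib g \<Longrightarrow> j (\<pi> g (g, b)) = \<psi> g b"
proof -
  interpret A: cstar_algebra A by fact
  have \<psi>: "\<And>g b. g \<in> carrier G \<Longrightarrow> b \<in> fib g \<Longrightarrow> \<psi> g b \<in> carrier A"
    "\<And>g b c. g \<in> carrier G \<Longrightarrow> b \<in> fib g \<Longrightarrow> c \<in> fib g \<Longrightarrow> \<psi> g (b \<oplus>\<^bsub>C\<^esub> c) = \<psi> g b \<oplus>\<^bsub>A\<^esub> \<psi> g c"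
    "\<And>g b z. g \<in> carrier G \<Longrightarrow> b \<in> fib g \<Longrightarrow> \<psi> g (scale C z b) = scale A z (\<psi> g b)"
    "\<And>g h b c. g \<in> carrier G \<Longrightarrow> h \<in> carrier G \<Longrightarrow> b \<in> fib g \<Longrightarrow> c \<in> fib h \<Longrightarrow>
      \<psi> (g \<otimes>\<^bsub>G\<^esub> h) (scale C (\<sigma> g h) (b \<otimes>\<^bsub>C\<^esub> c)) = \<psi> g b \<otimes>\<^bsub>A\<^esub> \<psi> h c"
    "\<And>g b. g \<in> carrier G \<Longrightarrow> b \<in> fib g \<Longrightarrow>
      \<psi> (inv\<^bsub>G\<^esub> g) (scale C (cnj (\<sigma> g (inv\<^bsub>G\<^esub> g))) (adj C b)) = adj A (\<psi> g b)"
    "\<And>g b c. g \<in> carrier G \<Longrightarrow> b \<in> fib g \<Longrightarrow> c \<in> fib g \<Longrightarrow>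
      cnorm A (\<psi> g b \<ominus>\<^bsub>A\<^esub> \<psi> g c) \<le> cnorm C (b \<ominus>\<^bsub>C\<^esub> c)"
    using assms(2) by (simp_all add: graded_rep_def)
  \<comment> \<open>Tagging with the group element keeps apart equal elements of different fibres,
    on which \<psi> may take different values.\<close>
  define J where "J = (SIGMA g : carrier G. fib g)"
  define x where "x p = \<psi> (fst p) (snd p)" for p
  have xA: "x p \<in> carrier A" if "p \<in> J" for p using that \<psi>(1) by (auto simp: J_def x_def)
  obtain E :: "('g \<times> 'a) test_elem cstar" and j where E: "cstar_algebra E" "cstar_hom E A j" "inj_on j (carrier E)"
    "x ` J \<subseteq> j ` carrier E"
    and min: "\<And>S. cstar_subalgebra A S \<Longrightarrow> x ` J \<subseteq> S \<Longrightarrow> j ` carrier E \<subseteq> S"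
    and iso: "\<And>e. cnorm E e = cnorm A (j e)"
    using A.generated_test_algebra[of J x, OF xA] by metis
  interpret E: cstar_algebra E by fact
  note h = cstar_homD[OF E(2)]
  have j_minus: "j (a \<ominus>\<^bsub>E\<^esub> b) = j a \<ominus>\<^bsub>A\<^esub> j b" if "a \<in> carrier E" "b \<in> carrier E" for a b
    by (rule cstar_hom_minus[OF E.pre_cstar_axioms A.pre_cstar_axioms E(2) that])
  have j0: "j \<zero>\<^bsub>E\<^esub> = \<zero>\<^bsub>A\<^esub>" by (rule cstar_hom_zero[OF E.pre_cstar_axioms A.pre_cstar_axioms E(2)])
  have j_inj: "a = b" if "a \<in> carrier E" "b \<in> carrier E" "j a = j b" for a b
    using E(3) that by (auto dest: inj_onD)
  define \<phi> where "\<phi> g b = inv_into (carrier E) j (\<psi> g b)" for g b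
  have \<phi>: "\<phi> g b \<in> carrier E" "j (\<phi> g b) = \<psi> g b" if "g \<in> carrier G" "b \<in> fib g" for g b
  proof -
    have *: "\<psi> g b \<in> j ` carrier E" using E(4) that by (force simp: J_def x_def)
    show "\<phi> g b \<in> carrier E" unfolding \<phi>_def by (rule inv_into_into[OF *])
    show "j (\<phi> g b) = \<psi> g b" unfolding \<phi>_def by (rule f_inv_into_f[OF *])
  qed
  have \<phi>I: "\<phi> g b = e" if "e \<in> carrier E" "\<psi> g b = j e" for g b e
    unfolding \<phi>_def that(2) by (rule inv_into_f_f[OF E(3) that(1)])
  have \<phi>_plus: "\<phi> g (b \<oplus>\<^bsub>C\<^esub> c) = \<phi> g b \<oplus>\<^bsub>E\<^esub> \<phi> g c" if "g \<in> carrier G" "b \<in> fib g" "c \<in> fib g" for g b c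
    using \<phi>[OF that(1,2)] \<phi>[OF that(1,3)] by (intro \<phi>I) (simp_all add: h \<psi>(2)[OF that])
  have \<phi>_scale: "\<phi> g (scale C z b) = scale E z (\<phi> g b)" if "g \<in> carrier G" "b \<in> fib g" for g b z
    using \<phi>[OF that] by (intro \<phi>I) (simp_all add: h \<psi>(3)[OF that])
  have \<phi>_mult: "\<phi> (g \<otimes>\<^bsub>G\<^esub> k) (scale C (\<sigma> g k) (b \<otimes>\<^bsub>C\<^esub> c)) = \<phi> g b \<otimes>\<^bsub>E\<^esub> \<phi> k c"
    if "g \<in> carrier G" "k \<in> carrier G" "b \<in> fib g" "c \<in> fib k" for g k b c
    using \<phi>[OF that(1,3)] \<phi>[OF that(2,4)] by (intro \<phi>I) (simp_all add: h \<psi>(4)[OF that])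
  have \<phi>_adj: "\<phi> (inv\<^bsub>G\<^esub> g) (scale C (cnj (\<sigma> g (inv\<^bsub>G\<^esub> g))) (adj C b)) = adj E (\<phi> g b)"
    if "g \<in> carrier G" "b \<in> fib g" for g b
    using \<phi>[OF that] by (intro \<phi>I) (simp_all add: h \<psi>(5)[OF that])
  have \<phi>_lip: "cnorm E (\<phi> g b \<ominus>\<^bsub>E\<^esub> \<phi> g c) \<le> 1 * cnorm C (b \<ominus>\<^bsub>C\<^esub> c)"
    if "g \<in> carrier G" "b \<in> fib g" "c \<in> fib g" for g b c
    using \<phi>[OF that(1,2)] \<phi>[OF that(1,3)] \<psi>(6)[OF that] by (simp add: iso j_minus)
  \<comment> \<open>\<open>N\<close> is the closed span in the nondegeneracy axiom; what follows
    shows that it is all of \<open>E\<close>.\<close>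
  define Y where "Y = {\<phi> \<one>\<^bsub>G\<^esub> b \<otimes>\<^bsub>E\<^esub> y |b y. b \<in> fib \<one>\<^bsub>G\<^esub> \<and> y \<in> carrier E}"
  define N where "N = norm_closure E (lin_span E Y)"
  have Y: "Y \<subseteq> carrier E" using \<phi>(1)[OF G.one_closed] by (auto simp: Y_def)
  have YN: "Y \<subseteq> N" unfolding N_def
    using E.closure_subset[OF E.span_carrier[OF Y]] E.span_superset[of Y] by blast
  have N: "lin_subspace E N" unfolding N_def by (intro E.subspace_closure E.subspace_span Y)
  note sN = E.subspaceD[OF N]
  have Nc: "n \<in> carrier E" if "n \<in> N" for n using sN(1) that by blast
  have N_closed: "norm_closure E N \<subseteq> N"
    unfolding N_def using E.closure_idem[OF E.span_carrier[OF Y]] by simp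
  have ideal: "n \<otimes>\<^bsub>E\<^esub> y \<in> N" if n: "n \<in> N" and y: "y \<in> carrier E" for n y
  proof (rule closure_preimage[where \<phi> = "\<lambda>n. n \<otimes>\<^bsub>E\<^esub> y", OF E.pre_cstar_axioms E.pre_cstar_axioms _ subset_refl _ _ sN(1) N_closed])
    show "lin_span E Y \<subseteq> carrier E" by (rule E.span_carrier[OF Y])
    show "n \<in> norm_closure E (lin_span E Y)" using n by (simp add: N_def)
    show "cnorm E (a \<otimes>\<^bsub>E\<^esub> y \<ominus>\<^bsub>E\<^esub> b \<otimes>\<^bsub>E\<^esub> y) \<le> cnorm E y * cnorm E (a \<ominus>\<^bsub>E\<^esub> b)"
      if "a \<in> carrier E" "b \<in> carrier E" for a b
      using E.norm_mult[of "a \<ominus>\<^bsub>E\<^esub> b" y] that y by (simp add: E.minus_mult mult.commute)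
    have "lin_subspace E {n \<in> carrier E. n \<otimes>\<^bsub>E\<^esub> y \<in> N}"
      unfolding lin_subspace_def using y sN by (auto simp: E.plus_mult E.scale_mult)
    moreover have "Y \<subseteq> {n \<in> carrier E. n \<otimes>\<^bsub>E\<^esub> y \<in> N}"
    proof
      fix a assume "a \<in> Y"
      then obtain b w where a: "a = \<phi> \<one>\<^bsub>G\<^esub> b \<otimes>\<^bsub>E\<^esub> w" "b \<in> fib \<one>\<^bsub>G\<^esub>" "w \<in> carrier E" by (auto simp: Y_def)
      have "a \<otimes>\<^bsub>E\<^esub> y = \<phi> \<one>\<^bsub>G\<^esub> b \<otimes>\<^bsub>E\<^esub> (w \<otimes>\<^bsub>E\<^esub> y)"
        using a y \<phi>(1)[OF G.one_closed a(2)] by (simp add: E.mult_assoc)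
      then have "a \<otimes>\<^bsub>E\<^esub> y \<in> Y" unfolding Y_def using a(2) E.mult_in[OF a(3) y] by blast
      then show "a \<in> {n \<in> carrier E. n \<otimes>\<^bsub>E\<^esub> y \<in> N}" using \<open>a \<in> Y\<close> Y YN by blast
    qed
    ultimately have "lin_span E Y \<subseteq> {n \<in> carrier E. n \<otimes>\<^bsub>E\<^esub> y \<in> N}" by (rule E.span_least)
    then show "a \<otimes>\<^bsub>E\<^esub> y \<in> N" if "a \<in> lin_span E Y" for a using that by blast
  qed (use n y Nc in auto)
  \<comment> \<open>The projection at the range of \<kappa> is a left unit for the spanning product
    of \<kappa> and \<mu>. As \<sigma> is 1 at \<open>(\<one>, g)\<close>, the deformed product
    agrees, and the value of \<phi> lies in \<open>Y\<close>. Up to a scalar, the adjoint is the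
    value at the product of \<mu> and \<kappa>, over the inverse of \<open>g\<close>.\<close>
  have gens: "\<phi> g b \<in> N \<and> adj E (\<phi> g b) \<in> N" if g: "g \<in> carrier G" and b: "b \<in> fib_gens g" for g b
  proof -
    have unit: "\<phi> g (s \<kappa> \<otimes>\<^bsub>C\<^esub> adj C (s \<mu>)) \<in> N"
      if "\<kappa> \<in> paths \<Lambda>" "\<mu> \<in> paths \<Lambda>" "\<eta> \<kappa> \<otimes>\<^bsub>G\<^esub> inv\<^bsub>G\<^esub> \<eta> \<mu> = g" for \<kappa> \<mu> g
    proof -
      have g: "g \<in> carrier G" using that \<eta>_in by auto
      let ?b = "s \<kappa> \<otimes>\<^bsub>C\<^esub> adj C (s \<mu>)" and ?v = "rng \<Lambda> \<kappa>"
      have b: "?b \<in> fib g" using fib_gens_fib that by (auto simp: fib_gens_def)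
      have v: "?v \<in> paths \<Lambda>" "?v \<in> vertices \<Lambda>" using that rng_in vertex_in by auto
      have vf: "s ?v \<in> fib \<one>\<^bsub>G\<^esub>" using s_fib(1)[OF v(1)] \<eta>_vertex[OF v(2)] by simp
      have "s ?v \<otimes>\<^bsub>C\<^esub> ?b = ?b"
        using s_unit(1)[OF that(1)] s'(1) that v by (simp add: C.mult_assoc[symmetric])
      then have "\<phi> g ?b = \<phi> \<one>\<^bsub>G\<^esub> (s ?v) \<otimes>\<^bsub>E\<^esub> \<phi> g ?b"
        using \<phi>_mult[OF G.one_closed g vf b] g fib_in[OF b]
        by (simp add: cocycleD(2)[OF \<sigma>] C.scale_1)
      then have "\<phi> g ?b \<in> Y" unfolding Y_def using vf \<phi>(1)[OF g b] by blast
      then show ?thesis using YN by blast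
    qed
    obtain \<kappa> \<mu> where km: "\<kappa> \<in> paths \<Lambda>" "\<mu> \<in> paths \<Lambda>" "\<eta> \<kappa> \<otimes>\<^bsub>G\<^esub> inv\<^bsub>G\<^esub> \<eta> \<mu> = g"
      "b = s \<kappa> \<otimes>\<^bsub>C\<^esub> adj C (s \<mu>)" using b by (auto simp: fib_gens_def)
    have inv: "\<eta> \<mu> \<otimes>\<^bsub>G\<^esub> inv\<^bsub>G\<^esub> \<eta> \<kappa> = inv\<^bsub>G\<^esub> g"
      using km(1,2) \<eta>_in unfolding km(3)[symmetric] by (simp add: G.inv_mult_group)
    have "s \<mu> \<otimes>\<^bsub>C\<^esub> adj C (s \<kappa>) \<in> fib (inv\<^bsub>G\<^esub> g)" using fib_gens_fib km inv by (auto simp: fib_gens_def)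
    moreover have "adj C b = s \<mu> \<otimes>\<^bsub>C\<^esub> adj C (s \<kappa>)" using km s'(1) by (simp add: C.adj_mult C.adj_adj)
    ultimately have "adj E (\<phi> g b) = scale E (cnj (\<sigma> g (inv\<^bsub>G\<^esub> g))) (\<phi> (inv\<^bsub>G\<^esub> g) (s \<mu> \<otimes>\<^bsub>C\<^esub> adj C (s \<kappa>)))"
      using \<phi>_adj[OF g subsetD[OF fib_gens_fib b]] \<phi>_scale[OF G.inv_closed[OF g]] by simp
    then show ?thesis using unit[OF km(1-3)] unit[OF km(2,1) inv] sN(4) km(4) by simp
  qed
  have in_N: "\<phi> g b \<in> N \<and> adj E (\<phi> g b) \<in> N" if g: "g \<in> carrier G" and b: "b \<in> fib g" for g b
  proof -
    note sf = C.subspaceD[OF fib_subspace[of g]]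
    have Fc: "fib g \<subseteq> carrier C" by (rule sf(1))
    let ?Z = "{b \<in> fib g. \<phi> g b \<in> N \<and> adj E (\<phi> g b) \<in> N}"
    have "lin_subspace C ?Z" unfolding lin_subspace_def
    proof (intro conjI ballI allI)
      have "\<phi> g \<zero>\<^bsub>C\<^esub> = \<zero>\<^bsub>E\<^esub>" using \<phi>_scale[OF g sf(2), of 0] \<phi>(1)[OF g sf(2)] by simp
      then show "\<zero>\<^bsub>C\<^esub> \<in> ?Z" using sf(2) sN(2) by simp
      fix a assume a: "a \<in> ?Z"
      then show "scale C z a \<in> ?Z" for z
        using \<phi>(1)[OF g, of a] sf(4) sN(4) by (auto simp: \<phi>_scale[OF g] E.adj_scale)
      show "a \<oplus>\<^bsub>C\<^esub> b \<in> ?Z" if "b \<in> ?Z" for b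
        using a that \<phi>(1)[OF g, of a] \<phi>(1)[OF g, of b] sf(3) sN(3) by (auto simp: \<phi>_plus[OF g] E.adj_plus)
    qed (use Fc in auto)
    moreover have "fib_gens g \<subseteq> ?Z" using gens[OF g] fib_gens_fib by blast
    ultimately have span: "lin_span C (fib_gens g) \<subseteq> ?Z" by (rule C.span_least)
    have cl: "b \<in> norm_closure C (lin_span C (fib_gens g))" using b by (simp add: fib_eq)
    have 1: "lin_span C (fib_gens g) \<subseteq> fib g" using span by blast
    have "\<phi> g b \<in> N"
      by (rule closure_preimage[OF C.pre_cstar_axioms E.pre_cstar_axioms 1 Fc \<phi>(1)[OF g] \<phi>_lip[OF g] sN(1) N_closed _ cl b])
         (use span in auto)
    moreover have "adj E (\<phi> g b) \<in> N"
    proof (rule closure_preimage[OF C.pre_cstar_axioms E.pre_cstar_axioms 1 Fc _ _ sN(1) N_closed _ cl b])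
      show "cnorm E (adj E (\<phi> g a) \<ominus>\<^bsub>E\<^esub> adj E (\<phi> g c)) \<le> 1 * cnorm C (a \<ominus>\<^bsub>C\<^esub> c)"
        if "a \<in> fib g" "c \<in> fib g" for a c
        using \<phi>_lip[OF g that] \<phi>(1)[OF g that(1)] \<phi>(1)[OF g that(2)] by (simp add: E.adj_minus[symmetric])
    qed (use span \<phi>(1)[OF g] in auto)
    ultimately show ?thesis ..
  qed
  \<comment> \<open>\<open>N\<close> is only known to be a right ideal, so elements are kept
    together with their adjoints. Then \<open>R\<close> is closed under products: \<open>e f\<close>
    lies in \<open>N\<close> because \<open>e\<close> does, and its adjoint
    \<open>f\<^sup>*e\<^sup>*\<close> because \<open>f\<^sup>*\<close> does.\<close>
  define R where "R = {e \<in> carrier E. e \<in> N \<and> adj E e \<in> N}"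
  have Rc: "norm_closure E R \<subseteq> R"
  proof
    fix e assume e: "e \<in> norm_closure E R"
    then have ec: "e \<in> carrier E" by (simp add: norm_closure_def)
    have 1: "R \<subseteq> carrier E" by (auto simp: R_def)
    have "e \<in> N" using e E.closure_mono[of R N] N_closed by (auto simp: R_def)
    moreover have "adj E e \<in> N"
    proof (rule closure_preimage[OF E.pre_cstar_axioms E.pre_cstar_axioms 1 subset_refl _ _ sN(1) N_closed _ e ec])
      show "cnorm E (adj E a \<ominus>\<^bsub>E\<^esub> adj E c) \<le> 1 * cnorm E (a \<ominus>\<^bsub>E\<^esub> c)"
        if "a \<in> carrier E" "c \<in> carrier E" for a c
        using that by (simp add: E.adj_minus[symmetric])
    qed (auto simp: R_def)
    ultimately show "e \<in> R" using ec by (simp add: R_def)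
  qed
  \<comment> \<open>Minimality of the generated algebra is stated for C*-subalgebras of
    \<open>A\<close>; so \<open>R\<close> is compared with \<open>E\<close> through its image under
    \<open>j\<close>.\<close>
  have jR: "cstar_subalgebra A (j ` R)" unfolding cstar_subalgebra_def lin_subspace_def
  proof (intro conjI ballI allI)
    show jRA: "j ` R \<subseteq> carrier A" using h(1) by (auto simp: R_def)
    show "\<zero>\<^bsub>A\<^esub> \<in> j ` R" using sN(2) j0 by (intro image_eqI[of _ _ "\<zero>\<^bsub>E\<^esub>"]) (auto simp: R_def)
    have "norm_closure A (j ` R) \<subseteq> j ` R"
      by (rule complete_image_closed[OF E(1) A _ Rc h(1)]) (auto simp: R_def iso j_minus)
    then show "norm_closure A (j ` R) = j ` R" using A.closure_subset[OF jRA] by blast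
    fix a assume "a \<in> j ` R"
    then obtain e where e: "e \<in> R" "a = j e" by blast
    then have ec: "e \<in> carrier E" "e \<in> N" "adj E e \<in> N" by (auto simp: R_def)
    show "scale A z a \<in> j ` R" for z
      using ec e sN(4) by (intro image_eqI[of _ _ "scale E z e"]) (auto simp: R_def h E.adj_scale)
    show "adj A a \<in> j ` R"
      using ec e by (intro image_eqI[of _ _ "adj E e"]) (auto simp: R_def h E.adj_adj)
    fix b assume "b \<in> j ` R"
    then obtain f where f: "f \<in> R" "b = j f" by blast
    then have fc: "f \<in> carrier E" "f \<in> N" "adj E f \<in> N" by (auto simp: R_def)
    show "a \<oplus>\<^bsub>A\<^esub> b \<in> j ` R"
      using ec e fc f sN(3) by (intro image_eqI[of _ _ "e \<oplus>\<^bsub>E\<^esub> f"]) (auto simp: R_def h E.adj_plus)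
    show "a \<otimes>\<^bsub>A\<^esub> b \<in> j ` R"
      using ec e fc f ideal by (intro image_eqI[of _ _ "e \<otimes>\<^bsub>E\<^esub> f"]) (auto simp: R_def h E.adj_mult)
  qed
  have "x ` J \<subseteq> j ` R"
  proof
    fix a assume "a \<in> x ` J"
    then obtain g b where gb: "g \<in> carrier G" "b \<in> fib g" "a = \<psi> g b" by (auto simp: J_def x_def)
    then show "a \<in> j ` R" using \<phi>[OF gb(1,2)] in_N[OF gb(1,2)]
      by (intro image_eqI[of _ _ "\<phi> g b"]) (auto simp: R_def)
  qed
  then have "j ` carrier E \<subseteq> j ` R" by (rule min[OF jR])
  moreover have "R \<subseteq> carrier E" by (auto simp: R_def)
  ultimately have "carrier E \<subseteq> R" using inj_on_image_mem_iff[OF E(3)] by blast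
  then have NE: "N = carrier E" using sN(1) by (auto simp: R_def)
  have "fell_rep G B\<sigma> E (\<lambda>g p. \<phi> g (snd p))"
    unfolding fell_rep_def
  proof (intro conjI ballI allI)
    have "{\<phi> \<one>\<^bsub>G\<^esub> (snd b) \<otimes>\<^bsub>E\<^esub> y |b y. b \<in> fibre B\<sigma> \<one>\<^bsub>G\<^esub> \<and> y \<in> carrier E} = Y"
      unfolding Y_def by (force simp: fibre_deform_graph_bundle)
    then show "norm_closure E (lin_span E {\<phi> \<one>\<^bsub>G\<^esub> (snd b) \<otimes>\<^bsub>E\<^esub> y |b y. b \<in> fibre B\<sigma> \<one>\<^bsub>G\<^esub> \<and> y \<in> carrier E})
        = carrier E" using NE by (simp add: N_def)
  qed (auto simp: fibre_deform_graph_bundle deform_graph_bundle_sel \<phi>(1) \<phi>_plus \<phi>_scale \<phi>_mult \<phi>_adj)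
  then show ?thesis using that[OF E(1,2)] \<phi>(2) by simp
qed

end

theorem theorem4p2:
  fixes k :: nat and \<Lambda> :: "'l graph_cat" and G :: "'g monoid" and \<eta> :: "'l \<Rightarrow> 'g"
    and C :: "'a cstar" and s :: "'l \<Rightarrow> 'a"
    and B :: "('g, 'g \<times> 'a) banach_bundle" and \<sigma> :: "'g \<Rightarrow> 'g \<Rightarrow> complex"
    and D :: "'c cstar" and \<pi> :: "'g \<Rightarrow> 'g \<times> 'a \<Rightarrow> 'c" and t :: "'l \<Rightarrow> 'c"
  assumes "k_graph k \<Lambda>" and "row_finite_no_sources k \<Lambda>"
    and "group G" and "graph_functor \<Lambda> G \<eta>"
    and "graph_cstar_algebra k \<Lambda> C s"
    and "B = graph_bundle G \<Lambda> \<eta> C s"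
    and "cocycle G \<sigma>"
    and "bundle_cstar_algebra G (deform G \<sigma> B) D \<pi>"
    and "t = (\<lambda>\<kappa>. \<pi> (\<eta> \<kappa>) (\<eta> \<kappa>, s \<kappa>))"
  shows "twisted_CK_family k \<Lambda> (\<lambda>\<kappa> \<mu>. \<sigma> (\<eta> \<kappa>) (\<eta> \<mu>)) D t \<and>
    (\<forall>(A :: 'd cstar) T.
      cstar_algebra A \<and> twisted_CK_family k \<Lambda> (\<lambda>\<kappa> \<mu>. \<sigma> (\<eta> \<kappa>) (\<eta> \<mu>)) A T \<longrightarrow>
      (\<exists>\<rho>. cstar_hom D A \<rho> \<and> (\<forall>\<kappa>\<in>paths \<Lambda>. \<rho> (t \<kappa>) = T \<kappa>)))"
proof -
  have C: "cstar_algebra C" "CK_family k \<Lambda> C s"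
    and univ: "\<And>(E :: 'l test_elem cstar) S. cstar_algebra E \<Longrightarrow> CK_family k \<Lambda> E S \<Longrightarrow>
      \<exists>\<rho>. cstar_hom C E \<rho> \<and> (\<forall>\<kappa>\<in>paths \<Lambda>. \<rho> (s \<kappa>) = S \<kappa>)"
    using assms(5) unfolding graph_cstar_algebra_def by blast+
  interpret graph_setting k \<Lambda> G C \<eta> s \<sigma>
    using assms(1,3,4,7) C by (intro graph_setting.intro graph_setting_axioms.intro)
  have D: "cstar_algebra D" "fell_rep G B\<sigma> D \<pi>"
    and univD: "\<And>(E :: ('g \<times> 'a) test_elem cstar) \<psi>. cstar_algebra E \<Longrightarrow> fell_rep G B\<sigma> E \<psi> \<Longrightarrow>
      \<exists>\<rho>. cstar_hom D E \<rho> \<and> (\<forall>g\<in>carrier G. \<forall>b\<in>fibre B\<sigma> g. \<rho> (\<pi> g b) = \<psi> g b)"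
    using assms(8) unfolding assms(6) bundle_cstar_algebra_def by blast+
  show ?thesis
  proof (intro conjI allI impI)
    show "twisted_CK_family k \<Lambda> (\<lambda>\<kappa> \<mu>. \<sigma> (\<eta> \<kappa>) (\<eta> \<mu>)) D t"
      unfolding assms(9) by (rule canonical_family[OF D])
  next
    fix A :: "'d cstar" and T
    assume "cstar_algebra A \<and> twisted_CK_family k \<Lambda> (\<lambda>\<kappa> \<mu>. \<sigma> (\<eta> \<kappa>) (\<eta> \<mu>)) A T"
    then have A: "cstar_algebra A" and T: "twisted_CK_family k \<Lambda> (\<lambda>\<kappa> \<mu>. \<sigma> (\<eta> \<kappa>) (\<eta> \<mu>)) A T" by auto
    show "\<exists>\<rho>. cstar_hom D A \<rho> \<and> (\<forall>\<kappa>\<in>paths \<Lambda>. \<rho> (t \<kappa>) = T \<kappa>)"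
    proof (rule graded_map[OF univ A T], assumption, assumption)
      fix \<psi> assume \<psi>: "graded_rep A \<psi>"
        and \<psi>s: "\<And>\<kappa>. \<kappa> \<in> paths \<Lambda> \<Longrightarrow> \<psi> (\<eta> \<kappa>) (s \<kappa>) = T \<kappa>"
      \<comment> \<open>The nondegenerate representation lives on the test type of the bundle, so
        the universal property of \<open>D\<close> yields a homomorphism into \<open>E\<close>;
        composing with \<open>j\<close> returns to \<open>A\<close>.\<close>
      obtain E :: "('g \<times> 'a) test_elem cstar" and j \<pi>' where E: "cstar_algebra E" "cstar_hom E A j"
        "fell_rep G B\<sigma> E \<pi>'" and j: "\<And>g b. g \<in> carrier G \<Longrightarrow> b \<in> fib g \<Longrightarrow> j (\<pi>' g (g, b)) = \<psi> g b"
        by (rule corestriction[OF A \<psi>]) blast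
      obtain \<rho> where \<rho>: "cstar_hom D E \<rho>" "\<And>g b. g \<in> carrier G \<Longrightarrow> b \<in> fibre B\<sigma> g \<Longrightarrow> \<rho> (\<pi> g b) = \<pi>' g b"
        using univD[OF E(1,3)] by metis
      have "(j \<circ> \<rho>) (t \<kappa>) = T \<kappa>" if "\<kappa> \<in> paths \<Lambda>" for \<kappa>
        using \<rho>(2)[OF \<eta>_in[OF that], of "(\<eta> \<kappa>, s \<kappa>)"] j[OF \<eta>_in s_fib(1), OF that that] \<psi>s[OF that]
          s_fib(1)[OF that] \<eta>_in[OF that] by (simp add: assms(9) fibre_deform_graph_bundle)
      then show ?thesis using cstar_hom_comp[OF \<rho>(1) E(2)] by blast
    qed
  qed
qed

end
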